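(* Let $\epsilon>0$, $\gamma\in(0,1]$ and $T>0$. Let $f$ be a convex-concave potential function which is bounded with bounded derivatives up to order $3$ (i.e. $C^f_i<\infty$ for $i=0,1,2,3$), and let $g$ be either a quadratic potential function or a convex-concave potential function which is bounded with bounded derivatives up to order $3$ (i.e. $C^g_i<\infty$ for $i=0,1,2,3$). Let $X=C^{0,\gamma}_0(D;\mathbb{R}^d)\times C^{0,\gamma}_0(D;\mathbb{R}^d)$. For any initial condition $x_0\in X$, time interval $I_0=(-T,T)$, and body force $b:I_0\to C^{0,\gamma}_0(D;\mathbb{R}^d)$ which is continuous in time for $t\in I_0$ and satisfies $\sup_{t\in I_0}\|b(t)\|_{C^{0,\gamma}}<\infty$, there is a unique solution $y\in C^1(I_0;X)$ of $$y(t)=x_0+\int_0^t F^\epsilon(y(\tau),\tau)\,d\tau,\qquad t\in I_0,$$ or equivalently of $$y'(t)=F^\epsilon(y(t),t),\qquad y(0)=x_0,$$ where $y(t)$ and $y'(t)$ are Lipschitz continuous in time for $t\in I_0$. Here $F^\epsilon(y,t)=(y_2,\ \mathcal{L}^\epsilon(y_1)+b(t))$ for $y=(y_1,y_2)\in X$.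
   Context: Setting. $d\in\{2,3\}$, $D\subset\mathbb{R}^d$ is the material domain, $\epsilon>0$ is the horizon, $H_r(x)$ is the open ball of radius $r$ centered at $x$, and $\omega_d$ is the volume of the unit ball in $\mathbb{R}^d$. The influence function $J:[0,\infty)\to[0,\infty)$ satisfies $J(r)=0$ for $r\ge1$ and $0\le J(r)\le M<\infty$ for $r<1$. For $\gamma\in(0,1]$, $C^{0,\gamma}_0(D)=C^{0,\gamma}(D)\cap C_0(D)$, where $C_0(D)$ is the closure in the sup norm of the continuous functions with compact support in $D$; functions in $C^{0,\gamma}_0(D)$ vanish on $\partial D$ and are extended by zero outside $D$. The norm is $\|u\|_{C^{0,\gamma}}=\sup_{x\in D}|u(x)|+\sup_{x\ne y\in D}\frac{|u(x)-u(y)|}{|x-y|^\gamma}$, and $\|(y_1,y_2)\|_X=\|y_1\|_{C^{0,\gamma}}+\|y_2\|_{C^{0,\gamma}}$. The boundary function $\omega\in C^{0,\gamma}_0(D;[0,1])$ equals $1$ at points of $D$ at distance at least $\epsilon$ from $\partial D$, decays to $0$ on $\partial D$, and is extended by zero outside $D$. Potentials. $f:\mathbb{R}\to\mathbb{R}$ is convex-concave: $f(0)=f'(0)=0$, there are inflection points $r^-<0<r^+$ with $f$ convex on $[r^-,r^+]$ and concave on $(-\infty,r^-]$ and on $[r^+,\infty)$, and $f$ has finite limits $C^\pm$ at $\pm\infty$. $C^f_0=\sup_r|f(r)|$, $C^f_i=\sup_r|f^{(i)}(r)|$ for $i=1,2,3$. The function $g:\mathbb{R}\to\mathbb{R}$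 is either quadratic with a minimum at zero, $g(r)=\beta r^2/2$, or convex-concave with a well at $0$ and inflection points $r^-_*<0<r^+_*$; in the latter case $C^g_0=\sup_r|g(r)|$, $C^g_i=\sup_r|g^{(i)}(r)|$ for $i=1,2,3$. Peridynamic force. For a displacement $u$ (extended by zero outside $D$), with $e_\xi=\xi/|\xi|$, the hydrostatic strain is $$\theta(x;u)=\frac{1}{\omega_d}\int_{H_1(0)}\omega(x+\epsilon\xi)J(|\xi|)\,(u(x+\epsilon\xi)-u(x))\cdot e_\xi\,d\xi,$$ and $\mathcal{L}^\epsilon=\mathcal{L}^\epsilon_T+\mathcal{L}^\epsilon_D$ with $$\mathcal{L}^\epsilon_T(u)(x)=\frac{2}{\epsilon\omega_d}\int_{H_1(0)}\omega(x)\omega(x+\epsilon\xi)\frac{J(|\xi|)}{\sqrt{\epsilon|\xi|}}\,f'\!\left(\frac{(u(x+\epsilon\xi)-u(x))\cdot e_\xi}{\sqrt{\epsilon|\xi|}}\right)e_\xi\,d\xi,$$ $$\mathcal{L}^\epsilon_D(u)(x)=\frac{1}{\epsilon^2\omega_d}\int_{H_1(0)}\omega(x)\omega(x+\epsilon\xi)J(|\xi|)\left[g'(\theta(x+\epsilon\xi;u))+g'(\theta(x;u))\right]e_\xi\,d\xi.$$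
   Formalization: The claim that y' is Lipschitz in time fails for merely continuous b (e.g. b(t)=√|t| w with fixed w≠0); it is replaced by: y' is Lipschitz on I_0 if and only if b is. Everything else, including Lipschitz continuity of y, is as stated. *)

theory Defs
  imports "HOL-Analysis.Analysis"
begin

section \<open>The spaces C_0(D) and C_0^{0,gamma}(D)\<close>

text \<open>
  Functions on D are represented by their extension by zero, as elements of the library type of
  bounded continuous functions on the whole space. For open D the extension by zero of a
  compactly supported continuous function is continuous, and the sup norm over the whole space of a
  function vanishing off D is its sup norm over D; so the closure below is the closure in the
  sup norm over D.
\<close>

definition C0_space :: "'a::metric_space set \<Rightarrow> ('a \<Rightarrow>\<^sub>C 'b::real_normed_vector) set" where
  "C0_space D = closure {\<phi>. compact (closure {x. apply_bcontfun \<phi> x \<noteq> 0}) \<and>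
                            closure {x. apply_bcontfun \<phi> x \<noteq> 0} \<subseteq> D}"

definition holder_quotients ::
    "real \<Rightarrow> 'a::metric_space set \<Rightarrow> ('a \<Rightarrow>\<^sub>C 'b::real_normed_vector) \<Rightarrow> real set" where
  "holder_quotients \<gamma> D u =
     {dist (u x) (u y) / dist x y powr \<gamma> | x y. x \<in> D \<and> y \<in> D \<and> x \<noteq> y}"

definition C0_holder :: "real \<Rightarrow> 'a::metric_space set \<Rightarrow> ('a \<Rightarrow>\<^sub>C 'b::real_normed_vector) set" where
  "C0_holder \<gamma> D = {u \<in> C0_space D. bdd_above (holder_quotients \<gamma> D u)}"

definition holder_norm :: "real \<Rightarrow> 'a::metric_space set \<Rightarrow> ('a \<Rightarrow>\<^sub>C 'b::real_normed_vector) \<Rightarrow> real" where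
  "holder_norm \<gamma> D u = (SUP x\<in>D. norm (u x)) + Sup (holder_quotients \<gamma> D u)"

definition X_space ::
    "real \<Rightarrow> 'a::metric_space set \<Rightarrow> (('a \<Rightarrow>\<^sub>C 'b::real_normed_vector) \<times> ('a \<Rightarrow>\<^sub>C 'b)) set" where
  "X_space \<gamma> D = C0_holder \<gamma> D \<times> C0_holder \<gamma> D"

definition X_norm ::
    "real \<Rightarrow> 'a::metric_space set \<Rightarrow> ('a \<Rightarrow>\<^sub>C 'b::real_normed_vector) \<times> ('a \<Rightarrow>\<^sub>C 'b) \<Rightarrow> real" where
  "X_norm \<gamma> D y = holder_norm \<gamma> D (fst y) + holder_norm \<gamma> D (snd y)"

section \<open>Calculus with respect to a norm on a subspace\<close>

text \<open>
  The Hoelder norm depends on D and gamma, so it cannot be the type class norm (which on bounded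
  continuous functions is the sup norm). The following notions are the library's continuity, vector
  derivative and integral with an arbitrary norm N, on a carrier S, in place of the class norm.
\<close>

definition continuous_wrt :: "('v::real_vector \<Rightarrow> real) \<Rightarrow> real set \<Rightarrow> (real \<Rightarrow> 'v) \<Rightarrow> bool" where
  "continuous_wrt N I y \<longleftrightarrow> (\<forall>t\<in>I. ((\<lambda>s. N (y s - y t)) \<longlongrightarrow> 0) (at t within I))"

definition lipschitz_wrt :: "('v::real_vector \<Rightarrow> real) \<Rightarrow> real set \<Rightarrow> (real \<Rightarrow> 'v) \<Rightarrow> bool" where
  "lipschitz_wrt N I y \<longleftrightarrow> (\<exists>L. \<forall>s\<in>I. \<forall>t\<in>I. N (y s - y t) \<le> L * \<bar>s - t\<bar>)"

definition has_derivative_wrt ::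
    "('v::real_vector \<Rightarrow> real) \<Rightarrow> real set \<Rightarrow> (real \<Rightarrow> 'v) \<Rightarrow> 'v \<Rightarrow> real \<Rightarrow> bool" where
  "has_derivative_wrt N I y d t \<longleftrightarrow>
     ((\<lambda>s. N ((y s - y t) /\<^sub>R (s - t) - d)) \<longlongrightarrow> 0) (at t within I)"

definition C1_wrt ::
    "'v::real_vector set \<Rightarrow> ('v \<Rightarrow> real) \<Rightarrow> real set \<Rightarrow> (real \<Rightarrow> 'v) \<Rightarrow> (real \<Rightarrow> 'v) \<Rightarrow> bool" where
  "C1_wrt S N I y y' \<longleftrightarrow>
     y ` I \<subseteq> S \<and> y' ` I \<subseteq> S \<and> (\<forall>t\<in>I. has_derivative_wrt N I y (y' t) t) \<and> continuous_wrt N I y'"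

definition has_integral_wrt ::
    "'v::real_vector set \<Rightarrow> ('v \<Rightarrow> real) \<Rightarrow> (real \<Rightarrow> 'v) \<Rightarrow> 'v \<Rightarrow> real \<Rightarrow> real \<Rightarrow> bool" where
  "has_integral_wrt S N h i a b \<longleftrightarrow> h ` {a..b} \<subseteq> S \<and> i \<in> S \<and>
     ((\<lambda>p. N ((\<Sum>(x,k)\<in>p. measure lborel k *\<^sub>R h x) - i)) \<longlongrightarrow> 0) (division_filter {a..b})"

text \<open>The integral of h from 0 to t equals i, with the usual sign convention for t < 0.\<close>

definition has_integral_from_0 ::
    "'v::real_vector set \<Rightarrow> ('v \<Rightarrow> real) \<Rightarrow> (real \<Rightarrow> 'v) \<Rightarrow> 'v \<Rightarrow> real \<Rightarrow> bool" where
  "has_integral_from_0 S N h i t \<longleftrightarrow>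
     (if 0 \<le> t then has_integral_wrt S N h i 0 t else has_integral_wrt S N h (- i) t 0)"

section \<open>Potentials, influence function and boundary function\<close>

definition convex_concave :: "(real \<Rightarrow> real) \<Rightarrow> bool" where
  "convex_concave f \<longleftrightarrow> f 0 = 0 \<and> (f has_real_derivative 0) (at 0) \<and>
     (\<exists>rm rp. rm < 0 \<and> 0 < rp \<and>
        convex_on {rm..rp} f \<and> concave_on {..rm} f \<and> concave_on {rp..} f) \<and>
     (\<exists>Cm. (f \<longlongrightarrow> Cm) at_bot) \<and> (\<exists>Cp. (f \<longlongrightarrow> Cp) at_top)"

definition bounded_derivs_upto :: "nat \<Rightarrow> (real \<Rightarrow> real) \<Rightarrow> bool" where
  "bounded_derivs_upto n f \<longleftrightarrow>
     (\<forall>i<n. \<forall>r. ((deriv ^^ i) f) differentiable (at r)) \<and>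
     (\<forall>i\<le>n. bounded (range ((deriv ^^ i) f)))"

definition quadratic_potential :: "(real \<Rightarrow> real) \<Rightarrow> bool" where
  "quadratic_potential g \<longleftrightarrow> (\<exists>\<beta>>0. \<forall>r. g r = \<beta> * r\<^sup>2 / 2)"

text \<open>
  The type argument fixes the dimension. Measurability is required of the radial function on
  the space itself, which is what the integrals below need.
\<close>

definition influence_function :: "'n::finite itself \<Rightarrow> (real \<Rightarrow> real) \<Rightarrow> bool" where
  "influence_function _ J \<longleftrightarrow>
     (\<forall>r\<ge>0. 0 \<le> J r) \<and> (\<forall>r\<ge>1. J r = 0) \<and> (\<exists>M. \<forall>r. 0 \<le> r \<and> r < 1 \<longrightarrow> J r \<le> M) \<and>
     (\<lambda>\<xi>::real^'n. J (norm \<xi>)) \<in> borel_measurable lebesgue"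

definition boundary_function ::
    "real \<Rightarrow> real \<Rightarrow> 'a::metric_space set \<Rightarrow> ('a \<Rightarrow>\<^sub>C real) \<Rightarrow> bool" where
  "boundary_function \<epsilon> \<gamma> D \<omega> \<longleftrightarrow> \<omega> \<in> C0_holder \<gamma> D \<and> (\<forall>x. \<omega> x \<in> {0..1}) \<and>
     (\<forall>x\<in>D. (\<forall>y\<in>frontier D. \<epsilon> \<le> dist x y) \<longrightarrow> \<omega> x = 1)"

section \<open>The peridynamic force\<close>

text \<open>In the following definitions, sgn xi is the unit vector xi / |xi|.\<close>

definition hydrostatic_strain ::
    "real \<Rightarrow> (real^'n \<Rightarrow> real) \<Rightarrow> (real \<Rightarrow> real) \<Rightarrow> (real^'n \<Rightarrow> real^'n) \<Rightarrow> real^'n \<Rightarrow> real" where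
  "hydrostatic_strain \<epsilon> \<omega> J u x =
     1 / measure lebesgue (ball (0::real^'n) 1) *
     (LINT \<xi>:ball 0 1|lebesgue.
        \<omega> (x + \<epsilon> *\<^sub>R \<xi>) * J (norm \<xi>) * ((u (x + \<epsilon> *\<^sub>R \<xi>) - u x) \<bullet> sgn \<xi>))"

definition tensile_force ::
    "real \<Rightarrow> (real^'n \<Rightarrow> real) \<Rightarrow> (real \<Rightarrow> real) \<Rightarrow> (real \<Rightarrow> real) \<Rightarrow>
     (real^'n \<Rightarrow> real^'n) \<Rightarrow> real^'n \<Rightarrow> real^'n" where
  "tensile_force \<epsilon> \<omega> J f u x =
     (2 / (\<epsilon> * measure lebesgue (ball (0::real^'n) 1))) *\<^sub>R
     (LINT \<xi>:ball 0 1|lebesgue.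
        (\<omega> x * \<omega> (x + \<epsilon> *\<^sub>R \<xi>) * (J (norm \<xi>) / sqrt (\<epsilon> * norm \<xi>)) *
         deriv f (((u (x + \<epsilon> *\<^sub>R \<xi>) - u x) \<bullet> sgn \<xi>) / sqrt (\<epsilon> * norm \<xi>))) *\<^sub>R sgn \<xi>)"

definition dilatational_force ::
    "real \<Rightarrow> (real^'n \<Rightarrow> real) \<Rightarrow> (real \<Rightarrow> real) \<Rightarrow> (real \<Rightarrow> real) \<Rightarrow>
     (real^'n \<Rightarrow> real^'n) \<Rightarrow> real^'n \<Rightarrow> real^'n" where
  "dilatational_force \<epsilon> \<omega> J g u x =
     (1 / (\<epsilon>\<^sup>2 * measure lebesgue (ball (0::real^'n) 1))) *\<^sub>R
     (LINT \<xi>:ball 0 1|lebesgue.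
        (\<omega> x * \<omega> (x + \<epsilon> *\<^sub>R \<xi>) * J (norm \<xi>) *
         (deriv g (hydrostatic_strain \<epsilon> \<omega> J u (x + \<epsilon> *\<^sub>R \<xi>)) +
          deriv g (hydrostatic_strain \<epsilon> \<omega> J u x))) *\<^sub>R sgn \<xi>)"

definition peridynamic_force ::
    "real \<Rightarrow> (real^'n \<Rightarrow> real) \<Rightarrow> (real \<Rightarrow> real) \<Rightarrow> (real \<Rightarrow> real) \<Rightarrow> (real \<Rightarrow> real) \<Rightarrow>
     (real^'n \<Rightarrow> real^'n) \<Rightarrow> real^'n \<Rightarrow> real^'n" where
  "peridynamic_force \<epsilon> \<omega> J f g u x = tensile_force \<epsilon> \<omega> J f u x + dilatational_force \<epsilon> \<omega> J g u x"

text \<open>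
  For displacements in the Hoelder space the force is again bounded and continuous, so that
  Bcontfun merely packages it.
\<close>

definition F_peri ::
    "real \<Rightarrow> ((real^'n) \<Rightarrow>\<^sub>C real) \<Rightarrow> (real \<Rightarrow> real) \<Rightarrow> (real \<Rightarrow> real) \<Rightarrow> (real \<Rightarrow> real) \<Rightarrow>
     (real \<Rightarrow> ((real^'n) \<Rightarrow>\<^sub>C (real^'n))) \<Rightarrow>
     ((real^'n) \<Rightarrow>\<^sub>C (real^'n)) \<times> ((real^'n) \<Rightarrow>\<^sub>C (real^'n)) \<Rightarrow> real \<Rightarrow>
     ((real^'n) \<Rightarrow>\<^sub>C (real^'n)) \<times> ((real^'n) \<Rightarrow>\<^sub>C (real^'n))" where
  "F_peri \<epsilon> \<omega> J f g b y t =
     (snd y, Bcontfun (peridynamic_force \<epsilon> \<omega> J f g (fst y)) + b t)"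

section \<open>The initial value problem in integral and differential form\<close>

definition solves_integral_eq ::
    "'v::real_vector set \<Rightarrow> ('v \<Rightarrow> real) \<Rightarrow> real set \<Rightarrow> ('v \<Rightarrow> real \<Rightarrow> 'v) \<Rightarrow> 'v \<Rightarrow> (real \<Rightarrow> 'v) \<Rightarrow> bool" where
  "solves_integral_eq S N I F x0 y \<longleftrightarrow>
     (\<forall>t\<in>I. has_integral_from_0 S N (\<lambda>\<tau>. F (y \<tau>) \<tau>) (y t - x0) t)"

definition solves_ivp ::
    "real set \<Rightarrow> ('v \<Rightarrow> real \<Rightarrow> 'v) \<Rightarrow> 'v \<Rightarrow> (real \<Rightarrow> 'v) \<Rightarrow> (real \<Rightarrow> 'v) \<Rightarrow> bool" where
  "solves_ivp I F x0 y y' \<longleftrightarrow> y 0 = x0 \<and> (\<forall>t\<in>I. y' t = F (y t) t)"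

end

theory Submission
  imports Defs
begin

text \<open>
  The Hoelder norm is only lower semicontinuous for uniform convergence, and the peridynamic force
  is only locally Lipschitz for it: the difference of two forces contains the second difference
  of \<open>f'\<close> and so the product of a displacement difference with a Hoelder seminorm. The proof
  does not continue local solutions; it uses the two norms for two different purposes.

  In the sup norm the force is globally Lipschitz, because \<open>f'\<close> and \<open>g'\<close> are. The Picard iterates
  therefore converge uniformly on the whole open interval, in the weighted norm with weight
  \<open>exp (2 \<Lambda> \<bar>t\<bar>)\<close>, and solutions are unique. In the Hoelder norm the force grows at most linearly, so
  one bound \<open>M exp (2 \<Lambda> \<bar>t\<bar>)\<close> holds for the Hoelder norms of all iterates. Balls of the Hoelder norm are
  closed under uniform limits (\<open>normed_subspace_X_space\<close>), so the limit stays in the space with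
  the same bound. Only afterwards is the local Lipschitz estimate used, on that bounded set: it makes
  the right-hand side continuous (Lipschitz if the body force is) in the Hoelder norm, and closedness
  of the balls transfers this to the difference quotients and to the Riemann sums of the solution
  (\<open>picard_fixed_point_regular\<close>, \<open>Riemann_sums_converge_wrt\<close>). This part is
  carried out for an abstract subspace with a finer norm and an autonomous field plus a forcing term
  (\<open>forced_evolution_well_posed\<close>).

  The estimates on the force rest on
  \<open>\<bar>h a - h b - (h c - h d)\<bar> \<le> K * \<bar>(a - b) - (c - d)\<bar> + K * \<bar>a - b\<bar> * \<bar>b - d\<bar>\<close>
  for \<open>h = f'\<close> or \<open>h = g'\<close> (\<open>second_difference_bound\<close>). Its right-hand side contains the variation of
  only one of the two displacements. Taking that one to be zero yields linear growth, so a single kind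
  of estimate (\<open>tame\<close>) gives growth and local Lipschitz continuity, and it is stable under
  composition and under integration over bonds. The worst bond weight is \<open>|\<xi>|\<close> to the power \<open>-3/2\<close>,
  one half for the weight in front of \<open>f'\<close> and one half for each factor of the product above; it is
  integrable because the dimension is at least two (\<open>integrable_norm_powr_ball\<close>). The
  outer factor \<open>\<omega>(x)\<close> puts the force into the closure of the compactly supported functions.
\<close>

section \<open>Subspaces with a finer norm whose balls are closed\<close>

lemma has_integral_interval_iff:
  fixes h :: "real \<Rightarrow> 'a::real_normed_vector"
  shows "(h has_integral i) {a..b} \<longleftrightarrow>
    ((\<lambda>p. \<Sum>(x,k)\<in>p. measure lborel k *\<^sub>R h x) \<longlongrightarrow> i) (division_filter {a..b})"
  unfolding box_real[symmetric] by (rule has_integral_cbox)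

text \<open>
  The last assumption is lower semicontinuity of \<open>N\<close> together with closedness of \<open>N\<close>-bounded sets in the
  ambient Banach space. It replaces completeness of \<open>X\<close>: integrals and limits are taken in the
  ambient norm and shown to stay in \<open>X\<close>.
\<close>

locale normed_subspace =
  fixes X :: "'e::banach set" and N :: "'e \<Rightarrow> real"
  assumes subspace_X: "subspace X"
    and N_add: "x \<in> X \<Longrightarrow> y \<in> X \<Longrightarrow> N (x + y) \<le> N x + N y"
    and N_scale: "x \<in> X \<Longrightarrow> N (c *\<^sub>R x) \<le> \<bar>c\<bar> * N x"
    and norm_le_N: "x \<in> X \<Longrightarrow> norm x \<le> N x"
    and closed_N_ball: "closed {x \<in> X. N x \<le> c}"
begin

lemma X_0: "0 \<in> X" and X_add: "x \<in> X \<Longrightarrow> y \<in> X \<Longrightarrow> x + y \<in> X"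
  and X_diff: "x \<in> X \<Longrightarrow> y \<in> X \<Longrightarrow> x - y \<in> X" and X_scale: "x \<in> X \<Longrightarrow> c *\<^sub>R x \<in> X"
  and X_minus: "x \<in> X \<Longrightarrow> - x \<in> X"
  using subspace_X by (auto simp: subspace_0 subspace_add subspace_diff subspace_scale subspace_neg)

lemma N_nonneg: "x \<in> X \<Longrightarrow> 0 \<le> N x"
  using norm_le_N norm_ge_zero order_trans by blast

lemma N_0: "N 0 = 0"
  using N_scale[OF X_0, of 0] N_nonneg[OF X_0] by simp

lemma N_minus: "x \<in> X \<Longrightarrow> N (- x) = N x"
  using N_scale[of x "-1"] N_scale[of "-x" "-1"] X_minus[of x] by fastforce

lemma N_minus_commute: "x \<in> X \<Longrightarrow> y \<in> X \<Longrightarrow> N (x - y) = N (y - x)"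
  using N_minus[of "x - y"] X_diff by simp

lemma N_sum: "finite S \<Longrightarrow> (\<And>i. i \<in> S \<Longrightarrow> u i \<in> X) \<Longrightarrow> sum u S \<in> X \<and> N (sum u S) \<le> (\<Sum>i\<in>S. N (u i))"
proof (induction S rule: finite_induct)
  case empty
  then show ?case using X_0 N_0 by simp
next
  case (insert i S)
  then have "sum u S \<in> X" "u i \<in> X" "N (sum u S) \<le> (\<Sum>i\<in>S. N (u i))"
    by simp_all
  then show ?case using N_add[of "u i" "sum u S"] X_add insert(1,2) by simp
qed

lemma Riemann_sum_in_X:
  fixes a b :: real
  assumes p: "p tagged_division_of {a..b}" and hX: "h ` {a..b} \<subseteq> X"
  shows "(\<Sum>(x,k)\<in>p. measure lborel k *\<^sub>R h x) \<in> X"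
proof -
  have "measure lborel (snd z) *\<^sub>R h (fst z) \<in> X" if "z \<in> p" for z
    using tag_in_interval[OF p, of "fst z" "snd z"] that hX X_scale by (simp add: image_subset_iff)
  then show ?thesis
    using N_sum[of p "\<lambda>z. measure lborel (snd z) *\<^sub>R h (fst z)"] p
    by (simp add: case_prod_unfold tagged_division_of_finite)
qed

text \<open>
  The Riemann sums of \<open>h\<close> have \<open>N\<close> at most the Riemann sums of \<open>\<phi>\<close>, hence lie in the ball of radius
  \<open>I + e\<close> along a fine enough gauge; that ball is closed for the ambient norm.
\<close>

lemma has_integral_in_subspace:
  fixes a b :: real
  assumes h: "(h has_integral i) {a..b}" and \<phi>: "(\<phi> has_integral I) {a..b}"
    and bd: "\<And>\<tau>. \<tau> \<in> {a..b} \<Longrightarrow> h \<tau> \<in> X \<and> N (h \<tau>) \<le> \<phi> \<tau>"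
  shows "i \<in> X \<and> N i \<le> I"
proof -
  have step: "i \<in> X \<and> N i \<le> I + e" if e: "e > 0" for e
  proof -
    have lim: "((\<lambda>p. \<Sum>(x,k)\<in>p. measure lborel k *\<^sub>R h x) \<longlongrightarrow> i) (division_filter {a..b})"
      using h by (simp only: has_integral_interval_iff)
    have "((\<lambda>p. \<Sum>(x,k)\<in>p. measure lborel k *\<^sub>R \<phi> x) \<longlongrightarrow> I) (division_filter {a..b})"
      using \<phi> by (simp only: has_integral_interval_iff)
    then have "\<forall>\<^sub>F p in division_filter {a..b}. dist (\<Sum>(x,k)\<in>p. measure lborel k *\<^sub>R \<phi> x) I < e"
      using e tendstoD by blast
    moreover have "\<forall>\<^sub>F p in division_filter {a..b}. p tagged_division_of {a..b}"
      by (rule eventually_division_filter_tagged_division)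
    ultimately have "\<forall>\<^sub>F p in division_filter {a..b}.
        (\<Sum>(x,k)\<in>p. measure lborel k *\<^sub>R h x) \<in> {x \<in> X. N x \<le> I + e}"
    proof eventually_elim
      case (elim p)
      have xk: "h x \<in> X \<and> N (h x) \<le> \<phi> x" if "(x,k) \<in> p" for x k
        using bd tag_in_interval[OF elim(2) that] by blast
      let ?u = "\<lambda>z. measure lborel (snd z) *\<^sub>R h (fst z)"
      have fin: "finite p" using elim(2) by blast
      have "sum ?u p \<in> X \<and> N (sum ?u p) \<le> (\<Sum>z\<in>p. N (?u z))"
        using fin xk by (intro N_sum) (auto intro!: X_scale)
      moreover have "(\<Sum>z\<in>p. N (?u z)) \<le> (\<Sum>z\<in>p. measure lborel (snd z) *\<^sub>R \<phi> (fst z))"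
      proof (rule sum_mono)
        fix z assume "z \<in> p"
        then have z: "h (fst z) \<in> X \<and> N (h (fst z)) \<le> \<phi> (fst z)"
          using xk[of "fst z" "snd z"] by simp
        have "N (?u z) \<le> measure lborel (snd z) * N (h (fst z))"
          using N_scale[of "h (fst z)" "measure lborel (snd z)"] z by simp
        also have "\<dots> \<le> measure lborel (snd z) * \<phi> (fst z)"
          using z by (intro mult_left_mono) auto
        finally show "N (?u z) \<le> measure lborel (snd z) *\<^sub>R \<phi> (fst z)" by simp
      qed
      moreover have "(\<Sum>z\<in>p. measure lborel (snd z) *\<^sub>R \<phi> (fst z)) < I + e"
        using elim(1) by (simp add: dist_real_def case_prod_unfold)
      ultimately show ?case by (simp add: case_prod_unfold)
    qed
    then have "i \<in> {x \<in> X. N x \<le> I + e}"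
      using Lim_in_closed_set[OF closed_N_ball _ _ lim] division_filter_not_empty[of a b] by simp
    then show ?thesis by simp
  qed
  from step[of 1] have "i \<in> X" by simp
  moreover have "N i \<le> I"
    by (rule field_le_epsilon) (use step in simp)
  ultimately show ?thesis by simp
qed

text \<open>
  An ambient integral is also an integral for the finer norm as soon as the integrand is continuous for
  it. On a piece of a division on which \<open>h\<close> stays \<open>N\<close>-close to its value at the tag, the previous
  lemma bounds the error of the Riemann sum. The gauge may depend on the tag, so pointwise continuity is
  enough to choose it.
\<close>

lemma Riemann_sums_converge_wrt:
  assumes hX: "h ` {a..b} \<subseteq> X" and cN: "continuous_wrt N {a..b} h" and h: "(h has_integral i) {a..b}"
  shows "has_integral_wrt X N h i a b"
proof -
  have hint: "h integrable_on cbox a b" using h by auto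
  have approx: "\<exists>\<gamma>. gauge \<gamma> \<and> (\<forall>p. p tagged_division_of {a..b} \<and> \<gamma> fine p \<longrightarrow>
      i \<in> X \<and> N ((\<Sum>(x,k)\<in>p. measure lborel k *\<^sub>R h x) - i) \<le> e * measure lborel {a..b})" if e: "e > 0" for e
  proof -
    have "\<exists>d>0. \<forall>s\<in>{a..b}. dist s x < d \<longrightarrow> N (h s - h x) \<le> e" if x: "x \<in> {a..b}" for x
    proof -
      have "((\<lambda>s. N (h s - h x)) \<longlongrightarrow> 0) (at x within {a..b})"
        using cN x by (simp add: continuous_wrt_def)
      then have "\<forall>\<^sub>F s in at x within {a..b}. dist (N (h s - h x)) 0 < e"
        using e tendstoD by blast
      then obtain d where d: "d > 0" "\<forall>s\<in>{a..b}. s \<noteq> x \<and> dist s x < d \<longrightarrow> dist (N (h s - h x)) 0 < e"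
        unfolding eventually_at by blast
      have "N (h s - h x) \<le> e" if "s \<in> {a..b}" "dist s x < d" for s
        using d(2) that e N_0 by (cases "s = x") (auto simp: dist_real_def abs_if split: if_splits)
      then show ?thesis using d(1) by blast
    qed
    then obtain \<delta> where \<delta>: "\<And>x. x \<in> {a..b} \<Longrightarrow> \<delta> x > 0 \<and> (\<forall>s\<in>{a..b}. dist s x < \<delta> x \<longrightarrow> N (h s - h x) \<le> e)"
      by metis
    define \<gamma> where "\<gamma> x = ball x (if x \<in> {a..b} then \<delta> x else 1)" for x
    have g: "gauge \<gamma>" unfolding gauge_def \<gamma>_def using \<delta> by auto
    have close: "i \<in> X \<and> N ((\<Sum>(x,k)\<in>p. measure lborel k *\<^sub>R h x) - i) \<le> e * measure lborel {a..b}"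
      if p: "p tagged_division_of {a..b}" and fine: "\<gamma> fine p" for p
    proof -
      have p': "p tagged_division_of cbox a b" using p by simp
      have fin: "finite p" using p by blast
      have piece: "measure lborel (snd z) *\<^sub>R h (fst z) - integral (snd z) h \<in> X \<and>
            N (measure lborel (snd z) *\<^sub>R h (fst z) - integral (snd z) h) \<le> measure lborel (snd z) *\<^sub>R e"
        if z: "z \<in> p" for z
      proof -
        obtain x k where xk: "z = (x,k)" by fastforce
        have x: "x \<in> k" "k \<subseteq> {a..b}" using tagged_division_ofD(2,3)[OF p] z xk by auto
        obtain c d where k: "k = {c..d}"
          using tagged_division_ofD(4)[OF p, of x k] z xk by auto
        have "k \<subseteq> \<gamma> x" using fine z xk unfolding fine_def by blast
        then have sub: "k \<subseteq> ball x (\<delta> x)" using x unfolding \<gamma>_def by (simp add: subset_iff)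
        have "(h has_integral integral k h) {c..d}"
          using integrable_on_subcbox[OF hint, of c d] k x(2) by auto
        then have "((\<lambda>s. h x - h s) has_integral measure lborel k *\<^sub>R h x - integral k h) {c..d}"
          using has_integral_diff[OF has_integral_const_real] k by blast
        moreover have "((\<lambda>s. e) has_integral measure lborel k *\<^sub>R e) {c..d}"
          using has_integral_const_real k by blast
        moreover have "h x - h s \<in> X \<and> N (h x - h s) \<le> e" if "s \<in> {c..d}" for s
        proof -
          have s: "s \<in> {a..b}" "dist s x < \<delta> x" "x \<in> {a..b}" using that k x sub by (auto simp: dist_commute)
          then have "h s \<in> X" "h x \<in> X" using hX by auto
          then show ?thesis using \<delta>[OF s(3)] s(1,2) N_minus_commute[of "h x" "h s"] X_diff by auto
        qed
        ultimately have "measure lborel k *\<^sub>R h x - integral k h \<in> X \<and> N (measure lborel k *\<^sub>R h x - integral k h) \<le> measure lborel k *\<^sub>R e"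
          using has_integral_in_subspace by blast
        then show ?thesis using xk by simp
      qed
      let ?v = "\<lambda>z. measure lborel (snd z) *\<^sub>R h (fst z) - integral (snd z) h"
      have "i = (\<Sum>(x,k)\<in>p. integral k h)"
        using integral_combine_tagged_division_topdown[OF hint p'] integral_unique[OF h] by simp
      then have S: "(\<Sum>(x,k)\<in>p. measure lborel k *\<^sub>R h x) - i = sum ?v p"
        by (simp add: case_prod_unfold sum_subtractf)
      have v: "sum ?v p \<in> X \<and> N (sum ?v p) \<le> (\<Sum>z\<in>p. N (?v z))"
        using fin piece by (intro N_sum) auto
      have "(\<Sum>z\<in>p. N (?v z)) \<le> (\<Sum>z\<in>p. measure lborel (snd z) *\<^sub>R e)"
        using piece by (intro sum_mono) auto
      also have "\<dots> = e * measure lborel {a..b}"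
        using additive_content_tagged_division[OF p']
        by (simp add: case_prod_unfold sum_distrib_right[symmetric])
      finally have le: "N (sum ?v p) \<le> e * measure lborel {a..b}" using v by simp
      have "(\<Sum>(x,k)\<in>p. measure lborel k *\<^sub>R h x) - sum ?v p \<in> X"
        using Riemann_sum_in_X[OF p hX] v by (intro X_diff) auto
      moreover have "R - (R - i) = i" for R by simp
      ultimately have "i \<in> X" unfolding S[symmetric] by (simp only:)
      then show ?thesis unfolding S using le by (simp only: simp_thms)
    qed
    show ?thesis by (rule exI[of _ \<gamma>], rule conjI[OF g], intro allI impI, elim conjE, rule close)
  qed
  have iX: "i \<in> X"
  proof -
    obtain \<gamma> where \<gamma>: "gauge \<gamma>" "\<forall>p. p tagged_division_of cbox a b \<and> \<gamma> fine p \<longrightarrow> i \<in> X"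
      using approx[of 1] box_real(2)[of a b] zero_less_one by metis
    obtain p where "p tagged_division_of cbox a b" "\<gamma> fine p"
      using fine_division_exists[OF \<gamma>(1)] by metis
    then show ?thesis using \<gamma>(2) by metis
  qed
  have "((\<lambda>p. N ((\<Sum>(x,k)\<in>p. measure lborel k *\<^sub>R h x) - i)) \<longlongrightarrow> 0) (division_filter {a..b})"
  proof (rule tendstoI)
    fix e :: real assume e: "e > 0"
    define e' where "e' = e / (measure lborel {a..b} + 1)"
    have e': "e' > 0" using e by (simp add: e'_def add_nonneg_pos)
    have lt: "e' * measure lborel {a..b} < e"
    proof -
      have "e' * measure lborel {a..b} < e' * (measure lborel {a..b} + 1)" using e' by simp
      also have "\<dots> = e" using measure_nonneg[of lborel "{a..b}"] by (simp add: e'_def)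
      finally show ?thesis .
    qed
    obtain \<gamma> where \<gamma>: "gauge \<gamma>" "\<forall>p. p tagged_division_of {a..b} \<and> \<gamma> fine p \<longrightarrow>
        N ((\<Sum>(x,k)\<in>p. measure lborel k *\<^sub>R h x) - i) \<le> e' * measure lborel {a..b}"
      using approx[OF e'] by metis
    have "dist (N ((\<Sum>(x,k)\<in>p. measure lborel k *\<^sub>R h x) - i)) 0 < e"
      if p: "p tagged_division_of {a..b}" and fine: "\<gamma> fine p" for p
    proof -
      have "0 \<le> N ((\<Sum>(x,k)\<in>p. measure lborel k *\<^sub>R h x) - i)"
        using Riemann_sum_in_X[OF p hX] iX by (intro N_nonneg X_diff)
      moreover have "N ((\<Sum>(x,k)\<in>p. measure lborel k *\<^sub>R h x) - i) \<le> e' * measure lborel {a..b}"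
        using \<gamma>(2) p fine by metis
      ultimately show ?thesis using lt by (simp add: dist_real_def)
    qed
    then show "\<forall>\<^sub>F p in division_filter {a..b}. dist (N ((\<Sum>(x,k)\<in>p. measure lborel k *\<^sub>R h x) - i)) 0 < e"
      unfolding eventually_division_filter using \<gamma>(1) by metis
  qed
  then show ?thesis using hX iX by (simp add: has_integral_wrt_def)
qed

lemma has_integral_of_wrt:
  assumes "has_integral_wrt X N h i a b"
  shows "(h has_integral i) {a..b}"
proof -
  have hX: "h ` {a..b} \<subseteq> X" and iX: "i \<in> X"
    and lim: "((\<lambda>p. N ((\<Sum>(x,k)\<in>p. measure lborel k *\<^sub>R h x) - i)) \<longlongrightarrow> 0) (division_filter {a..b})"
    using assms by (auto simp: has_integral_wrt_def)
  have "\<forall>\<^sub>F p in division_filter {a..b}. norm ((\<Sum>(x,k)\<in>p. measure lborel k *\<^sub>R h x) - i)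
      \<le> N ((\<Sum>(x,k)\<in>p. measure lborel k *\<^sub>R h x) - i)"
    using eventually_division_filter_tagged_division[of "{a..b}"]
  proof eventually_elim
    case (elim p)
    show ?case using Riemann_sum_in_X[OF elim hX] iX by (intro norm_le_N X_diff)
  qed
  then have "((\<lambda>p. (\<Sum>(x,k)\<in>p. measure lborel k *\<^sub>R h x) - i) \<longlongrightarrow> 0) (division_filter {a..b})"
    using Lim_null_comparison[OF _ lim] by simp
  then have "((\<lambda>p. (\<Sum>(x,k)\<in>p. measure lborel k *\<^sub>R h x)) \<longlongrightarrow> i) (division_filter {a..b})"
    by (simp add: LIM_zero_iff)
  then show ?thesis by (simp only: has_integral_interval_iff)
qed

lemma continuous_on_of_wrt:
  fixes I :: "real set"
  assumes hX: "h ` I \<subseteq> X" and c: "continuous_wrt N I h"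
  shows "continuous_on I h"
  unfolding continuous_on_def
proof
  fix t assume t: "t \<in> I"
  have "norm (h s - h t) \<le> N (h s - h t)" if "s \<in> I" for s
    using hX t that by (intro norm_le_N X_diff) auto
  then have ev: "\<forall>\<^sub>F s in at t within I. norm (h s - h t) \<le> N (h s - h t)"
    by (simp add: eventually_at_filter)
  have "((\<lambda>s. N (h s - h t)) \<longlongrightarrow> 0) (at t within I)"
    using c t by (simp add: continuous_wrt_def)
  then have "((\<lambda>s. h s - h t) \<longlongrightarrow> 0) (at t within I)"
    by (rule Lim_null_comparison[OF ev])
  then show "(h \<longlongrightarrow> h t) (at t within I)" by (simp add: LIM_zero_iff)
qed

lemma has_vector_derivative_of_wrt:
  fixes I :: "real set"
  assumes yX: "y ` I \<subseteq> X" and d: "d \<in> X" and t: "t \<in> I" and D: "has_derivative_wrt N I y d t"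
  shows "(y has_vector_derivative d) (at t within I)"
proof -
  have "norm ((y s - y t) /\<^sub>R (s - t) - d) \<le> N ((y s - y t) /\<^sub>R (s - t) - d)" if "s \<in> I" for s
    using yX d t that by (intro norm_le_N X_diff X_scale) auto
  then have ev: "\<forall>\<^sub>F s in at t within I. norm ((y s - y t) /\<^sub>R (s - t) - d) \<le> N ((y s - y t) /\<^sub>R (s - t) - d)"
    by (simp add: eventually_at_filter)
  have "((\<lambda>s. N ((y s - y t) /\<^sub>R (s - t) - d)) \<longlongrightarrow> 0) (at t within I)"
    using D by (simp add: has_derivative_wrt_def)
  then have "((\<lambda>s. (y s - y t) /\<^sub>R (s - t) - d) \<longlongrightarrow> 0) (at t within I)"
    by (rule Lim_null_comparison[OF ev])
  then have lim: "((\<lambda>s. norm ((y s - y t) /\<^sub>R (s - t) - d)) \<longlongrightarrow> 0) (at t within I)"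
    by (rule tendsto_norm_zero)
  have "norm ((y s - y t) /\<^sub>R (s - t) - d) = norm ((y s - y t) - (s - t) *\<^sub>R d) / norm (s - t)"
    if "s \<noteq> t" for s
  proof -
    have "(y s - y t) /\<^sub>R (s - t) - d = ((y s - y t) - (s - t) *\<^sub>R d) /\<^sub>R (s - t)"
      using that by (simp add: scaleR_right_diff_distrib)
    then show ?thesis by (simp add: divide_inverse_commute)
  qed
  then have "\<forall>\<^sub>F s in at t within I. norm ((y s - y t) /\<^sub>R (s - t) - d)
      = norm ((y s - y t) - (s - t) *\<^sub>R d) / norm (s - t)"
    by (simp add: eventually_at_filter)
  then have "((\<lambda>s. norm ((y s - y t) - (s - t) *\<^sub>R d) / norm (s - t)) \<longlongrightarrow> 0) (at t within I)"
    by (rule Lim_transform_eventually[OF lim])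
  then show ?thesis
    unfolding has_vector_derivative_def has_derivative_iff_norm
    by (simp add: bounded_linear_scaleR_left)
qed

end


section \<open>Integrals from zero\<close>

text \<open>
  The signed integral of \<open>has_integral_from_0\<close> as a function of its upper endpoint, in the ambient norm.
\<close>

definition integral_from_0 :: "(real \<Rightarrow> 'a::banach) \<Rightarrow> real \<Rightarrow> 'a" where
  "integral_from_0 h t = (if 0 \<le> t then integral {0..t} h else - integral {t..0} h)"

lemma integral_from_0_zero [simp]: "integral_from_0 h 0 = 0"
  by (simp add: integral_from_0_def)

lemma integral_from_0_increment:
  assumes h: "continuous_on {-T<..<T::real} h" and s: "s \<in> {-T<..<T}" and t: "t \<in> {-T<..<T}" and st: "s \<le> t"
  shows "(h has_integral (integral_from_0 h t - integral_from_0 h s)) {s..t}"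
proof -
  have int: "h integrable_on {a..b}" if "a \<in> {-T<..<T}" "b \<in> {-T<..<T}" for a b
    using that by (intro integrable_continuous_real continuous_on_subset[OF h]) auto
  have z: "0 \<in> {-T<..<T}" using s by auto
  consider "0 \<le> s" | "s < 0" "0 \<le> t" | "t < 0" by linarith
  then have "integral_from_0 h t - integral_from_0 h s = integral {s..t} h"
  proof cases
    case 1
    then show ?thesis
      using Henstock_Kurzweil_Integration.integral_combine[of 0 s t h] int[OF z t] st
      by (simp add: integral_from_0_def algebra_simps)
  next
    case 2
    then show ?thesis
      using Henstock_Kurzweil_Integration.integral_combine[of s 0 t h] int[OF s t]
      by (simp add: integral_from_0_def algebra_simps)
  next
    case 3
    then show ?thesis
      using Henstock_Kurzweil_Integration.integral_combine[of s t 0 h] int[OF s z] st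
      by (simp add: integral_from_0_def algebra_simps)
  qed
  then show ?thesis using int[OF s t] by (simp add: integrable_integral)
qed

lemma integral_from_0_diff:
  assumes "continuous_on {-T<..<T::real} h" "continuous_on {-T<..<T} k" "t \<in> {-T<..<T}"
  shows "integral_from_0 (\<lambda>\<tau>. h \<tau> - k \<tau>) t = integral_from_0 h t - integral_from_0 k t"
proof -
  have int: "h integrable_on {a..b}" "k integrable_on {a..b}"
    if "a \<in> {-T<..<T}" "b \<in> {-T<..<T}" for a b
    using that by (auto intro!: integrable_continuous_real continuous_on_subset[OF assms(1)]
        continuous_on_subset[OF assms(2)])
  show ?thesis using assms(3)
    by (auto simp: integral_from_0_def Henstock_Kurzweil_Integration.integral_diff int)
qed

lemma integral_from_0_has_vector_derivative:
  assumes h: "continuous_on {-T<..<T::real} h" and t: "t \<in> {-T<..<T}"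
  shows "(integral_from_0 h has_vector_derivative h t) (at t)"
proof -
  define c where "c = (t - T) / 2"
  define d where "d = (t + T) / 2"
  have cd: "c \<in> {-T<..<T}" "d \<in> {-T<..<T}" "c < t" "t < d" using t by (auto simp: c_def d_def)
  have "continuous_on {c..d} h" using cd by (intro continuous_on_subset[OF h]) auto
  then have "((\<lambda>u. integral {c..u} h) has_vector_derivative h t) (at t within {c..d})"
    using cd by (intro integral_has_vector_derivative) auto
  then have "((\<lambda>u. integral {c..u} h) has_vector_derivative h t) (at t)"
    using cd at_within_Icc_at[of c t d] by simp
  then have "((\<lambda>u. integral_from_0 h c + integral {c..u} h) has_vector_derivative h t) (at t)"
    using has_vector_derivative_add[OF has_vector_derivative_const] by fastforce
  moreover have "integral_from_0 h c + integral {c..u} h = integral_from_0 h u" if "u \<in> {c<..<d}" for u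
    using integral_unique[OF integral_from_0_increment[OF h cd(1), of u]] that cd by auto
  ultimately show ?thesis
    using has_vector_derivative_transform_within_open[of _ "h t" t "{c<..<d}"] cd
    by (metis (no_types, lifting) greaterThanLessThan_iff open_greaterThanLessThan)
qed

context normed_subspace
begin

lemma integral_from_0_increment_bound:
  assumes h: "continuous_on {-T<..<T::real} h" and s: "s \<in> {-T<..<T}" and t: "t \<in> {-T<..<T}"
    and bd: "\<And>\<tau>. min s t \<le> \<tau> \<Longrightarrow> \<tau> \<le> max s t \<Longrightarrow> h \<tau> \<in> X \<and> N (h \<tau>) \<le> C"
  shows "integral_from_0 h t - integral_from_0 h s \<in> X \<and>
         N (integral_from_0 h t - integral_from_0 h s) \<le> C * \<bar>t - s\<bar>"
proof -
  have ord: "integral_from_0 h v - integral_from_0 h u \<in> X \<and>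
         N (integral_from_0 h v - integral_from_0 h u) \<le> C * (v - u)"
    if uv: "u \<in> {-T<..<T}" "v \<in> {-T<..<T}" "u \<le> v"
      and bd: "\<And>\<tau>. \<tau> \<in> {u..v} \<Longrightarrow> h \<tau> \<in> X \<and> N (h \<tau>) \<le> C" for u v
  proof -
    have "((\<lambda>_. C) has_integral measure lborel {u..v} *\<^sub>R C) {u..v}" by (rule has_integral_const_real)
    then have "((\<lambda>_. C) has_integral C * (v - u)) {u..v}" using uv by (simp add: mult.commute)
    then show ?thesis
      using has_integral_in_subspace[OF integral_from_0_increment[OF h uv]] bd by blast
  qed
  show ?thesis
  proof (cases "s \<le> t")
    case True
    then show ?thesis using ord[OF s t] bd by auto
  next
    case False
    then have *: "integral_from_0 h s - integral_from_0 h t \<in> X \<and>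
         N (integral_from_0 h s - integral_from_0 h t) \<le> C * (s - t)"
      using ord[OF t s] bd by auto
    then show ?thesis
      using X_minus[of "integral_from_0 h s - integral_from_0 h t"]
        N_minus[of "integral_from_0 h s - integral_from_0 h t"] False by simp
  qed
qed

text \<open>
  Integration from zero gains a factor \<open>1 / \<kappa>\<close> in the norm weighted by \<open>exp (\<kappa> \<bar>t\<bar>)\<close>. This makes the Picard
  map a contraction on the whole interval at once, and it controls the growth of the finer norm.
\<close>

lemma integral_from_0_weighted_bound:
  assumes h: "continuous_on {-T<..<T::real} h" and t: "t \<in> {-T<..<T}" and lam: "\<kappa> > 0" and C: "C \<ge> 0"
    and bd: "\<And>\<tau>. \<tau> \<in> {-T<..<T} \<Longrightarrow> h \<tau> \<in> X \<and> N (h \<tau>) \<le> C * exp (\<kappa> * \<bar>\<tau>\<bar>)"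
  shows "integral_from_0 h t \<in> X \<and> N (integral_from_0 h t) \<le> C / \<kappa> * exp (\<kappa> * \<bar>t\<bar>)"
proof (cases "0 \<le> t")
  case True
  have z: "0 \<in> {-T<..<T}" using t by auto
  have "((\<lambda>\<tau>. C * exp (\<kappa> * \<tau>)) has_integral C / \<kappa> * exp (\<kappa> * t) - C / \<kappa> * exp (\<kappa> * 0)) {0..t}"
    using lam by (intro fundamental_theorem_of_calculus True)
      (auto intro!: derivative_eq_intros simp: has_real_derivative_iff_has_vector_derivative[symmetric])
  then have "integral_from_0 h t - integral_from_0 h 0 \<in> X \<and>
      N (integral_from_0 h t - integral_from_0 h 0) \<le> C / \<kappa> * exp (\<kappa> * t) - C / \<kappa> * exp (\<kappa> * 0)"
  proof (rule has_integral_in_subspace[OF integral_from_0_increment[OF h z t True]])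
    show "h \<tau> \<in> X \<and> N (h \<tau>) \<le> C * exp (\<kappa> * \<tau>)" if "\<tau> \<in> {0..t}" for \<tau>
      using bd[of \<tau>] that t by auto
  qed
  moreover have "0 \<le> C / \<kappa>" using lam C by simp
  ultimately show ?thesis using True by simp
next
  case False
  then have le: "t \<le> 0" by simp
  have z: "0 \<in> {-T<..<T}" using t by auto
  have "((\<lambda>\<tau>. C * exp (\<kappa> * - \<tau>)) has_integral - C / \<kappa> * exp (\<kappa> * - 0) - - C / \<kappa> * exp (\<kappa> * - t)) {t..0}"
    using lam by (intro fundamental_theorem_of_calculus le)
      (auto intro!: derivative_eq_intros simp: has_real_derivative_iff_has_vector_derivative[symmetric])
  then have *: "integral_from_0 h 0 - integral_from_0 h t \<in> X \<and>
      N (integral_from_0 h 0 - integral_from_0 h t) \<le> - C / \<kappa> * exp (\<kappa> * - 0) - - C / \<kappa> * exp (\<kappa> * - t)"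
  proof (rule has_integral_in_subspace[OF integral_from_0_increment[OF h t z le]])
    show "h \<tau> \<in> X \<and> N (h \<tau>) \<le> C * exp (\<kappa> * - \<tau>)" if "\<tau> \<in> {t..0}" for \<tau>
      using bd[of \<tau>] that t by auto
  qed
  moreover have "0 \<le> C / \<kappa>" using lam C by simp
  ultimately show ?thesis
    using False X_minus[of "- integral_from_0 h t"] N_minus[of "- integral_from_0 h t"] by simp
qed

end

section \<open>Evolution equations with a time-dependent forcing\<close>

text \<open>
  With the whole space as subspace, the bounds above are available for the ambient norm as well.
\<close>

lemma normed_subspace_whole: "normed_subspace (UNIV :: 'e::banach set) norm"
  by standard (auto intro: norm_triangle_ineq closed_Collect_le continuous_intros)

text \<open>
  Global Lipschitz continuity is assumed only for the ambient norm. For \<open>N\<close> there are linear growth and a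
  Lipschitz constant that depends on the size of the arguments.
\<close>

locale forced_evolution = normed_subspace X N for X :: "'e::banach set" and N :: "'e \<Rightarrow> real" +
  fixes A :: "'e \<Rightarrow> 'e" and \<beta> :: "real \<Rightarrow> 'e" and T \<Lambda> B :: real
  assumes T_pos: "0 < T" and Lam_pos: "0 < \<Lambda>"
    and A_in_X: "x \<in> X \<Longrightarrow> A x \<in> X"
    and A_growth: "x \<in> X \<Longrightarrow> N (A x) \<le> \<Lambda> * N x"
    and A_lipschitz: "x \<in> X \<Longrightarrow> y \<in> X \<Longrightarrow> norm (A x - A y) \<le> \<Lambda> * norm (x - y)"
    and A_locally_lipschitz:
      "\<exists>L\<ge>0. \<forall>x\<in>X. \<forall>y\<in>X. N x \<le> R \<longrightarrow> N y \<le> R \<longrightarrow> N (A x - A y) \<le> L * N (x - y)"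
    and forcing_in_X: "t \<in> {-T<..<T} \<Longrightarrow> \<beta> t \<in> X"
    and forcing_bound: "t \<in> {-T<..<T} \<Longrightarrow> N (\<beta> t) \<le> B"
    and forcing_continuous: "continuous_wrt N {-T<..<T} \<beta>"
begin

definition rhs :: "(real \<Rightarrow> 'e) \<Rightarrow> real \<Rightarrow> 'e" where
  "rhs y t = A (y t) + \<beta> t"

lemma zero_in: "0 \<in> {-T<..<T}" using T_pos by simp

lemma B_nonneg: "0 \<le> B"
  using forcing_bound[OF zero_in] N_nonneg[OF forcing_in_X[OF zero_in]] by simp

lemma rhs_in_X: "t \<in> {-T<..<T} \<Longrightarrow> y t \<in> X \<Longrightarrow> rhs y t \<in> X"
  unfolding rhs_def by (intro X_add A_in_X forcing_in_X)

lemma rhs_growth: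
  assumes "t \<in> {-T<..<T}" "y t \<in> X" shows "N (rhs y t) \<le> \<Lambda> * N (y t) + B"
  using N_add[OF A_in_X[OF assms(2)] forcing_in_X[OF assms(1)]] A_growth[OF assms(2)]
    forcing_bound[OF assms(1)] by (simp add: rhs_def)

lemma rhs_diff: "y t \<in> X \<Longrightarrow> z t \<in> X \<Longrightarrow> norm (rhs y t - rhs z t) \<le> \<Lambda> * norm (y t - z t)"
  using A_lipschitz[of "y t" "z t"] by (simp add: rhs_def)

lemma rhs_continuous:
  assumes c: "continuous_on {-T<..<T} y" and X: "y ` {-T<..<T} \<subseteq> X"
  shows "continuous_on {-T<..<T} (rhs y)"
proof -
  have "continuous_on X A"
    by (rule lipschitz_on_continuous_on[of \<Lambda>], rule lipschitz_onI)
      (use A_lipschitz Lam_pos in \<open>auto simp: dist_norm\<close>)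
  then have "continuous_on {-T<..<T} (\<lambda>t. A (y t))"
    using continuous_on_compose2[OF _ c X] by blast
  moreover have "continuous_on {-T<..<T} \<beta>"
    using forcing_in_X forcing_continuous by (intro continuous_on_of_wrt) auto
  ultimately show ?thesis unfolding rhs_def by (intro continuous_intros)
qed

definition picard_map :: "'e \<Rightarrow> (real \<Rightarrow> 'e) \<Rightarrow> real \<Rightarrow> 'e" where
  "picard_map x0 y t = x0 + integral_from_0 (rhs y) t"

lemma picard_map_continuous:
  assumes "continuous_on {-T<..<T} y" "y ` {-T<..<T} \<subseteq> X"
  shows "continuous_on {-T<..<T} (picard_map x0 y)"
proof -
  have "continuous (at t within {-T<..<T}) (integral_from_0 (rhs y))" if "t \<in> {-T<..<T}" for t
    using integral_from_0_has_vector_derivative[OF rhs_continuous[OF assms] that]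
      has_vector_derivative_continuous continuous_at_imp_continuous_at_within by blast
  then have "continuous_on {-T<..<T} (integral_from_0 (rhs y))"
    by (simp add: continuous_on_eq_continuous_within)
  then show ?thesis unfolding picard_map_def by (intro continuous_intros)
qed

text \<open>
  The smaller interval bounded by \<open>S\<close> serves the uniqueness proof: on a compact subinterval the
  difference of two solutions is bounded, which is not known beforehand on all of \<open>{-T<..<T}\<close>.
\<close>

lemma picard_map_contracts:
  assumes y: "continuous_on {-T<..<T} y" "y ` {-T<..<T} \<subseteq> X"
    and z: "continuous_on {-T<..<T} z" "z ` {-T<..<T} \<subseteq> X"
    and c: "c \<ge> 0" and S: "S \<le> T" and t: "t \<in> {-S<..<S}"
    and yz: "\<And>\<tau>. \<tau> \<in> {-S<..<S} \<Longrightarrow> norm (y \<tau> - z \<tau>) \<le> c * exp (2 * \<Lambda> * \<bar>\<tau>\<bar>)"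
  shows "norm (picard_map x0 y t - picard_map x0 z t) \<le> c / 2 * exp (2 * \<Lambda> * \<bar>t\<bar>)"
proof -
  have sub: "{-S<..<S} \<subseteq> {-T<..<T}" using S by auto
  have cont: "continuous_on {-S<..<S} (rhs y)" "continuous_on {-S<..<S} (rhs z)"
    using rhs_continuous[OF y] rhs_continuous[OF z] continuous_on_subset[OF _ sub] by auto
  have "norm (rhs y \<tau> - rhs z \<tau>) \<le> \<Lambda> * c * exp (2 * \<Lambda> * \<bar>\<tau>\<bar>)" if "\<tau> \<in> {-S<..<S}" for \<tau>
  proof -
    have "norm (rhs y \<tau> - rhs z \<tau>) \<le> \<Lambda> * norm (y \<tau> - z \<tau>)"
      using y(2) z(2) that sub by (intro rhs_diff) (blast intro: imageI)+
    also have "\<dots> \<le> \<Lambda> * (c * exp (2 * \<Lambda> * \<bar>\<tau>\<bar>))"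
      using yz[OF that] Lam_pos by (intro mult_left_mono) auto
    finally show ?thesis by simp
  qed
  then have "norm (integral_from_0 (\<lambda>\<tau>. rhs y \<tau> - rhs z \<tau>) t) \<le> \<Lambda> * c / (2 * \<Lambda>) * exp (2 * \<Lambda> * \<bar>t\<bar>)"
    using normed_subspace.integral_from_0_weighted_bound[OF normed_subspace_whole, of S _ t "2 * \<Lambda>" "\<Lambda> * c"]
      cont t c Lam_pos
    by (auto intro: continuous_on_diff)
  then show ?thesis
    using integral_from_0_diff[OF cont t] Lam_pos
    by (simp add: picard_map_def)
qed

text \<open>
  \<open>M\<close> is the solution of \<open>M = N x0 + (\<Lambda> M + B) / (2 \<Lambda>)\<close>, so the growth of the field is absorbed by the
  contraction factor one half.
\<close>

lemma picard_map_keeps_bound: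
  assumes x0: "x0 \<in> X" and M: "M = 2 * N x0 + B / \<Lambda>"
    and y: "continuous_on {-T<..<T} y"
    and bd: "\<And>\<tau>. \<tau> \<in> {-T<..<T} \<Longrightarrow> y \<tau> \<in> X \<and> N (y \<tau>) \<le> M * exp (2 * \<Lambda> * \<bar>\<tau>\<bar>)"
    and t: "t \<in> {-T<..<T}"
  shows "picard_map x0 y t \<in> X \<and> N (picard_map x0 y t) \<le> M * exp (2 * \<Lambda> * \<bar>t\<bar>)"
proof -
  have yX: "y ` {-T<..<T} \<subseteq> X" using bd by auto
  have M0: "M \<ge> 0" using M N_nonneg[OF x0] B_nonneg Lam_pos by simp
  have "N (rhs y \<tau>) \<le> (\<Lambda> * M + B) * exp (2 * \<Lambda> * \<bar>\<tau>\<bar>)" if \<tau>: "\<tau> \<in> {-T<..<T}" for \<tau>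
  proof -
    have "N (rhs y \<tau>) \<le> \<Lambda> * N (y \<tau>) + B" using rhs_growth \<tau> bd by blast
    also have "\<dots> \<le> \<Lambda> * (M * exp (2 * \<Lambda> * \<bar>\<tau>\<bar>)) + B * exp (2 * \<Lambda> * \<bar>\<tau>\<bar>)"
    proof (intro add_mono mult_left_mono)
      show "B \<le> B * exp (2 * \<Lambda> * \<bar>\<tau>\<bar>)"
        using B_nonneg Lam_pos mult_left_mono[of 1 "exp (2 * \<Lambda> * \<bar>\<tau>\<bar>)" B] by simp
    qed (use bd \<tau> Lam_pos in auto)
    finally show ?thesis by (simp add: algebra_simps)
  qed
  then have *: "integral_from_0 (rhs y) t \<in> X \<and>
      N (integral_from_0 (rhs y) t) \<le> (\<Lambda> * M + B) / (2 * \<Lambda>) * exp (2 * \<Lambda> * \<bar>t\<bar>)"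
    using rhs_in_X bd M0 B_nonneg Lam_pos t
    by (intro integral_from_0_weighted_bound[OF rhs_continuous[OF y yX]]) auto
  have "N (picard_map x0 y t) \<le> N x0 + (\<Lambda> * M + B) / (2 * \<Lambda>) * exp (2 * \<Lambda> * \<bar>t\<bar>)"
    using N_add[OF x0, of "integral_from_0 (rhs y) t"] * by (simp add: picard_map_def)
  also have "\<dots> \<le> N x0 * exp (2 * \<Lambda> * \<bar>t\<bar>) + (\<Lambda> * M + B) / (2 * \<Lambda>) * exp (2 * \<Lambda> * \<bar>t\<bar>)"
    using N_nonneg[OF x0] Lam_pos mult_left_mono[of 1 "exp (2 * \<Lambda> * \<bar>t\<bar>)" "N x0"] by simp
  also have "\<dots> = (N x0 + (\<Lambda> * M + B) / (2 * \<Lambda>)) * exp (2 * \<Lambda> * \<bar>t\<bar>)" by (simp add: distrib_right)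
  also have "N x0 + (\<Lambda> * M + B) / (2 * \<Lambda>) = M"
    using Lam_pos by (simp add: M field_simps)
  finally show ?thesis using * X_add[OF x0] by (simp add: picard_map_def)
qed

text \<open>
  The iterates form a geometric series in the weighted ambient norm. The weight is bounded on
  \<open>{-T<..<T}\<close>, so they converge uniformly there, although the forcing need not extend continuously to the
  endpoints.
\<close>

lemma exists_picard_fixed_point:
  assumes x0: "x0 \<in> X"
  obtains y C where "continuous_on {-T<..<T} y"
    "\<And>t. t \<in> {-T<..<T} \<Longrightarrow> y t \<in> X \<and> N (y t) \<le> C"
    "\<And>t. t \<in> {-T<..<T} \<Longrightarrow> y t = picard_map x0 y t"
proof -
  define M where "M = 2 * N x0 + B / \<Lambda>"
  define W where "W t = exp (2 * \<Lambda> * \<bar>t\<bar>)" for t :: real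
  have M0: "M \<ge> 0" using M_def N_nonneg[OF x0] B_nonneg Lam_pos by simp
  have W1: "1 \<le> W t" for t using Lam_pos by (simp add: W_def)
  have WT: "W t \<le> W T" if "t \<in> {-T<..<T}" for t using that Lam_pos T_pos by (auto simp: W_def)
  define Y where "Y n = (picard_map x0 ^^ n) (\<lambda>_. x0)" for n
  have Y: "continuous_on {-T<..<T} (Y n) \<and> (\<forall>t\<in>{-T<..<T}. Y n t \<in> X \<and> N (Y n t) \<le> M * W t)" for n
  proof (induction n)
    case 0
    have "N x0 \<le> M * W t" for t
    proof -
      have "N x0 \<le> M" using N_nonneg[OF x0] B_nonneg Lam_pos by (simp add: M_def)
      also have "\<dots> \<le> M * W t" using mult_left_mono[OF W1 M0] by simp
      finally show ?thesis .
    qed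
    then show ?case using x0 by (simp add: Y_def)
  next
    case (Suc n)
    have S: "Y (Suc n) = picard_map x0 (Y n)" by (simp add: Y_def)
    show ?case unfolding S
      using Suc picard_map_continuous[of "Y n" x0] picard_map_keeps_bound[OF x0 M_def, of "Y n"]
      by (auto simp: W_def image_subset_iff)
  qed
  have Yc: "continuous_on {-T<..<T} (Y n)" and YX: "Y n ` {-T<..<T} \<subseteq> X" for n
    using Y by auto
  have YS: "Y (Suc n) = picard_map x0 (Y n)" for n by (simp add: Y_def)
  have step: "norm (Y (Suc n) t - Y n t) \<le> 2 * M * (1/2)^n * W t" if "t \<in> {-T<..<T}" for n t
    using that
  proof (induction n arbitrary: t)
    case 0
    have "norm (Y (Suc 0) t - Y 0 t) \<le> norm (Y (Suc 0) t) + norm (Y 0 t)" by (rule norm_triangle_ineq4)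
    also have "\<dots> \<le> M * W t + M * W t"
      using Y 0 norm_le_N by (intro add_mono) (meson order_trans)+
    finally show ?case by simp
  next
    case (Suc n)
    have "norm (picard_map x0 (Y (Suc n)) t - picard_map x0 (Y n) t) \<le> 2 * M * (1/2)^n / 2 * exp (2 * \<Lambda> * \<bar>t\<bar>)"
      using Suc M0 by (intro picard_map_contracts[where S = T] Yc YX) (auto simp: W_def)
    then show ?case by (simp add: YS W_def)
  qed
  have "uniform_limit {-T<..<T} (\<lambda>n t. \<Sum>i<n. Y (Suc i) t - Y i t) (\<lambda>t. \<Sum>i. Y (Suc i) t - Y i t) sequentially"
  proof (rule Weierstrass_m_test)
    fix n t assume t: "t \<in> {-T<..<T}"
    have "2 * M * (1/2)^n * W t \<le> 2 * M * (1/2)^n * W T"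
      using WT[OF t] M0 by (intro mult_left_mono) auto
    then show "norm (Y (Suc n) t - Y n t) \<le> 2 * M * W T * (1/2)^n"
      using step[OF t, of n] by (simp add: mult_ac)
  next
    show "summable (\<lambda>n. 2 * M * W T * (1/2)^n)" by (intro summable_mult summable_geometric) simp
  qed
  then have "uniform_limit {-T<..<T} (\<lambda>n t. x0 + (\<Sum>i<n. Y (Suc i) t - Y i t))
      (\<lambda>t. x0 + (\<Sum>i. Y (Suc i) t - Y i t)) sequentially"
    by (intro uniform_limit_intros)
  moreover have "x0 + (\<Sum>i<n. Y (Suc i) t - Y i t) = Y n t" for n t
    using sum_lessThan_telescope[of "\<lambda>i. Y i t" n] by (simp add: Y_def)
  ultimately obtain y where lim: "uniform_limit {-T<..<T} Y y sequentially" by auto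
  have yc: "continuous_on {-T<..<T} y"
    using uniform_limit_theorem[OF _ lim] Yc by simp
  have ptlim: "(\<lambda>n. Y n t) \<longlonglongrightarrow> y t" if "t \<in> {-T<..<T}" for t
    using tendsto_uniform_limitI[OF lim that] .
  have yX: "y t \<in> X \<and> N (y t) \<le> M * W t" if t: "t \<in> {-T<..<T}" for t
  proof -
    have "y t \<in> {x \<in> X. N x \<le> M * W t}"
      using Y t by (intro Lim_in_closed_set[OF closed_N_ball _ _ ptlim[OF t]]) auto
    then show ?thesis by simp
  qed
  have fixed: "y t = picard_map x0 y t" if t: "t \<in> {-T<..<T}" for t
  proof -
    have "(\<lambda>n. picard_map x0 (Y n) t - picard_map x0 y t) \<longlonglongrightarrow> 0"
    proof (rule tendstoI)
      fix e :: real assume e: "e > 0"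
      have e': "e / W T > 0" using e W1[of T] by simp
      have "\<forall>\<^sub>F n in sequentially. \<forall>\<tau>\<in>{-T<..<T}. dist (Y n \<tau>) (y \<tau>) < e / W T"
        using uniform_limitD[OF lim e'] .
      then show "\<forall>\<^sub>F n in sequentially. dist (picard_map x0 (Y n) t - picard_map x0 y t) 0 < e"
      proof eventually_elim
        case (elim n)
        have "norm (Y n \<tau> - y \<tau>) \<le> e / W T * exp (2 * \<Lambda> * \<bar>\<tau>\<bar>)" if "\<tau> \<in> {-T<..<T}" for \<tau>
        proof -
          have "norm (Y n \<tau> - y \<tau>) \<le> e / W T" using bspec[OF elim that] by (simp add: dist_norm)
          also have "\<dots> \<le> e / W T * W \<tau>" using mult_left_mono[OF W1, of "e / W T"] e' by simp
          finally show ?thesis by (simp add: W_def)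
        qed
        then have "norm (picard_map x0 (Y n) t - picard_map x0 y t) \<le> e / W T / 2 * exp (2 * \<Lambda> * \<bar>t\<bar>)"
          using yX e' t by (intro picard_map_contracts[where S = T] Yc YX yc) auto
        also have "\<dots> = e / W T / 2 * W t" by (simp add: W_def)
        also have "\<dots> \<le> e / W T / 2 * W T" using WT[OF t] e' by (intro mult_left_mono) auto
        also have "\<dots> < e" using e W1[of T] by simp
        finally show ?case by simp
      qed
    qed
    then have "(\<lambda>n. Y (Suc n) t) \<longlonglongrightarrow> picard_map x0 y t" by (simp add: YS LIM_zero_iff)
    then show ?thesis using LIMSEQ_unique LIMSEQ_Suc[OF ptlim[OF t]] by blast
  qed
  have "N (y t) \<le> M * W T" if "t \<in> {-T<..<T}" for t
    using yX[OF that] mult_left_mono[OF WT[OF that] M0] by linarith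
  then show thesis using that yc yX fixed by blast
qed

text \<open>
  Near a given time the difference of two solutions is bounded by some \<open>c\<close>, hence, iterating the
  contraction, by \<open>c (1/2)^n\<close> times the weight for every \<open>n\<close>.
\<close>

lemma picard_fixed_point_unique:
  assumes y: "continuous_on {-T<..<T} y" "y ` {-T<..<T} \<subseteq> X" "\<And>t. t \<in> {-T<..<T} \<Longrightarrow> y t = picard_map x0 y t"
    and z: "continuous_on {-T<..<T} z" "z ` {-T<..<T} \<subseteq> X" "\<And>t. t \<in> {-T<..<T} \<Longrightarrow> z t = picard_map x0 z t"
    and t: "t \<in> {-T<..<T}"
  shows "y t = z t"
proof -
  define S where "S = (\<bar>t\<bar> + T) / 2"
  have S: "S < T" "t \<in> {-S<..<S}" using t by (auto simp: S_def abs_if field_simps)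
  have "compact ((\<lambda>s. y s - z s) ` {-S..S})"
    using S(1) by (intro compact_continuous_image continuous_on_diff continuous_on_subset[OF y(1)]
        continuous_on_subset[OF z(1)]) auto
  then obtain c where c: "c > 0" "\<And>s. s \<in> {-S..S} \<Longrightarrow> norm (y s - z s) \<le> c"
    using compact_imp_bounded bounded_pos by (metis (no_types, lifting) imageI)
  have "norm (y s - z s) \<le> c * (1/2)^n * exp (2 * \<Lambda> * \<bar>s\<bar>)" if "s \<in> {-S<..<S}" for n s
    using that
  proof (induction n arbitrary: s)
    case 0
    have "norm (y s - z s) \<le> c" using c(2)[of s] 0 by simp
    also have "\<dots> \<le> c * exp (2 * \<Lambda> * \<bar>s\<bar>)" using c(1) Lam_pos by simp
    finally show ?case by simp
  next
    case (Suc n)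
    have "norm (picard_map x0 y s - picard_map x0 z s) \<le> c * (1/2)^n / 2 * exp (2 * \<Lambda> * \<bar>s\<bar>)"
      using Suc c(1) S(1) by (intro picard_map_contracts[where S = S] y z) auto
    then show ?case using y(3)[of s] z(3)[of s] Suc(2) S(1) by simp
  qed
  then have "norm (y t - z t) \<le> c * (1/2)^n * exp (2 * \<Lambda> * \<bar>t\<bar>)" for n
    using S(2) by blast
  moreover have "(\<lambda>n. c * (1/2)^n * exp (2 * \<Lambda> * \<bar>t\<bar>)) \<longlonglongrightarrow> c * 0 * exp (2 * \<Lambda> * \<bar>t\<bar>)"
    by (intro tendsto_intros LIMSEQ_realpow_zero) auto
  ultimately have "norm (y t - z t) \<le> c * 0 * exp (2 * \<Lambda> * \<bar>t\<bar>)"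
    using LIMSEQ_le_const by blast
  then show ?thesis by simp
qed

text \<open>
  The solution is an integral in the ambient norm only; the regularity for \<open>N\<close> comes from the bound on
  \<open>y\<close>. Increments of \<open>y\<close> are integrals of an \<open>N\<close>-bounded function, so \<open>y\<close> is \<open>N\<close>-Lipschitz; by the
  local Lipschitz estimate \<open>A \<circ> y\<close> is too, so that \<open>rhs y\<close> and \<open>\<beta>\<close> have the same regularity in time.
\<close>

lemma picard_fixed_point_regular:
  assumes yc: "continuous_on {-T<..<T} y"
    and yX: "\<And>t. t \<in> {-T<..<T} \<Longrightarrow> y t \<in> X \<and> N (y t) \<le> C"
    and fixed: "\<And>t. t \<in> {-T<..<T} \<Longrightarrow> y t = picard_map x0 y t"
  shows "lipschitz_wrt N {-T<..<T} y" and "C1_wrt X N {-T<..<T} y (rhs y)"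
    and "lipschitz_wrt N {-T<..<T} (rhs y) \<longleftrightarrow> lipschitz_wrt N {-T<..<T} \<beta>"
proof -
  have img: "y ` {-T<..<T} \<subseteq> X" using yX by auto
  note rc = rhs_continuous[OF yc img]
  have rX: "rhs y t \<in> X" if "t \<in> {-T<..<T}" for t using rhs_in_X yX that by blast
  have rB: "N (rhs y t) \<le> \<Lambda> * C + B" if "t \<in> {-T<..<T}" for t
  proof -
    have "N (rhs y t) \<le> \<Lambda> * N (y t) + B" using rhs_growth yX that by blast
    also have "\<dots> \<le> \<Lambda> * C + B" using yX[OF that] Lam_pos by simp
    finally show ?thesis .
  qed
  have incr: "y t - y s = integral_from_0 (rhs y) t - integral_from_0 (rhs y) s"
    if "s \<in> {-T<..<T}" "t \<in> {-T<..<T}" for s t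
    using fixed[OF that(1)] fixed[OF that(2)] by (simp add: picard_map_def)
  have lip: "N (y t - y s) \<le> (\<Lambda> * C + B) * \<bar>t - s\<bar>" if "s \<in> {-T<..<T}" "t \<in> {-T<..<T}" for s t
    unfolding incr[OF that] using that
    by (intro conjunct2[OF integral_from_0_increment_bound[OF rc]]) (auto intro!: rX rB)
  then show "lipschitz_wrt N {-T<..<T} y" unfolding lipschitz_wrt_def by blast

  obtain L where L: "L \<ge> 0" "\<forall>x\<in>X. \<forall>w\<in>X. N x \<le> C \<longrightarrow> N w \<le> C \<longrightarrow> N (A x - A w) \<le> L * N (x - w)"
    using A_locally_lipschitz by blast
  define L' where "L' = L * (\<Lambda> * C + B)"
  have A_lip: "N (A (y t) - A (y s)) \<le> L' * \<bar>t - s\<bar>" if "s \<in> {-T<..<T}" "t \<in> {-T<..<T}" for s t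
  proof -
    have "N (A (y t) - A (y s)) \<le> L * N (y t - y s)" using L yX that by blast
    also have "\<dots> \<le> L * ((\<Lambda> * C + B) * \<bar>t - s\<bar>)" using lip that L(1) by (intro mult_left_mono) auto
    finally show ?thesis by (simp add: L'_def)
  qed
  have rhs_forcing: "N (rhs y s - rhs y t) \<le> L' * \<bar>s - t\<bar> + N (\<beta> s - \<beta> t)"
    "N (\<beta> s - \<beta> t) \<le> L' * \<bar>s - t\<bar> + N (rhs y s - rhs y t)"
    if "s \<in> {-T<..<T}" "t \<in> {-T<..<T}" for s t
  proof -
    have m: "A (y s) - A (y t) \<in> X" "\<beta> s - \<beta> t \<in> X" "rhs y s - rhs y t \<in> X"
      using that yX by (auto intro!: X_diff A_in_X forcing_in_X rX)
    have eq: "rhs y s - rhs y t = (A (y s) - A (y t)) + (\<beta> s - \<beta> t)" by (simp add: rhs_def)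
    have eq': "\<beta> s - \<beta> t = - (A (y s) - A (y t)) + (rhs y s - rhs y t)" by (simp add: rhs_def)
    show "N (rhs y s - rhs y t) \<le> L' * \<bar>s - t\<bar> + N (\<beta> s - \<beta> t)"
      using N_add[OF m(1,2)] A_lip[OF that(2,1)] unfolding eq by linarith
    show "N (\<beta> s - \<beta> t) \<le> L' * \<bar>s - t\<bar> + N (rhs y s - rhs y t)"
      using N_add[OF X_minus[OF m(1)] m(3)] A_lip[OF that(2,1)] N_minus[OF m(1)]
      unfolding eq'[symmetric] by linarith
  qed
  have rhs_cN: "continuous_wrt N {-T<..<T} (rhs y)"
    unfolding continuous_wrt_def
  proof
    fix t assume t: "t \<in> {-T<..<T}"
    have "((\<lambda>s. L' * \<bar>s - t\<bar> + N (\<beta> s - \<beta> t)) \<longlongrightarrow> L' * \<bar>t - t\<bar> + 0) (at t within {-T<..<T})"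
      using forcing_continuous t unfolding continuous_wrt_def by (intro tendsto_intros) auto
    then have lim: "((\<lambda>s. L' * \<bar>s - t\<bar> + N (\<beta> s - \<beta> t)) \<longlongrightarrow> 0) (at t within {-T<..<T})" by simp
    have "norm (N (rhs y s - rhs y t)) \<le> L' * \<bar>s - t\<bar> + N (\<beta> s - \<beta> t)" if "s \<in> {-T<..<T}" for s
      using rhs_forcing(1)[OF that t] N_nonneg[OF X_diff[OF rX rX], OF that t] by simp
    then have "\<forall>\<^sub>F s in at t within {-T<..<T}. norm (N (rhs y s - rhs y t)) \<le> L' * \<bar>s - t\<bar> + N (\<beta> s - \<beta> t)"
      unfolding eventually_at_filter by (intro always_eventually) blast
    then show "((\<lambda>s. N (rhs y s - rhs y t)) \<longlongrightarrow> 0) (at t within {-T<..<T})"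
      using lim by (rule Lim_null_comparison)
  qed
  have deriv: "has_derivative_wrt N {-T<..<T} y (rhs y t) t" if t: "t \<in> {-T<..<T}" for t
    unfolding has_derivative_wrt_def
  proof (rule tendstoI)
    fix e :: real assume e: "e > 0"
    have "\<forall>\<^sub>F s in at t within {-T<..<T}. dist (N (rhs y s - rhs y t)) 0 < e / 2"
      using rhs_cN t e unfolding continuous_wrt_def by (intro tendstoD) auto
    then obtain d where d: "d > 0"
      "\<And>s. s \<in> {-T<..<T} \<Longrightarrow> s \<noteq> t \<Longrightarrow> dist s t < d \<Longrightarrow> dist (N (rhs y s - rhs y t)) 0 < e / 2"
      unfolding eventually_at by blast
    have close: "N (rhs y s - rhs y t) \<le> e / 2" if "s \<in> {-T<..<T}" "dist s t < d" for s
      using d(2)[OF that(1) _ that(2)] e N_0 by (cases "s = t") (auto simp: dist_real_def)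
    have "dist (N ((y s - y t) /\<^sub>R (s - t) - rhs y t)) 0 < e"
      if s: "s \<in> {-T<..<T}" "s \<noteq> t" "dist s t < d" for s
    proof -
      \<comment> \<open>The difference quotient minus the derivative is the mean over the increment of the oscillation k.\<close>
      define k where "k \<tau> = rhs y \<tau> - rhs y t" for \<tau>
      have kc: "continuous_on {-T<..<T} k" unfolding k_def by (intro continuous_intros rc)
      have diff: "integral_from_0 k r = integral_from_0 (rhs y) r - r *\<^sub>R rhs y t" if "r \<in> {-T<..<T}" for r
        unfolding k_def using integral_from_0_diff[OF rc continuous_on_const that, of "rhs y t"]
        by (simp add: integral_from_0_def)
      have kb: "integral_from_0 k s - integral_from_0 k t \<in> X \<and>
          N (integral_from_0 k s - integral_from_0 k t) \<le> e / 2 * \<bar>s - t\<bar>"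
      proof (rule integral_from_0_increment_bound[OF kc t s(1)])
        fix \<tau> assume "min t s \<le> \<tau>" "\<tau> \<le> max t s"
        then have "\<tau> \<in> {-T<..<T}" "dist \<tau> t < d" using s t by (auto simp: dist_real_def)
        then show "k \<tau> \<in> X \<and> N (k \<tau>) \<le> e / 2"
          using close rX t X_diff unfolding k_def by blast
      qed
      have eq: "(y s - y t) /\<^sub>R (s - t) - rhs y t = inverse (s - t) *\<^sub>R (integral_from_0 k s - integral_from_0 k t)"
      proof -
        have "integral_from_0 k s - integral_from_0 k t = (y s - y t) - (s - t) *\<^sub>R rhs y t"
          unfolding incr[OF t s(1)] diff[OF t] diff[OF s(1)] by (simp add: algebra_simps)
        then show ?thesis using s(2) by (simp add: scaleR_right_diff_distrib)
      qed
      have "N ((y s - y t) /\<^sub>R (s - t) - rhs y t) \<le> \<bar>inverse (s - t)\<bar> * (e / 2 * \<bar>s - t\<bar>)"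
        unfolding eq using kb N_scale[of "integral_from_0 k s - integral_from_0 k t" "inverse (s - t)"]
          mult_left_mono[of _ "e / 2 * \<bar>s - t\<bar>" "\<bar>inverse (s - t)\<bar>"] by fastforce
      also have "\<dots> = e / 2" using s(2) by (simp add: abs_inverse)
      also have "\<dots> < e" using e by simp
      finally show ?thesis
        using N_nonneg[OF X_scale[OF conjunct1[OF kb], of "inverse (s - t)"]] unfolding eq by simp
    qed
    then show "\<forall>\<^sub>F s in at t within {-T<..<T}. dist (N ((y s - y t) /\<^sub>R (s - t) - rhs y t)) 0 < e"
      unfolding eventually_at using d(1) by blast
  qed
  show "C1_wrt X N {-T<..<T} y (rhs y)"
    unfolding C1_wrt_def using img rX deriv rhs_cN by auto

  show "lipschitz_wrt N {-T<..<T} (rhs y) \<longleftrightarrow> lipschitz_wrt N {-T<..<T} \<beta>"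
  proof
    assume "lipschitz_wrt N {-T<..<T} (rhs y)"
    then obtain K where "\<And>s t. s \<in> {-T<..<T} \<Longrightarrow> t \<in> {-T<..<T} \<Longrightarrow> N (rhs y s - rhs y t) \<le> K * \<bar>s - t\<bar>"
      unfolding lipschitz_wrt_def by blast
    then have "N (\<beta> s - \<beta> t) \<le> (L' + K) * \<bar>s - t\<bar>" if "s \<in> {-T<..<T}" "t \<in> {-T<..<T}" for s t
      using rhs_forcing(2)[OF that] that by (fastforce simp: distrib_right)
    then show "lipschitz_wrt N {-T<..<T} \<beta>" unfolding lipschitz_wrt_def by blast
  next
    assume "lipschitz_wrt N {-T<..<T} \<beta>"
    then obtain K where "\<And>s t. s \<in> {-T<..<T} \<Longrightarrow> t \<in> {-T<..<T} \<Longrightarrow> N (\<beta> s - \<beta> t) \<le> K * \<bar>s - t\<bar>"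
      unfolding lipschitz_wrt_def by blast
    then have "N (rhs y s - rhs y t) \<le> (L' + K) * \<bar>s - t\<bar>" if "s \<in> {-T<..<T}" "t \<in> {-T<..<T}" for s t
      using rhs_forcing(1)[OF that] that by (fastforce simp: distrib_right)
    then show "lipschitz_wrt N {-T<..<T} (rhs y)" unfolding lipschitz_wrt_def by blast
  qed
qed

lemma C1_wrt_continuous:
  assumes "C1_wrt X N {-T<..<T} z z'" shows "continuous_on {-T<..<T} z"
proof -
  have "(z has_vector_derivative z' t) (at t within {-T<..<T})" if "t \<in> {-T<..<T}" for t
    using assms that by (intro has_vector_derivative_of_wrt) (auto simp: C1_wrt_def)
  then show ?thesis
    unfolding continuous_on_eq_continuous_within by (blast intro: has_vector_derivative_continuous)
qed

lemma solves_integral_eq_imp_fixed_point: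
  assumes "solves_integral_eq X N {-T<..<T} (\<lambda>y t. A y + \<beta> t) x0 z" "t \<in> {-T<..<T}"
  shows "z t = picard_map x0 z t"
proof -
  have "has_integral_from_0 X N (rhs z) (z t - x0) t"
    using assms by (simp add: solves_integral_eq_def rhs_def[abs_def])
  then have "z t - x0 = integral_from_0 (rhs z) t"
    using has_integral_of_wrt integral_unique unfolding has_integral_from_0_def integral_from_0_def
    by (metis minus_minus)
  then show ?thesis by (simp add: picard_map_def algebra_simps)
qed

lemma fixed_point_imp_solves_integral_eq:
  assumes c: "continuous_on {-T<..<T} z" "z ` {-T<..<T} \<subseteq> X" and rN: "continuous_wrt N {-T<..<T} (rhs z)"
    and fixed: "\<And>t. t \<in> {-T<..<T} \<Longrightarrow> z t = picard_map x0 z t"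
  shows "solves_integral_eq X N {-T<..<T} (\<lambda>y t. A y + \<beta> t) x0 z"
proof -
  have wrt: "has_integral_wrt X N (rhs z) (integral_from_0 (rhs z) b - integral_from_0 (rhs z) a) a b"
    if ab: "a \<in> {-T<..<T}" "b \<in> {-T<..<T}" "a \<le> b" for a b
  proof (rule Riemann_sums_converge_wrt)
    have sub: "{a..b} \<subseteq> {-T<..<T}" using ab by auto
    show "rhs z ` {a..b} \<subseteq> X" using rhs_in_X c(2) sub by blast
    show "continuous_wrt N {a..b} (rhs z)"
      using rN sub unfolding continuous_wrt_def by (meson subsetD tendsto_within_subset)
    show "(rhs z has_integral integral_from_0 (rhs z) b - integral_from_0 (rhs z) a) {a..b}"
      by (rule integral_from_0_increment[OF rhs_continuous[OF c] ab])
  qed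
  have "has_integral_from_0 X N (rhs z) (z t - x0) t" if t: "t \<in> {-T<..<T}" for t
  proof -
    have "z t - x0 = integral_from_0 (rhs z) t" using fixed[OF t] by (simp add: picard_map_def)
    then show ?thesis
      using wrt[OF zero_in t] wrt[OF t zero_in] by (simp add: has_integral_from_0_def)
  qed
  then show ?thesis by (simp add: solves_integral_eq_def rhs_def[abs_def])
qed

text \<open>
  The equivalence of the two formulations is proved in the ambient norm, where the fundamental theorem of
  calculus is available; the notions relative to \<open>N\<close> are finer, and Riemann sums of \<open>N\<close>-continuous functions
  lead back to them.
\<close>

theorem forced_evolution_well_posed:
  fixes F defines "F \<equiv> \<lambda>y t. A y + \<beta> t"
  assumes x0: "x0 \<in> X"
  shows "(\<exists>y y'. C1_wrt X N {-T<..<T} y y' \<and> solves_integral_eq X N {-T<..<T} F x0 y \<and>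
            (\<forall>z z'. C1_wrt X N {-T<..<T} z z' \<and> solves_integral_eq X N {-T<..<T} F x0 z \<longrightarrow>
               (\<forall>t\<in>{-T<..<T}. z t = y t)) \<and>
            lipschitz_wrt N {-T<..<T} y \<and>
            (lipschitz_wrt N {-T<..<T} y' \<longleftrightarrow> lipschitz_wrt N {-T<..<T} \<beta>))"
    and "C1_wrt X N {-T<..<T} z z' \<Longrightarrow>
            solves_integral_eq X N {-T<..<T} F x0 z \<longleftrightarrow> solves_ivp {-T<..<T} F x0 z z'"
proof -
  obtain y C where yc: "continuous_on {-T<..<T} y"
    and yX: "\<And>t. t \<in> {-T<..<T} \<Longrightarrow> y t \<in> X \<and> N (y t) \<le> C"
    and fixed: "\<And>t. t \<in> {-T<..<T} \<Longrightarrow> y t = picard_map x0 y t"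
    using exists_picard_fixed_point[OF x0] by metis
  have img: "y ` {-T<..<T} \<subseteq> X" using yX by auto
  note reg = picard_fixed_point_regular[OF yc yX fixed]
  have "solves_integral_eq X N {-T<..<T} F x0 y"
    unfolding F_def using reg(2) fixed
    by (intro fixed_point_imp_solves_integral_eq[OF yc img]) (auto simp: C1_wrt_def)
  moreover have "z t = y t"
    if z: "C1_wrt X N {-T<..<T} z z'" "solves_integral_eq X N {-T<..<T} F x0 z" and t: "t \<in> {-T<..<T}" for z z' t
  proof (rule picard_fixed_point_unique[OF _ _ _ yc img fixed t])
    show "z ` {-T<..<T} \<subseteq> X" using z(1) by (simp add: C1_wrt_def)
    show "z t = picard_map x0 z t" if "t \<in> {-T<..<T}" for t
      using solves_integral_eq_imp_fixed_point z(2) that unfolding F_def by blast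
  qed (rule C1_wrt_continuous[OF z(1)])
  ultimately show "\<exists>y y'. C1_wrt X N {-T<..<T} y y' \<and> solves_integral_eq X N {-T<..<T} F x0 y \<and>
            (\<forall>z z'. C1_wrt X N {-T<..<T} z z' \<and> solves_integral_eq X N {-T<..<T} F x0 z \<longrightarrow>
               (\<forall>t\<in>{-T<..<T}. z t = y t)) \<and>
            lipschitz_wrt N {-T<..<T} y \<and>
            (lipschitz_wrt N {-T<..<T} y' \<longleftrightarrow> lipschitz_wrt N {-T<..<T} \<beta>)"
    using reg by blast
next
  assume z: "C1_wrt X N {-T<..<T} z z'"
  have zX: "z ` {-T<..<T} \<subseteq> X" using z by (simp add: C1_wrt_def)
  have D: "(z has_vector_derivative z' t) (at t)" if "t \<in> {-T<..<T}" for t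
  proof -
    have "(z has_vector_derivative z' t) (at t within {-T<..<T})"
      using z that by (intro has_vector_derivative_of_wrt) (auto simp: C1_wrt_def)
    then show ?thesis using at_within_open[OF that] by simp
  qed
  note zc = C1_wrt_continuous[OF z]
  show "solves_integral_eq X N {-T<..<T} F x0 z \<longleftrightarrow> solves_ivp {-T<..<T} F x0 z z'"
  proof
    assume "solves_integral_eq X N {-T<..<T} F x0 z"
    then have fixed: "z t = x0 + integral_from_0 (rhs z) t" if "t \<in> {-T<..<T}" for t
      using solves_integral_eq_imp_fixed_point that unfolding F_def picard_map_def by blast
    have "z' t = rhs z t" if t: "t \<in> {-T<..<T}" for t
    proof -
      have "((\<lambda>t. x0 + integral_from_0 (rhs z) t) has_vector_derivative 0 + rhs z t) (at t)"
        by (intro has_vector_derivative_add has_vector_derivative_const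
            integral_from_0_has_vector_derivative[OF rhs_continuous[OF zc zX] t])
      then have "(z has_vector_derivative rhs z t) (at t)"
        using has_vector_derivative_transform_within_open[of _ "0 + rhs z t" t "{-T<..<T}" z] t fixed by simp
      then show ?thesis using vector_derivative_unique_at D[OF t] by blast
    qed
    then show "solves_ivp {-T<..<T} F x0 z z'"
      using fixed[OF zero_in] by (simp add: solves_ivp_def F_def rhs_def)
  next
    assume ivp: "solves_ivp {-T<..<T} F x0 z z'"
    then have z0: "z 0 = x0" and z': "\<And>t. t \<in> {-T<..<T} \<Longrightarrow> z' t = rhs z t"
      by (auto simp: solves_ivp_def F_def rhs_def)
    have ftc: "integral {a..b} (rhs z) = z b - z a" if ab: "a \<in> {-T<..<T}" "b \<in> {-T<..<T}" "a \<le> b" for a b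
    proof (rule integral_unique, rule fundamental_theorem_of_calculus[OF ab(3)])
      fix t assume "t \<in> {a..b}"
      then have "t \<in> {-T<..<T}" using ab by auto
      then show "(z has_vector_derivative rhs z t) (at t within {a..b})"
        using D z' has_vector_derivative_at_within by metis
    qed
    have fixed: "z t = picard_map x0 z t" if "t \<in> {-T<..<T}" for t
      using ftc[OF zero_in that] ftc[OF that zero_in] z0 by (simp add: picard_map_def integral_from_0_def)
    have "continuous_wrt N {-T<..<T} z' = continuous_wrt N {-T<..<T} (rhs z)"
      unfolding continuous_wrt_def by (intro ball_cong refl Lim_cong_within) (simp_all only: z')
    then have "continuous_wrt N {-T<..<T} (rhs z)" using z by (simp add: C1_wrt_def)
    then show "solves_integral_eq X N {-T<..<T} F x0 z"
      unfolding F_def by (rule fixed_point_imp_solves_integral_eq[OF zc zX _ fixed])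
  qed
qed

end

section \<open>The Hoelder space inside the bounded continuous functions\<close>

instance bcontfun :: (metric_space, banach) banach ..

lemma subspace_closure:
  fixes S :: "'a::real_normed_vector set"
  assumes S: "subspace S" shows "subspace (closure S)"
proof (rule subspaceI)
  show "0 \<in> closure S" using subspace_0[OF S] closure_subset by blast
  show "x + y \<in> closure S" if "x \<in> closure S" "y \<in> closure S" for x y
  proof -
    let ?f = "\<lambda>p :: 'a \<times> 'a. fst p + snd p"
    have "bounded_linear ?f" by (intro bounded_linear_add bounded_linear_fst bounded_linear_snd)
    then have "?f ` closure (S \<times> S) \<subseteq> closure (?f ` (S \<times> S))"
      by (rule closure_bounded_linear_image_subset)
    also have "\<dots> \<subseteq> closure S" using subspace_add[OF S] by (intro closure_mono) auto
    finally have "?f ` closure (S \<times> S) \<subseteq> closure S" .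
    moreover have "(x, y) \<in> closure (S \<times> S)" using that by (simp add: closure_Times)
    ultimately show ?thesis by force
  qed
  show "c *\<^sub>R x \<in> closure S" if "x \<in> closure S" for c x
  proof -
    have "(*\<^sub>R) c ` closure S \<subseteq> closure ((*\<^sub>R) c ` S)"
      by (intro closure_bounded_linear_image_subset bounded_linear_scaleR_right)
    also have "\<dots> \<subseteq> closure S" using subspace_scale[OF S] by (intro closure_mono) auto
    finally show ?thesis using that by blast
  qed
qed

text \<open>
  Any compact set off which the function vanishes can serve in place of the closed support.
\<close>

lemma C0_space_alt:
  fixes D :: "'a::metric_space set"
  shows "(C0_space D :: ('a \<Rightarrow>\<^sub>C 'b::real_normed_vector) set) = closure {\<phi>. \<exists>K. compact K \<and> K \<subseteq> D \<and> (\<forall>x. x \<notin> K \<longrightarrow> apply_bcontfun \<phi> x = 0)}"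
proof -
  have "(compact (closure {x. apply_bcontfun \<phi> x \<noteq> 0}) \<and> closure {x. apply_bcontfun \<phi> x \<noteq> 0} \<subseteq> D)
      \<longleftrightarrow> (\<exists>K. compact K \<and> K \<subseteq> D \<and> (\<forall>x. x \<notin> K \<longrightarrow> apply_bcontfun \<phi> x = 0))" (is "?l \<longleftrightarrow> ?r") for \<phi> :: "'a \<Rightarrow>\<^sub>C 'b"
  proof
    assume ?l
    moreover have "x \<in> closure {x. apply_bcontfun \<phi> x \<noteq> 0}" if "apply_bcontfun \<phi> x \<noteq> 0" for x
      using that closure_subset by fast
    ultimately show ?r by (intro exI[of _ "closure {x. apply_bcontfun \<phi> x \<noteq> 0}"]) blast
  next
    assume ?r
    then obtain K where K: "compact K" "K \<subseteq> D" "\<forall>x. x \<notin> K \<longrightarrow> apply_bcontfun \<phi> x = 0" by blast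
    have "closure {x. apply_bcontfun \<phi> x \<noteq> 0} \<subseteq> K"
      using K compact_imp_closed by (intro closure_minimal) auto
    moreover from this have "compact (closure {x. apply_bcontfun \<phi> x \<noteq> 0})"
      using compact_Int_closed[OF K(1) closed_closure, of "{x. apply_bcontfun \<phi> x \<noteq> 0}"] by (simp add: Int_absorb1)
    ultimately show ?l using K(2) by blast
  qed
  then show ?thesis unfolding C0_space_def by simp
qed

lemma C0_space_approx:
  assumes "u \<in> C0_space D" "e > 0"
  obtains \<phi> K where "compact K" "K \<subseteq> D" "\<And>x. x \<notin> K \<Longrightarrow> apply_bcontfun \<phi> x = 0" "dist \<phi> u < e"
proof -
  have "\<forall>e>0. \<exists>\<phi>\<in>{\<phi>. \<exists>K. compact K \<and> K \<subseteq> D \<and> (\<forall>x. x \<notin> K \<longrightarrow> apply_bcontfun \<phi> x = 0)}. dist \<phi> u < e"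
    using assms(1) by (simp only: C0_space_alt closure_approachable)
  from this[rule_format, OF assms(2)] obtain \<phi> where \<phi>: "dist \<phi> u < e"
    and "\<exists>K. compact K \<and> K \<subseteq> D \<and> (\<forall>x. x \<notin> K \<longrightarrow> apply_bcontfun \<phi> x = 0)" by (elim bexE CollectE)
  then obtain K where "compact K" "K \<subseteq> D" "\<forall>x. x \<notin> K \<longrightarrow> apply_bcontfun \<phi> x = 0" by (elim exE conjE)
  then show thesis using \<phi> by (intro that[of K \<phi>]) simp_all
qed

lemma C0_space_vanishes:
  assumes u: "u \<in> C0_space D" and x: "x \<notin> D"
  shows "apply_bcontfun u x = 0"
proof -
  have "norm (u x) \<le> 0 + e" if e: "e > 0" for e
  proof -
    obtain \<phi> K where \<phi>: "K \<subseteq> D" "\<And>x. x \<notin> K \<Longrightarrow> apply_bcontfun \<phi> x = 0" "dist \<phi> u < e"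
      using C0_space_approx[OF u e] by metis
    then have "\<phi> x = 0" using x by blast
    then show ?thesis using dist_fun_lt_imp_dist_val_lt[OF \<phi>(3), of x] by (simp add: dist_norm)
  qed
  then show ?thesis using field_le_epsilon[of "norm (u x)" 0] by simp
qed

lemma subspace_C0_space: "subspace (C0_space D :: ('a::metric_space \<Rightarrow>\<^sub>C 'b::real_normed_vector) set)"
  unfolding C0_space_alt
proof (rule subspace_closure, rule subspaceI)
  let ?S = "{\<phi>. \<exists>K. compact K \<and> K \<subseteq> D \<and> (\<forall>x. x \<notin> K \<longrightarrow> apply_bcontfun \<phi> x = 0)}"
  show "0 \<in> ?S" by (auto intro: exI[of _ "{}"])
  show "\<phi> + \<psi> \<in> ?S" if "\<phi> \<in> ?S" "\<psi> \<in> ?S" for \<phi> \<psi> :: "'a \<Rightarrow>\<^sub>C 'b"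
  proof -
    obtain K K' where "compact K" "K \<subseteq> D" "\<forall>x. x \<notin> K \<longrightarrow> apply_bcontfun \<phi> x = 0"
      "compact K'" "K' \<subseteq> D" "\<forall>x. x \<notin> K' \<longrightarrow> apply_bcontfun \<psi> x = 0" using \<open>\<phi> \<in> ?S\<close> \<open>\<psi> \<in> ?S\<close> by blast
    then show ?thesis by (auto intro!: exI[of _ "K \<union> K'"] compact_Un)
  qed
  show "c *\<^sub>R \<phi> \<in> ?S" if "\<phi> \<in> ?S" for c and \<phi> :: "'a \<Rightarrow>\<^sub>C 'b" using that by auto
qed

text \<open>
  A product with a bounded continuous function is approximated by the products with compactly supported
  approximations of the first factor.
\<close>

lemma C0_space_mult:
  fixes G :: "'a::metric_space \<Rightarrow>\<^sub>C 'b::real_normed_vector" and \<omega> :: "'a \<Rightarrow>\<^sub>C real"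
  assumes "\<omega> \<in> C0_space D" and w: "\<And>x. apply_bcontfun w x = \<omega> x *\<^sub>R G x"
  shows "w \<in> C0_space D"
  unfolding C0_space_alt closure_approachable
proof (intro allI impI)
  fix e :: real assume e: "e > 0"
  define e' where "e' = e / (norm G + 1)"
  have e': "e' > 0" using e by (simp add: e'_def add_nonneg_pos)
  obtain \<phi> K where \<phi>: "compact K" "K \<subseteq> D" "\<And>x. x \<notin> K \<Longrightarrow> apply_bcontfun \<phi> x = 0" "dist \<phi> \<omega> < e'"
    using C0_space_approx[OF assms(1) e'] by metis
  have "(\<lambda>x. \<phi> x *\<^sub>R G x) \<in> bcontfun"
  proof (rule bcontfun_normI)
    show "continuous_on UNIV (\<lambda>x. \<phi> x *\<^sub>R G x)" by (intro continuous_intros) auto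
    show "norm (\<phi> x *\<^sub>R G x) \<le> norm \<phi> * norm G" for x
      using norm_bounded[of \<phi> x] norm_bounded[of G x] by (simp add: mult_mono)
  qed
  then obtain p where p: "\<And>x. apply_bcontfun p x = \<phi> x *\<^sub>R G x" by (metis bcontfunE)
  have "dist p w \<le> e' * norm G"
  proof (rule dist_bound)
    fix x
    have "dist (p x) (w x) = \<bar>\<phi> x - \<omega> x\<bar> * norm (G x)"
      by (simp add: p w dist_norm flip: scaleR_diff_left)
    also have "\<dots> \<le> e' * norm G"
      using dist_fun_lt_imp_dist_val_lt[OF \<phi>(4), of x] norm_bounded[of G x] e'
      by (intro mult_mono) (auto simp: dist_real_def)
    finally show "dist (p x) (w x) \<le> e' * norm G" .
  qed
  also have "\<dots> < e' * (norm G + 1)" using e' by simp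
  also have "\<dots> = e" by (simp add: e'_def add_nonneg_pos less_imp_neq[THEN not_sym])
  finally have "dist p w < e" .
  moreover have "p \<in> {\<phi>. \<exists>K. compact K \<and> K \<subseteq> D \<and> (\<forall>x. x \<notin> K \<longrightarrow> apply_bcontfun \<phi> x = 0)}"
    using \<phi>(1-3) p by (intro CollectI exI[of _ K]) simp
  ultimately show "\<exists>y\<in>{\<phi>. \<exists>K. compact K \<and> K \<subseteq> D \<and> (\<forall>x. x \<notin> K \<longrightarrow> apply_bcontfun \<phi> x = 0)}. dist y w < e"
    by blast
qed

text \<open>
  One constant for the sup norm and the Hoelder seminorm, on the whole space: the force evaluates
  displacements outside \<open>D\<close>.
\<close>

definition holder_bounded :: "real \<Rightarrow> real \<Rightarrow> ('a::metric_space \<Rightarrow> 'b::real_normed_vector) \<Rightarrow> bool" where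
  "holder_bounded \<gamma> C u \<longleftrightarrow>
     (\<forall>x. norm (u x) \<le> C) \<and> (\<forall>x y. norm (u x - u y) \<le> C * dist x y powr \<gamma>)"

lemma continuous_on_dist_powr: "0 < \<gamma> \<Longrightarrow> continuous_on S (\<lambda>y. dist x y powr \<gamma>)"
  by (intro continuous_on_powr' continuous_intros) auto

lemma holder_bounded_continuous:
  assumes \<gamma>: "0 < \<gamma>" and u: "holder_bounded \<gamma> C u"
  shows "continuous_on S u"
  unfolding continuous_on_def
proof (rule ballI)
  fix x assume "x \<in> S"
  have "((\<lambda>y. C * dist x y powr \<gamma>) \<longlongrightarrow> C * dist x x powr \<gamma>) (at x within S)"
    using continuous_on_dist_powr[OF \<gamma>, of S x] \<open>x \<in> S\<close> by (intro tendsto_mult tendsto_const) (simp only: continuous_on_def)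
  then have lim: "((\<lambda>y. C * dist x y powr \<gamma>) \<longlongrightarrow> 0) (at x within S)" by simp
  have "norm (u y - u x) \<le> C * dist x y powr \<gamma>" for y
    using u by (simp add: holder_bounded_def norm_minus_commute[of "u y"])
  then have "\<forall>\<^sub>F y in at x within S. norm (u y - u x) \<le> C * dist x y powr \<gamma>"
    by (intro always_eventually allI)
  then have "((\<lambda>y. u y - u x) \<longlongrightarrow> 0) (at x within S)"
    using lim by (rule Lim_null_comparison)
  then show "(u \<longlongrightarrow> u x) (at x within S)" by (simp add: LIM_zero_iff)
qed

lemma holder_bounded_in_bcontfun:
  assumes "0 < \<gamma>" "holder_bounded \<gamma> C u" shows "u \<in> bcontfun"
  using holder_bounded_continuous[OF assms] assms(2) by (auto intro: bcontfun_normI simp: holder_bounded_def)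

text \<open>
  The Hoelder norm is a sum of two suprema, that is, one supremum over triples of points. Each value of a
  triple is a continuous seminorm for uniform convergence, so balls of the Hoelder norm are
  intersections of closed convex sets.
\<close>

definition triples :: "'a set \<Rightarrow> ('a \<times> 'a \<times> 'a) set" where
  "triples D = {(x, y, z). x \<in> D \<and> y \<in> D \<and> z \<in> D \<and> y \<noteq> z}"

definition triple_value ::
    "real \<Rightarrow> 'a::metric_space \<times> 'a \<times> 'a \<Rightarrow> ('a \<Rightarrow>\<^sub>C 'b::real_normed_vector) \<Rightarrow> real" where
  "triple_value \<gamma> = (\<lambda>(x, y, z) u. norm (u x) + dist (u y) (u z) / dist y z powr \<gamma>)"

lemma triples_nonempty:
  fixes D :: "'a::euclidean_space set"
  assumes "open D" "D \<noteq> {}" shows "triples D \<noteq> {}" and "\<And>x. x \<in> D \<Longrightarrow> \<exists>y z. (x, y, z) \<in> triples D"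
proof -
  obtain y where y: "y \<in> D" using assms by blast
  have "D \<noteq> {y}" using assms by (metis not_open_singleton)
  then obtain z where "z \<in> D" "y \<noteq> z" using y by blast
  then have "(y, y, z) \<in> triples D" "\<And>x. x \<in> D \<Longrightarrow> (x, y, z) \<in> triples D" using y by (auto simp: triples_def)
  then show "triples D \<noteq> {}" "\<And>x. x \<in> D \<Longrightarrow> \<exists>y z. (x, y, z) \<in> triples D" by blast+
qed

lemma triple_value_add: "triple_value \<gamma> i (u + v) \<le> triple_value \<gamma> i u + triple_value \<gamma> i v"
proof -
  obtain x y z where i: "i = (x, y, z)" by (cases i)
  have "dist (u y + v y) (u z + v z) / dist y z powr \<gamma> \<le> (dist (u y) (u z) + dist (v y) (v z)) / dist y z powr \<gamma>"
    by (intro divide_right_mono dist_triangle_add) auto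
  then show ?thesis
    using norm_triangle_ineq[of "u x" "v x"] by (simp add: i triple_value_def add_divide_distrib)
qed

lemma triple_value_scale: "triple_value \<gamma> i (c *\<^sub>R u) = \<bar>c\<bar> * triple_value \<gamma> i u"
  by (cases i) (simp add: triple_value_def distrib_left dist_scaleR dist_norm flip: scaleR_diff_right)

lemma continuous_on_eval: "continuous_on S (\<lambda>u. apply_bcontfun u x)"
proof -
  have "continuous_on UNIV (\<lambda>u. apply_bcontfun u x)"
    by (rule lipschitz_on_continuous_on[of 1], rule lipschitz_onI) (auto simp: dist_bounded)
  then show ?thesis by (rule continuous_on_subset) simp
qed

lemma continuous_on_triple_value:
  assumes "i \<in> triples D" shows "continuous_on S (triple_value \<gamma> i)"
proof -
  obtain x y z where i: "i = (x, y, z)" "y \<noteq> z" using assms by (auto simp: triples_def)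
  then show ?thesis unfolding triple_value_def i split
    by (intro continuous_intros continuous_on_eval) auto
qed

lemma C0_holder_norm_le_iff:
  fixes D :: "'a::euclidean_space set" and u :: "'a \<Rightarrow>\<^sub>C 'b::real_normed_vector"
  assumes D: "open D" "D \<noteq> {}"
  shows "u \<in> C0_holder \<gamma> D \<and> holder_norm \<gamma> D u \<le> c \<longleftrightarrow>
    u \<in> C0_space D \<and> (\<forall>i\<in>triples D. triple_value \<gamma> i u \<le> c)"
proof -
  have bdd: "bdd_above ((\<lambda>x. norm (u x)) ` D)" using norm_bounded[of u] by (auto intro!: bdd_aboveI)
  show ?thesis
  proof (intro iffI conjI ballI)
    fix i assume l: "u \<in> C0_holder \<gamma> D \<and> holder_norm \<gamma> D u \<le> c" and "i \<in> triples D"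
    then obtain x y z where i: "i = (x, y, z)" "x \<in> D" "y \<in> D" "z \<in> D" "y \<noteq> z" by (auto simp: triples_def)
    have "norm (u x) \<le> (SUP x\<in>D. norm (u x))" using bdd i by (intro cSUP_upper)
    moreover have "dist (u y) (u z) / dist y z powr \<gamma> \<le> Sup (holder_quotients \<gamma> D u)"
      using l i by (intro cSup_upper) (auto simp: C0_holder_def holder_quotients_def)
    ultimately show "triple_value \<gamma> i u \<le> c" using l by (simp add: i triple_value_def holder_norm_def)
  next
    assume r: "u \<in> C0_space D \<and> (\<forall>i\<in>triples D. triple_value \<gamma> i u \<le> c)"
    have q: "q \<le> c - norm (u x)" if qx: "q \<in> holder_quotients \<gamma> D u" "x \<in> D" for q x
    proof -
      obtain y z where yz: "q = dist (u y) (u z) / dist y z powr \<gamma>" "y \<in> D" "z \<in> D" "y \<noteq> z"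
        using qx(1) by (auto simp: holder_quotients_def)
      then have "triple_value \<gamma> (x, y, z) u \<le> c" using r qx(2) by (simp add: triples_def)
      then show ?thesis by (simp add: triple_value_def yz(1))
    qed
    obtain x where x: "x \<in> D" using D by blast
    have ne: "holder_quotients \<gamma> D u \<noteq> {}"
      using triples_nonempty(1)[OF D] by (auto simp: holder_quotients_def triples_def)
    have "bdd_above (holder_quotients \<gamma> D u)" using q[OF _ x] by (intro bdd_aboveI)
    then show "u \<in> C0_holder \<gamma> D" using r by (simp add: C0_holder_def)
    have "norm (u x) \<le> c - Sup (holder_quotients \<gamma> D u)" if "x \<in> D" for x
      using cSup_least[OF ne q[OF _ that]] by simp
    then have "(SUP x\<in>D. norm (u x)) \<le> c - Sup (holder_quotients \<gamma> D u)"
      using D by (intro cSUP_least) auto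
    then show "holder_norm \<gamma> D u \<le> c" by (simp add: holder_norm_def)
  qed (auto simp: C0_holder_def)
qed

lemma
  fixes D :: "'a::euclidean_space set" and u :: "'a \<Rightarrow>\<^sub>C 'b::real_normed_vector"
  assumes D: "open D" "D \<noteq> {}" and u: "u \<in> C0_holder \<gamma> D"
  shows triple_value_le_holder_norm: "i \<in> triples D \<Longrightarrow> triple_value \<gamma> i u \<le> holder_norm \<gamma> D u"
    and norm_le_holder_norm: "norm u \<le> holder_norm \<gamma> D u"
proof -
  show tv: "triple_value \<gamma> i u \<le> holder_norm \<gamma> D u" if "i \<in> triples D" for i
    using C0_holder_norm_le_iff[OF D, of u \<gamma> "holder_norm \<gamma> D u"] u that by auto
  have inD: "norm (u x) \<le> holder_norm \<gamma> D u" if x: "x \<in> D" for x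
  proof -
    obtain y z where "(x, y, z) \<in> triples D" using triples_nonempty(2)[OF D x] by blast
    from tv[OF this] have "norm (u x) + dist (u y) (u z) / dist y z powr \<gamma> \<le> holder_norm \<gamma> D u"
      by (simp add: triple_value_def)
    moreover have "0 \<le> dist (u y) (u z) / dist y z powr \<gamma>" by simp
    ultimately show ?thesis by linarith
  qed
  show "norm u \<le> holder_norm \<gamma> D u"
  proof (rule norm_bound)
    fix x
    obtain x' where "x' \<in> D" using D by blast
    then have "0 \<le> holder_norm \<gamma> D u" using inD norm_ge_zero order_trans by blast
    then show "norm (u x) \<le> holder_norm \<gamma> D u"
      using inD C0_space_vanishes[of u D x] u by (cases "x \<in> D") (auto simp: C0_holder_def)
  qed
qed

text \<open>
  The extension by zero keeps the Hoelder constant: a segment from \<open>x\<close> in \<open>D\<close> to \<open>y\<close> outside meets the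
  frontier at a point that is no farther from \<open>x\<close> than \<open>y\<close>, where the function vanishes and to which the
  estimate inside \<open>D\<close> extends by continuity.
\<close>

lemma holder_bounded_of_C0_holder:
  fixes D :: "'a::euclidean_space set" and u :: "'a \<Rightarrow>\<^sub>C 'b::real_normed_vector"
  assumes D: "open D" "D \<noteq> {}" and \<gamma>: "0 < \<gamma>" and u: "u \<in> C0_holder \<gamma> D"
  shows "holder_bounded \<gamma> (holder_norm \<gamma> D u) u"
proof -
  let ?C = "holder_norm \<gamma> D u"
  have C0: "0 \<le> ?C" using norm_le_holder_norm[OF D u] norm_ge_zero order_trans by blast
  have van: "u x = 0" if "x \<notin> D" for x using C0_space_vanishes u that by (auto simp: C0_holder_def)
  have inner: "norm (u x - u y) \<le> ?C * dist x y powr \<gamma>" if "x \<in> D" "y \<in> D" for x y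
  proof (cases "x = y")
    case False
    then have "triple_value \<gamma> (x, x, y) u \<le> ?C"
      using that by (intro triple_value_le_holder_norm[OF D u]) (simp add: triples_def)
    then have "dist (u x) (u y) / dist x y powr \<gamma> \<le> ?C"
      unfolding triple_value_def by (simp add: order_trans[rotated])
    then show ?thesis using False by (simp add: divide_le_eq dist_norm)
  qed simp
  have cl: "norm (u x - u z) \<le> ?C * dist x z powr \<gamma>" if x: "x \<in> D" and z: "z \<in> closure D" for x z
  proof -
    have "closed {z. norm (u x - u z) \<le> ?C * dist x z powr \<gamma>}"
      by (intro closed_Collect_le continuous_intros continuous_on_dist_powr \<gamma>) auto
    then have "closure D \<subseteq> {z. norm (u x - u z) \<le> ?C * dist x z powr \<gamma>}"
      using inner x by (intro closure_minimal) auto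
    then show ?thesis using z by blast
  qed
  have outer: "norm (u x - u y) \<le> ?C * dist x y powr \<gamma>" if x: "x \<in> D" and y: "y \<notin> D" for x y
  proof -
    have "closed_segment x y \<inter> frontier D \<noteq> {}"
      using x y by (intro connected_Int_frontier) auto
    then obtain z where z: "z \<in> closed_segment x y" "z \<in> frontier D" by blast
    have "z \<notin> D" "z \<in> closure D" using z(2) D by (auto simp: frontier_def interior_open)
    then have "norm (u x - u y) \<le> ?C * dist x z powr \<gamma>" using cl[OF x, of z] van y by simp
    also have "\<dots> \<le> ?C * dist x y powr \<gamma>"
      using segment_bound(1)[OF z(1)] C0 \<gamma>
      by (intro mult_left_mono powr_mono2) (auto simp: dist_norm norm_minus_commute)
    finally show ?thesis .
  qed
  have "norm (u x - u y) \<le> ?C * dist x y powr \<gamma>" for x y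
  proof (cases "x \<in> D")
    case True
    then show ?thesis using inner outer by (cases "y \<in> D") auto
  next
    case False
    show ?thesis
    proof (cases "y \<in> D")
      case True
      then show ?thesis using outer[OF True False] by (simp add: norm_minus_commute dist_commute)
    next
      case F: False
      show ?thesis using van[OF False] van[OF F] C0 by simp
    qed
  qed
  moreover have "norm (u x) \<le> ?C" for x
    using norm_bounded norm_le_holder_norm[OF D u] order_trans by blast
  ultimately show ?thesis by (simp add: holder_bounded_def)
qed

text \<open>
  The factor two appears because the norm adds the two quantities that \<open>C\<close> bounds separately.
\<close>

lemma C0_holder_of_holder_bounded:
  fixes D :: "'a::euclidean_space set" and u :: "'a \<Rightarrow>\<^sub>C 'b::real_normed_vector"
  assumes D: "open D" "D \<noteq> {}" and u: "u \<in> C0_space D" "holder_bounded \<gamma> C u"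
  shows "u \<in> C0_holder \<gamma> D \<and> holder_norm \<gamma> D u \<le> 2 * C"
proof -
  have "triple_value \<gamma> i u \<le> 2 * C" if tr: "i \<in> triples D" for i
  proof -
    obtain x y z where i: "i = (x, y, z)" "y \<noteq> z" using tr by (auto simp: triples_def)
    have "norm (u x) \<le> C" "norm (u y - u z) \<le> C * dist y z powr \<gamma>" using u(2) by (auto simp: holder_bounded_def)
    moreover from this(2) have "dist (u y) (u z) / dist y z powr \<gamma> \<le> C"
      using i(2) by (simp add: divide_le_eq dist_norm)
    ultimately show ?thesis by (simp add: i(1) triple_value_def)
  qed
  then show ?thesis using C0_holder_norm_le_iff[OF D] u(1) by blast
qed

text \<open>
  The same description for pairs, with the two suprema taken over independent triples.
\<close>

lemma X_norm_le_iff: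
  fixes D :: "'a::euclidean_space set" and y :: "('a \<Rightarrow>\<^sub>C 'b::real_normed_vector) \<times> ('a \<Rightarrow>\<^sub>C 'b)"
  assumes D: "open D" "D \<noteq> {}"
  shows "y \<in> X_space \<gamma> D \<and> X_norm \<gamma> D y \<le> c \<longleftrightarrow> fst y \<in> C0_space D \<and> snd y \<in> C0_space D \<and>
    (\<forall>i\<in>triples D. \<forall>j\<in>triples D. triple_value \<gamma> i (fst y) + triple_value \<gamma> j (snd y) \<le> c)"
proof -
  obtain u v where y: "y = (u, v)" by (cases y)
  show ?thesis
  proof
    assume "y \<in> X_space \<gamma> D \<and> X_norm \<gamma> D y \<le> c"
    then have uv: "u \<in> C0_holder \<gamma> D" "v \<in> C0_holder \<gamma> D" "holder_norm \<gamma> D u + holder_norm \<gamma> D v \<le> c"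
      by (auto simp: y X_space_def X_norm_def)
    have "triple_value \<gamma> i u + triple_value \<gamma> j v \<le> c" if "i \<in> triples D" "j \<in> triples D" for i j
      using triple_value_le_holder_norm[OF D uv(1) that(1)] triple_value_le_holder_norm[OF D uv(2) that(2)] uv(3)
      by linarith
    then show "fst y \<in> C0_space D \<and> snd y \<in> C0_space D \<and>
      (\<forall>i\<in>triples D. \<forall>j\<in>triples D. triple_value \<gamma> i (fst y) + triple_value \<gamma> j (snd y) \<le> c)"
      using uv by (auto simp: y C0_holder_def)
  next
    assume r: "fst y \<in> C0_space D \<and> snd y \<in> C0_space D \<and>
      (\<forall>i\<in>triples D. \<forall>j\<in>triples D. triple_value \<gamma> i (fst y) + triple_value \<gamma> j (snd y) \<le> c)"
    have u: "u \<in> C0_holder \<gamma> D \<and> holder_norm \<gamma> D u \<le> c - triple_value \<gamma> j v" if "j \<in> triples D" for j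
      using r that unfolding C0_holder_norm_le_iff[OF D] by (force simp: y)
    have "triple_value \<gamma> j v \<le> c - holder_norm \<gamma> D u" if "j \<in> triples D" for j
      using u[OF that] by simp
    then have "v \<in> C0_holder \<gamma> D \<and> holder_norm \<gamma> D v \<le> c - holder_norm \<gamma> D u"
      using r C0_holder_norm_le_iff[OF D, of v \<gamma> "c - holder_norm \<gamma> D u"] by (simp add: y)
    then show "y \<in> X_space \<gamma> D \<and> X_norm \<gamma> D y \<le> c"
      using u triples_nonempty(1)[OF D] by (force simp: y X_space_def X_norm_def)
  qed
qed

lemma normed_subspace_X_space:
  fixes D :: "'a::euclidean_space set"
  assumes D: "open D" "D \<noteq> {}"
  shows "normed_subspace (X_space \<gamma> D :: (('a \<Rightarrow>\<^sub>C 'b::banach) \<times> ('a \<Rightarrow>\<^sub>C 'b)) set) (X_norm \<gamma> D)"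
proof -
  let ?X = "X_space \<gamma> D :: (('a \<Rightarrow>\<^sub>C 'b) \<times> ('a \<Rightarrow>\<^sub>C 'b)) set" and ?N = "X_norm \<gamma> D"
  note sub = subspace_C0_space[where ?'a = 'a and ?'b = 'b, of D]
  have tv: "triple_value \<gamma> i (fst y) + triple_value \<gamma> j (snd y) \<le> ?N y"
    if "y \<in> ?X" "i \<in> triples D" "j \<in> triples D" for y i j
    using X_norm_le_iff[OF D, of y \<gamma> "?N y"] that by blast
  have C0: "fst y \<in> C0_space D" "snd y \<in> C0_space D" if "y \<in> ?X" for y
    using X_norm_le_iff[OF D, of y \<gamma> "?N y"] that by blast+
  have add: "x + y \<in> ?X \<and> ?N (x + y) \<le> ?N x + ?N y" if x: "x \<in> ?X" and y: "y \<in> ?X" for x y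
    unfolding X_norm_le_iff[OF D]
  proof (intro conjI ballI)
    fix i j :: "'a \<times> 'a \<times> 'a" assume "i \<in> triples D" "j \<in> triples D"
    then show "triple_value \<gamma> i (fst (x + y)) + triple_value \<gamma> j (snd (x + y)) \<le> ?N x + ?N y"
      using tv[OF x, of i j] tv[OF y, of i j] triple_value_add[of \<gamma> i "fst x" "fst y"]
        triple_value_add[of \<gamma> j "snd x" "snd y"] by simp
  qed (use C0[OF x] C0[OF y] subspace_add[OF sub] in auto)
  have scale: "c *\<^sub>R x \<in> ?X \<and> ?N (c *\<^sub>R x) \<le> \<bar>c\<bar> * ?N x" if x: "x \<in> ?X" for c x
    unfolding X_norm_le_iff[OF D]
  proof (intro conjI ballI)
    fix i j :: "'a \<times> 'a \<times> 'a" assume "i \<in> triples D" "j \<in> triples D"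
    then show "triple_value \<gamma> i (fst (c *\<^sub>R x)) + triple_value \<gamma> j (snd (c *\<^sub>R x)) \<le> \<bar>c\<bar> * ?N x"
      using mult_left_mono[OF tv[OF x, of i j], of "\<bar>c\<bar>"] by (simp add: triple_value_scale distrib_left)
  qed (use C0[OF x] subspace_scale[OF sub] in auto)
  have zero: "0 \<in> ?X"
    using subspace_0[OF sub] C0_holder_of_holder_bounded[OF D, of "0 :: 'a \<Rightarrow>\<^sub>C 'b" \<gamma> 0]
    by (simp add: X_space_def holder_bounded_def zero_prod_def)
  show ?thesis
  proof
    show "subspace ?X" using zero add scale by (simp add: subspace_def)
    show "?N (x + y) \<le> ?N x + ?N y" if "x \<in> ?X" "y \<in> ?X" for x y using add that by blast
    show "?N (c *\<^sub>R x) \<le> \<bar>c\<bar> * ?N x" if "x \<in> ?X" for c x using scale that by blast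
    show "norm x \<le> ?N x" if x: "x \<in> ?X" for x
    proof -
      have "norm x \<le> norm (fst x) + norm (snd x)" using norm_Pair_le[of "fst x" "snd x"] by simp
      also have "\<dots> \<le> ?N x" using x norm_le_holder_norm[OF D]
        by (auto simp: X_space_def X_norm_def intro!: add_mono)
      finally show ?thesis .
    qed
    show "closed {x \<in> ?X. ?N x \<le> c}" for c
    proof -
      have "closed {y :: ('a \<Rightarrow>\<^sub>C 'b) \<times> ('a \<Rightarrow>\<^sub>C 'b). triple_value \<gamma> i (fst y) + triple_value \<gamma> j (snd y) \<le> c}"
        if "i \<in> triples D" "j \<in> triples D" for i j
        using that
        by (intro closed_Collect_le continuous_intros
            continuous_on_compose2[OF continuous_on_triple_value continuous_on_fst[OF continuous_on_id] subset_UNIV]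
            continuous_on_compose2[OF continuous_on_triple_value continuous_on_snd[OF continuous_on_id] subset_UNIV])
      then have "closed (\<Inter>i\<in>triples D. \<Inter>j\<in>triples D.
          {y :: ('a \<Rightarrow>\<^sub>C 'b) \<times> ('a \<Rightarrow>\<^sub>C 'b). triple_value \<gamma> i (fst y) + triple_value \<gamma> j (snd y) \<le> c})"
        by (intro closed_INT) blast
      moreover have "closed ((C0_space D :: ('a \<Rightarrow>\<^sub>C 'b) set) \<times> (C0_space D :: ('a \<Rightarrow>\<^sub>C 'b) set))"
        unfolding C0_space_def by (intro closed_Times closed_closure)
      ultimately have "closed ((C0_space D :: ('a \<Rightarrow>\<^sub>C 'b) set) \<times> (C0_space D :: ('a \<Rightarrow>\<^sub>C 'b) set) \<inter>
         (\<Inter>i\<in>triples D. \<Inter>j\<in>triples D.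
          {y :: ('a \<Rightarrow>\<^sub>C 'b) \<times> ('a \<Rightarrow>\<^sub>C 'b). triple_value \<gamma> i (fst y) + triple_value \<gamma> j (snd y) \<le> c}))"
        by (rule closed_Int[rotated])
      moreover have "{x \<in> ?X. ?N x \<le> c} = (C0_space D :: ('a \<Rightarrow>\<^sub>C 'b) set) \<times> (C0_space D :: ('a \<Rightarrow>\<^sub>C 'b) set) \<inter>
         (\<Inter>i\<in>triples D. \<Inter>j\<in>triples D.
          {y :: ('a \<Rightarrow>\<^sub>C 'b) \<times> ('a \<Rightarrow>\<^sub>C 'b). triple_value \<gamma> i (fst y) + triple_value \<gamma> j (snd y) \<le> c})"
        unfolding X_norm_le_iff[OF D] by (auto simp: mem_Times_iff)
      ultimately show ?thesis by simp
    qed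
  qed
qed

section \<open>Operators with tame Hoelder estimates\<close>

text \<open>
  With \<open>p = a - b\<close> and \<open>q = c - d\<close>, the step from \<open>q\<close> to \<open>p\<close> at the base point \<open>d\<close> costs the first term. Moving
  the increment \<open>p\<close> from base \<open>d\<close> to base \<open>b\<close> costs the second, by the mean value theorem for
  \<open>t \<mapsto> h (b + t) - h (d + t)\<close>. Only the variation between the second arguments \<open>b\<close> and \<open>d\<close> enters.
\<close>

lemma second_difference_bound:
  fixes h h' :: "real \<Rightarrow> real"
  assumes h: "\<And>x. (h has_real_derivative h' x) (at x)"
    and h'_bd: "\<And>x. \<bar>h' x\<bar> \<le> K" and h'_lip: "\<And>x y. \<bar>h' x - h' y\<bar> \<le> K * \<bar>x - y\<bar>"
  shows "\<bar>h a - h b - (h c - h d)\<bar> \<le> K * \<bar>(a - b) - (c - d)\<bar> + K * \<bar>a - b\<bar> * \<bar>b - d\<bar>"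
proof -
  have lip: "\<bar>h x - h y\<bar> \<le> K * \<bar>x - y\<bar>" for x y
    using field_differentiable_bound[of UNIV h h' K x y] h h'_bd by (auto simp: has_field_derivative_at_within)
  define p where "p = a - b"
  define q where "q = c - d"
  define \<phi> where "\<phi> t = h (b + t) - h (d + t)" for t
  have "(\<phi> has_real_derivative h' (b + t) - h' (d + t)) (at t)" for t
    unfolding \<phi>_def by (auto intro!: derivative_eq_intros DERIV_chain2[OF h])
  moreover have "\<bar>h' (b + t) - h' (d + t)\<bar> \<le> K * \<bar>b - d\<bar>" for t
    using h'_lip[of "b + t" "d + t"] by simp
  ultimately have "\<bar>\<phi> p - \<phi> 0\<bar> \<le> K * \<bar>b - d\<bar> * \<bar>p - 0\<bar>"
    using field_differentiable_bound[of UNIV \<phi> "\<lambda>t. h' (b + t) - h' (d + t)" "K * \<bar>b - d\<bar>" p 0]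
    by (auto simp: has_field_derivative_at_within)
  moreover have "\<bar>h (d + p) - h (d + q)\<bar> \<le> K * \<bar>p - q\<bar>" using lip[of "d + p" "d + q"] by simp
  moreover have "h a - h b - (h c - h d) = (\<phi> p - \<phi> 0) + (h (d + p) - h (d + q))"
    by (simp add: \<phi>_def p_def q_def)
  ultimately show ?thesis by (simp add: p_def q_def mult_ac)
qed

text \<open>
  The Hoelder estimate depends on the size \<open>R\<close> of \<open>v\<close> alone, not of \<open>u\<close>. Taking \<open>v = 0\<close> it gives linear growth with
  constant \<open>L 0\<close>, so that the estimates compose. The same \<open>L 0\<close> is the Lipschitz constant for the sup
  norm on Hoelder functions.
\<close>

definition tame :: "real \<Rightarrow> (real \<Rightarrow> real) \<Rightarrow>
    (('a::metric_space \<Rightarrow> 'b::real_normed_vector) \<Rightarrow> ('a \<Rightarrow> 'c::real_normed_vector)) \<Rightarrow> bool" where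
  "tame \<gamma> L G \<longleftrightarrow> G (\<lambda>_. 0) = (\<lambda>_. 0) \<and> (\<forall>R\<ge>0. 0 \<le> L R) \<and>
     (\<forall>u v C1 C2 C. holder_bounded \<gamma> C1 u \<longrightarrow> holder_bounded \<gamma> C2 v \<longrightarrow> (\<forall>x. norm (u x - v x) \<le> C) \<longrightarrow>
        (\<forall>x. norm (G u x - G v x) \<le> L 0 * C)) \<and>
     (\<forall>u v R C. holder_bounded \<gamma> R v \<longrightarrow> holder_bounded \<gamma> C (\<lambda>x. u x - v x) \<longrightarrow>
        holder_bounded \<gamma> (L R * C) (\<lambda>x. G u x - G v x))"

lemma
  assumes "tame \<gamma> L G"
  shows tame_zero: "G (\<lambda>_. 0) = (\<lambda>_. 0)"
    and tame_nonneg: "0 \<le> R \<Longrightarrow> 0 \<le> L R"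
    and tame_sup: "holder_bounded \<gamma> C1 u \<Longrightarrow> holder_bounded \<gamma> C2 v \<Longrightarrow> (\<And>x. norm (u x - v x) \<le> C) \<Longrightarrow>
        norm (G u x - G v x) \<le> L 0 * C"
    and tame_holder: "holder_bounded \<gamma> R v \<Longrightarrow> holder_bounded \<gamma> C (\<lambda>x. u x - v x) \<Longrightarrow>
        holder_bounded \<gamma> (L R * C) (\<lambda>x. G u x - G v x)"
  using assms unfolding tame_def by blast+

lemma holder_bounded_zero: "holder_bounded \<gamma> 0 (\<lambda>_. 0)"
  by (simp add: holder_bounded_def)

lemma holder_bounded_nonneg: "holder_bounded \<gamma> C u \<Longrightarrow> 0 \<le> C"
  unfolding holder_bounded_def using norm_ge_zero order_trans by blast

lemma holder_bounded_mono:
  assumes "holder_bounded \<gamma> C u" "C \<le> C'" shows "holder_bounded \<gamma> C' u"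
  using assms unfolding holder_bounded_def
  by (meson mult_right_mono order_trans powr_ge_zero)

lemma holder_bounded_add:
  assumes u: "holder_bounded \<gamma> C u" and v: "holder_bounded \<gamma> C' v"
  shows "holder_bounded \<gamma> (C + C') (\<lambda>x. u x + v x)"
  unfolding holder_bounded_def
proof (intro conjI allI)
  show "norm (u x + v x) \<le> C + C'" for x
    using u v by (intro norm_triangle_le add_mono) (auto simp: holder_bounded_def)
  show "norm (u x + v x - (u y + v y)) \<le> (C + C') * dist x y powr \<gamma>" for x y
  proof -
    have "norm (u x + v x - (u y + v y)) \<le> norm (u x - u y) + norm (v x - v y)" by (rule norm_diff_triangle_ineq)
    also have "\<dots> \<le> C * dist x y powr \<gamma> + C' * dist x y powr \<gamma>"
      using u v by (intro add_mono) (auto simp: holder_bounded_def)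
    finally show ?thesis by (simp add: distrib_right)
  qed
qed

lemma holder_bounded_linear_image:
  assumes f: "linear f" "\<And>y. norm (f y) \<le> K * norm y" and K: "0 \<le> K" and u: "holder_bounded \<gamma> C u"
  shows "holder_bounded \<gamma> (K * C) (\<lambda>x. f (u x))"
  unfolding holder_bounded_def
proof (intro conjI allI)
  show "norm (f (u x)) \<le> K * C" for x
    using f(2)[of "u x"] u K by (meson holder_bounded_def mult_left_mono order_trans)
  show "norm (f (u x) - f (u y)) \<le> K * C * dist x y powr \<gamma>" for x y
  proof -
    have "norm (f (u x) - f (u y)) \<le> K * norm (u x - u y)"
      using f(2)[of "u x - u y"] f(1) by (simp add: linear_diff)
    also have "\<dots> \<le> K * (C * dist x y powr \<gamma>)"
      using u K by (intro mult_left_mono) (auto simp: holder_bounded_def)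
    finally show ?thesis by simp
  qed
qed

lemma holder_bounded_mult:
  fixes m :: "'a::metric_space \<Rightarrow> real"
  assumes m: "holder_bounded \<gamma> a m" and u: "holder_bounded \<gamma> C u"
  shows "holder_bounded \<gamma> (2 * a * C) (\<lambda>x. m x *\<^sub>R u x)"
  unfolding holder_bounded_def
proof (intro conjI allI)
  have a0: "0 \<le> a" and C0: "0 \<le> C" using holder_bounded_nonneg m u by blast+
  have mb: "\<bar>m x\<bar> \<le> a" and ub: "norm (u x) \<le> C" for x using m u by (auto simp: holder_bounded_def)
  show "norm (m x *\<^sub>R u x) \<le> 2 * a * C" for x
  proof -
    have "norm (m x *\<^sub>R u x) \<le> a * C" using mb ub a0 by (simp add: mult_mono)
    also have "\<dots> \<le> 2 * a * C" using a0 C0 by simp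
    finally show ?thesis .
  qed
  show "norm (m x *\<^sub>R u x - m y *\<^sub>R u y) \<le> 2 * a * C * dist x y powr \<gamma>" for x y
  proof -
    have "m x *\<^sub>R u x - m y *\<^sub>R u y = m x *\<^sub>R (u x - u y) + (m x - m y) *\<^sub>R u y" by (simp add: algebra_simps)
    then have "norm (m x *\<^sub>R u x - m y *\<^sub>R u y) \<le> \<bar>m x\<bar> * norm (u x - u y) + \<bar>m x - m y\<bar> * norm (u y)"
      by (metis norm_scaleR norm_triangle_ineq)
    also have "\<dots> \<le> a * (C * dist x y powr \<gamma>) + (a * dist x y powr \<gamma>) * C"
      using m u mb ub a0 C0 by (intro add_mono mult_mono) (auto simp: holder_bounded_def)
    finally show ?thesis by (simp add: algebra_simps)
  qed
qed

lemma tame_growth: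
  assumes G: "tame \<gamma> L G" and u: "holder_bounded \<gamma> C u"
  shows "holder_bounded \<gamma> (L 0 * C) (G u)"
  using tame_holder[OF G holder_bounded_zero, of C u] u tame_zero[OF G] by (simp add: fun_eq_iff)

lemma tame_mono:
  assumes G: "tame \<gamma> L G" and le: "\<And>R. 0 \<le> R \<Longrightarrow> L R \<le> L' R"
  shows "tame \<gamma> L' G"
  unfolding tame_def
proof (intro conjI allI impI)
  show "0 \<le> L' R" if "0 \<le> R" for R using tame_nonneg[OF G that] le[OF that] by simp
  show "norm (G u x - G v x) \<le> L' 0 * C" if "holder_bounded \<gamma> C1 u" "holder_bounded \<gamma> C2 v"
    "\<forall>x. norm (u x - v x) \<le> C" for u v C1 C2 C x
  proof -
    have "0 \<le> C" using that(3) norm_ge_zero order_trans by blast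
    then show ?thesis
      using tame_sup[OF G that(1,2), of C x] that(3) le[of 0] mult_right_mono[of "L 0" "L' 0" C] by auto
  qed
  show "holder_bounded \<gamma> (L' R * C) (\<lambda>x. G u x - G v x)" if "holder_bounded \<gamma> R v"
    "holder_bounded \<gamma> C (\<lambda>x. u x - v x)" for u v R C
  proof (rule holder_bounded_mono[OF tame_holder[OF G that]])
    show "L R * C \<le> L' R * C" using le holder_bounded_nonneg that by (intro mult_right_mono) auto
  qed
qed (rule tame_zero[OF G])

text \<open>
  The outer estimate is applied at the size \<open>L 0 * R\<close> of the inner image of \<open>v\<close>.
\<close>

lemma tame_compose:
  assumes G: "tame \<gamma> L G" and H: "tame \<gamma> L' H"
  shows "tame \<gamma> (\<lambda>R. L' (L 0 * R) * L R) (\<lambda>u. H (G u))"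
  unfolding tame_def
proof (intro conjI allI impI)
  show "H (G (\<lambda>_. 0)) = (\<lambda>_. 0)" by (simp add: tame_zero[OF G] tame_zero[OF H])
  show "0 \<le> L' (L 0 * R) * L R" if "0 \<le> R" for R
    using tame_nonneg[OF G] tame_nonneg[OF H] that by simp
  show "norm (H (G u) x - H (G v) x) \<le> L' (L 0 * 0) * L 0 * C" if "holder_bounded \<gamma> C1 u" "holder_bounded \<gamma> C2 v"
    "\<forall>x. norm (u x - v x) \<le> C" for u v C1 C2 C x
  proof -
    have "norm (G u x - G v x) \<le> L 0 * C" for x using tame_sup[OF G that(1,2)] that(3) by blast
    then show ?thesis
      using tame_sup[OF H tame_growth[OF G that(1)] tame_growth[OF G that(2)], of "L 0 * C" x] by (simp add: mult.assoc)
  qed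
  show "holder_bounded \<gamma> (L' (L 0 * R) * L R * C) (\<lambda>x. H (G u) x - H (G v) x)" if "holder_bounded \<gamma> R v"
    "holder_bounded \<gamma> C (\<lambda>x. u x - v x)" for u v R C
    using tame_holder[OF H tame_growth[OF G that(1)] tame_holder[OF G that]] by (simp add: mult.assoc)
qed

lemma tame_add:
  assumes G: "tame \<gamma> L G" and H: "tame \<gamma> L' H"
  shows "tame \<gamma> (\<lambda>R. L R + L' R) (\<lambda>u x. G u x + H u x)"
  unfolding tame_def
proof (intro conjI allI impI)
  show "(\<lambda>x. G (\<lambda>_. 0) x + H (\<lambda>_. 0) x) = (\<lambda>_. 0)" by (simp add: tame_zero[OF G] tame_zero[OF H])
  show "0 \<le> L R + L' R" if "0 \<le> R" for R
    using tame_nonneg[OF G] tame_nonneg[OF H] that by simp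
  show "norm (G u x + H u x - (G v x + H v x)) \<le> (L 0 + L' 0) * C" if "holder_bounded \<gamma> C1 u" "holder_bounded \<gamma> C2 v"
    "\<forall>x. norm (u x - v x) \<le> C" for u v C1 C2 C x
  proof -
    have "norm (G u x - G v x) \<le> L 0 * C" using tame_sup[OF G that(1,2)] that(3) by blast
    moreover have "norm (H u x - H v x) \<le> L' 0 * C" using tame_sup[OF H that(1,2)] that(3) by blast
    ultimately show ?thesis
      using norm_diff_triangle_ineq[of "G u x" "H u x" "G v x" "H v x"] by (simp add: distrib_right)
  qed
  show "holder_bounded \<gamma> ((L R + L' R) * C) (\<lambda>x. G u x + H u x - (G v x + H v x))" if "holder_bounded \<gamma> R v"
    "holder_bounded \<gamma> C (\<lambda>x. u x - v x)" for u v R C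
    using holder_bounded_add[OF tame_holder[OF G that] tame_holder[OF H that]]
    by (simp add: distrib_right add_diff_add)
qed

lemma tame_linear_operator:
  assumes diff: "\<And>u v x. G u x - G v x = G (\<lambda>x. u x - v x) x" and K: "0 \<le> K"
    and sup: "\<And>u C x. (\<And>x. norm (u x) \<le> C) \<Longrightarrow> norm (G u x) \<le> K * C"
    and holder: "\<And>u C. holder_bounded \<gamma> C u \<Longrightarrow> holder_bounded \<gamma> (K * C) (G u)"
  shows "tame \<gamma> (\<lambda>_. K) G"
  unfolding tame_def
proof (intro conjI allI impI)
  show "G (\<lambda>_. 0) = (\<lambda>_. 0)" using diff[of "\<lambda>_. 0" _ "\<lambda>_. 0"] by (simp add: fun_eq_iff)
  show "norm (G u x - G v x) \<le> K * C" if "\<forall>x. norm (u x - v x) \<le> C" for u v C x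
    unfolding diff by (rule sup) (use that in blast)
  show "holder_bounded \<gamma> (K * C) (\<lambda>x. G u x - G v x)" if "holder_bounded \<gamma> C (\<lambda>x. u x - v x)" for u v C
    unfolding diff by (rule holder[OF that])
qed (rule K)

lemma tame_pointwise_linear:
  assumes f: "linear f" "\<And>y. norm (f y) \<le> K * norm y" and K: "0 \<le> K"
  shows "tame \<gamma> (\<lambda>_. K) (\<lambda>u x. f (u x))"
proof (rule tame_linear_operator)
  show "norm (f (u x)) \<le> K * C" if "\<And>x. norm (u x) \<le> C" for u C x
    using f(2)[of "u x"] mult_left_mono[OF that[of x] K] by simp
qed (use f K in \<open>auto simp: linear_diff intro: holder_bounded_linear_image\<close>)

lemma tame_multiplication:
  fixes m :: "'a::metric_space \<Rightarrow> real"
  assumes m: "holder_bounded \<gamma> a m"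
  shows "tame \<gamma> (\<lambda>_. 2 * a) (\<lambda>u x. m x *\<^sub>R u x)"
proof (rule tame_linear_operator)
  have a0: "0 \<le> a" using holder_bounded_nonneg m by blast
  then show "0 \<le> 2 * a" by simp
  show "norm (m x *\<^sub>R u x) \<le> 2 * a * C" if "\<And>x. norm (u x) \<le> C" for u C x
  proof -
    have C0: "0 \<le> C" using that norm_ge_zero order_trans by blast
    have "norm (m x *\<^sub>R u x) \<le> a * C" using m that[of x] a0 C0 by (simp add: holder_bounded_def mult_mono)
    also have "\<dots> \<le> 2 * a * C" using a0 C0 by simp
    finally show ?thesis .
  qed
qed (auto simp: scaleR_diff_right intro: holder_bounded_mult[OF m])

lemma holder_bounded_shift:
  fixes u :: "'a::real_normed_vector \<Rightarrow> 'b::real_normed_vector"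
  shows "holder_bounded \<gamma> C u \<Longrightarrow> holder_bounded \<gamma> C (\<lambda>x. u (x + z))"
  unfolding holder_bounded_def by (metis dist_add_cancel2)

lemma tame_shift:
  fixes z :: "'a::real_normed_vector"
  shows "tame \<gamma> (\<lambda>_. 1) (\<lambda>u x. u (x + z))"
  by (rule tame_linear_operator) (auto intro: holder_bounded_shift)

lemma tame_id: "tame \<gamma> (\<lambda>_. 1) (\<lambda>u. u)"
  by (rule tame_linear_operator) auto

lemma tame_uminus: "tame \<gamma> (\<lambda>_. 1) (\<lambda>u x. - u x)"
  by (rule tame_pointwise_linear) (auto intro!: linearI)

lemma tame_superposition:
  fixes h :: "real \<Rightarrow> real"
  assumes h0: "h 0 = 0" and K: "0 \<le> K"
    and lip: "\<And>a b. \<bar>h a - h b\<bar> \<le> K * \<bar>a - b\<bar>"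
    and sec: "\<And>a b c d. \<bar>h a - h b - (h c - h d)\<bar> \<le> K * \<bar>(a - b) - (c - d)\<bar> + K * \<bar>a - b\<bar> * \<bar>b - d\<bar>"
  shows "tame \<gamma> (\<lambda>R. K * (1 + R)) (\<lambda>u x. h (u x))"
  unfolding tame_def
proof (intro conjI allI impI)
  show "norm (h (u x) - h (v x)) \<le> K * (1 + 0) * C" if "\<forall>x. norm (u x - v x) \<le> C" for u v :: "'a \<Rightarrow> real" and C x
  proof -
    have "\<bar>h (u x) - h (v x)\<bar> \<le> K * \<bar>u x - v x\<bar>" by (rule lip)
    also have "\<dots> \<le> K * C" using that K by (intro mult_left_mono) auto
    finally show ?thesis by simp
  qed
  show "holder_bounded \<gamma> (K * (1 + R) * C) (\<lambda>x. h (u x) - h (v x))"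
    if v: "holder_bounded \<gamma> R v" and d: "holder_bounded \<gamma> C (\<lambda>x. u x - v x)" for u v :: "'a \<Rightarrow> real" and R C
    unfolding holder_bounded_def
  proof (intro conjI allI)
    have R0: "0 \<le> R" and C0: "0 \<le> C" using holder_bounded_nonneg v d by blast+
    have db: "\<bar>u x - v x\<bar> \<le> C" for x using d by (simp add: holder_bounded_def)
    show "norm (h (u x) - h (v x)) \<le> K * (1 + R) * C" for x
    proof -
      have "\<bar>h (u x) - h (v x)\<bar> \<le> K * \<bar>u x - v x\<bar>" by (rule lip)
      also have "\<dots> \<le> K * C" using db K by (intro mult_left_mono)
      also have "\<dots> \<le> K * (1 + R) * C" using K R0 C0 by (simp add: algebra_simps)
      finally show ?thesis by simp
    qed
    show "norm (h (u x) - h (v x) - (h (u y) - h (v y))) \<le> K * (1 + R) * C * dist x y powr \<gamma>" for x y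
    proof -
      have "\<bar>h (u x) - h (v x) - (h (u y) - h (v y))\<bar>
          \<le> K * \<bar>(u x - v x) - (u y - v y)\<bar> + K * \<bar>u x - v x\<bar> * \<bar>v x - v y\<bar>" by (rule sec)
      also have "\<dots> \<le> K * (C * dist x y powr \<gamma>) + K * C * (R * dist x y powr \<gamma>)"
        using v d db K C0 by (intro add_mono mult_mono) (auto simp: holder_bounded_def)
      finally show ?thesis by (simp add: algebra_simps)
    qed
  qed
qed (use h0 K in auto)

text \<open>
  Integration over a parameter keeps tameness if the constants factor into an integrable weight and a
  function of \<open>R\<close> common to all parameters.
\<close>

lemma tame_integral:
  fixes G :: "'i \<Rightarrow> ('a::metric_space \<Rightarrow> 'b::real_normed_vector) \<Rightarrow> 'a \<Rightarrow> 'c::euclidean_space"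
  assumes k: "integrable M k" "\<And>\<xi>. 0 \<le> k \<xi>" and L: "\<And>R. 0 \<le> R \<Longrightarrow> 0 \<le> L R"
    and G: "\<And>\<xi>. tame \<gamma> (\<lambda>R. k \<xi> * L R) (G \<xi>)"
    and meas: "\<And>C u x. holder_bounded \<gamma> C u \<Longrightarrow> (\<lambda>\<xi>. G \<xi> u x) \<in> borel_measurable M"
  shows "tame \<gamma> (\<lambda>R. (\<integral>\<xi>. k \<xi> \<partial>M) * L R) (\<lambda>u x. \<integral>\<xi>. G \<xi> u x \<partial>M)"
proof -
  have int: "integrable M (\<lambda>\<xi>. G \<xi> u x)" if u: "holder_bounded \<gamma> C u" for C u x
  proof (rule Bochner_Integration.integrable_bound[OF _ meas[OF u]])
    show "integrable M (\<lambda>\<xi>. k \<xi> * (L 0 * C))" using k(1) by simp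
    have "norm (G \<xi> u x) \<le> norm (k \<xi> * (L 0 * C))" for \<xi>
    proof -
      have "norm (G \<xi> u x) \<le> k \<xi> * L 0 * C"
        using tame_growth[OF G u] by (simp add: holder_bounded_def)
      then show ?thesis by (simp add: mult.assoc)
    qed
    then show "AE \<xi> in M. norm (G \<xi> u x) \<le> norm (k \<xi> * (L 0 * C))" by simp
  qed
  have bound: "norm (\<integral>\<xi>. w \<xi> \<partial>M) \<le> (\<integral>\<xi>. k \<xi> \<partial>M) * c"
    if w: "integrable M w" "\<And>\<xi>. norm (w \<xi>) \<le> k \<xi> * c" for w :: "'i \<Rightarrow> 'c" and c
  proof -
    have "norm (\<integral>\<xi>. w \<xi> \<partial>M) \<le> (\<integral>\<xi>. k \<xi> * c \<partial>M)"
      using w k(1) by (intro order_trans[OF integral_norm_bound integral_mono]) auto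
    then show ?thesis by simp
  qed
  show ?thesis
    unfolding tame_def
  proof (intro conjI allI impI)
    show "(\<lambda>x. \<integral>\<xi>. G \<xi> (\<lambda>_. 0) x \<partial>M) = (\<lambda>_. 0)" by (simp add: tame_zero[OF G])
    show "0 \<le> (\<integral>\<xi>. k \<xi> \<partial>M) * L R" if "0 \<le> R" for R using L[OF that] k(2) by simp
    show "norm ((\<integral>\<xi>. G \<xi> u x \<partial>M) - (\<integral>\<xi>. G \<xi> v x \<partial>M)) \<le> (\<integral>\<xi>. k \<xi> \<partial>M) * L 0 * C"
      if u: "holder_bounded \<gamma> C1 u" and v: "holder_bounded \<gamma> C2 v" and d: "\<forall>x. norm (u x - v x) \<le> C" for u v C1 C2 C x
    proof -
      have "norm (G \<xi> u x - G \<xi> v x) \<le> k \<xi> * (L 0 * C)" for \<xi>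
        using tame_sup[OF G u v, of C \<xi> x] d by (simp add: mult.assoc)
      then have "norm (\<integral>\<xi>. G \<xi> u x - G \<xi> v x \<partial>M) \<le> (\<integral>\<xi>. k \<xi> \<partial>M) * (L 0 * C)"
        using int[OF u] int[OF v] by (intro bound) auto
      then show ?thesis using int[OF u] int[OF v] by (simp add: mult.assoc)
    qed
    show "holder_bounded \<gamma> ((\<integral>\<xi>. k \<xi> \<partial>M) * L R * C) (\<lambda>x. (\<integral>\<xi>. G \<xi> u x \<partial>M) - (\<integral>\<xi>. G \<xi> v x \<partial>M))"
      if v: "holder_bounded \<gamma> R v" and d: "holder_bounded \<gamma> C (\<lambda>x. u x - v x)" for u v R C
    proof -
      have u: "holder_bounded \<gamma> (C + R) u" using holder_bounded_add[OF d v] by simp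
      note i = int[OF u] int[OF v]
      have t: "holder_bounded \<gamma> (k \<xi> * (L R * C)) (\<lambda>x. G \<xi> u x - G \<xi> v x)" for \<xi>
        using tame_holder[OF G v d] by (simp add: mult.assoc)
      have eq: "(\<integral>\<xi>. G \<xi> u x \<partial>M) - (\<integral>\<xi>. G \<xi> v x \<partial>M) = (\<integral>\<xi>. G \<xi> u x - G \<xi> v x \<partial>M)" for x
        using i by simp
      have "norm (\<integral>\<xi>. G \<xi> u x - G \<xi> v x \<partial>M) \<le> (\<integral>\<xi>. k \<xi> \<partial>M) * (L R * C)" for x
        using t i by (intro bound) (auto simp: holder_bounded_def)
      moreover have "norm ((\<integral>\<xi>. G \<xi> u x - G \<xi> v x \<partial>M) - (\<integral>\<xi>. G \<xi> u y - G \<xi> v y \<partial>M))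
          \<le> (\<integral>\<xi>. k \<xi> \<partial>M) * (L R * C) * dist x y powr \<gamma>" for x y
      proof -
        have "norm (\<integral>\<xi>. (G \<xi> u x - G \<xi> v x) - (G \<xi> u y - G \<xi> v y) \<partial>M)
            \<le> (\<integral>\<xi>. k \<xi> \<partial>M) * (L R * C * dist x y powr \<gamma>)"
          using t i by (intro bound) (auto simp: holder_bounded_def mult.assoc)
        then show ?thesis using i by (simp add: mult.assoc)
      qed
      ultimately show ?thesis unfolding holder_bounded_def eq by (simp add: mult.assoc)
    qed
  qed
qed

section \<open>Bond laws and the singular bond weight\<close>

text \<open>
  A comparison with balls of radius \<open>4^-k\<close>: where \<open>4^-(k+1) \<le> |\<xi>| < 4^-k\<close> the weight is at most \<open>8^(k+1)\<close>,
  while the volume of the larger ball is at most a multiple of \<open>16^-k\<close> in dimension at least two. The ratio four makes the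
  power \<open>3/2\<close> integral.
\<close>

lemma integrable_norm_powr_ball:
  assumes "2 \<le> CARD('n::finite)"
  shows "integrable lebesgue (\<lambda>\<xi>::real^'n. indicator (ball 0 1) \<xi> * norm \<xi> powr (-3/2))"
proof (rule integrableI_bounded)
  let ?f = "\<lambda>\<xi>::real^'n. indicator (ball 0 1) \<xi> * norm \<xi> powr (-3/2)"
  have "?f \<in> borel_measurable borel"
    by (intro borel_measurable_times borel_measurable_indicator powr_real_measurable) auto
  then show "?f \<in> borel_measurable lebesgue" by (simp add: measurable_completion)
  let ?V = "measure lebesgue (ball (0::real^'n) 1)"
  let ?g = "\<lambda>k. \<lambda>\<xi>::real^'n. ennreal (8 ^ Suc k) * indicator (ball 0 ((1/4)^k)) \<xi>"
  have pt: "ennreal (norm (?f \<xi>)) \<le> (\<Sum>k. ?g k \<xi>)" for \<xi>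
  proof (cases "\<xi> \<in> ball 0 1 \<and> \<xi> \<noteq> 0")
    case True
    then obtain n where "(1/4)^n < norm \<xi>" using real_arch_pow_inv[of "norm \<xi>" "1/4"] by auto
    then have ex: "\<exists>n. (1/4)^n \<le> norm \<xi>" by (auto intro: less_imp_le)
    define m where "m = (LEAST n. (1/4)^n \<le> norm \<xi>)"
    have m: "(1/4)^m \<le> norm \<xi>" unfolding m_def by (rule LeastI_ex[OF ex])
    have "m \<noteq> 0" using m True by (intro notI) simp
    then obtain k where k: "m = Suc k" using not0_implies_Suc by blast
    have "\<not> (1/4)^k \<le> norm \<xi>"
      using not_less_Least[of k "\<lambda>n. (1/4)^n \<le> norm \<xi>"] k unfolding m_def[symmetric] by simp
    then have ball: "\<xi> \<in> ball 0 ((1/4)^k)" by simp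
    have "norm \<xi> powr (-3/2) \<le> ((1/4)^m) powr (-3/2)"
      using m by (intro powr_mono2') auto
    also have "\<dots> = ((1/4) powr (-3/2)) ^ m"
      by (simp add: powr_power powr_realpow[symmetric] powr_powr mult.commute del: powr_realpow)
    also have "(1/4 :: real) powr (-3/2) = 8"
    proof -
      have "(1/4 :: real) = 2 powr (-2)" by (simp add: powr_minus powr_numeral)
      then have "(1/4 :: real) powr (-3/2) = 2 powr 3" by (simp only: powr_powr) simp
      then show ?thesis by simp
    qed
    finally have "norm (?f \<xi>) \<le> 8 ^ Suc k" using True by (simp add: k)
    then have "ennreal (norm (?f \<xi>)) \<le> ?g k \<xi>" using ball ennreal_leI by simp
    also have "\<dots> \<le> (\<Sum>k. ?g k \<xi>)"
    proof -
      have "a k \<le> suminf a" for a :: "nat \<Rightarrow> ennreal" using sum_le_suminf[of a "{k}"] by simp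
      then show ?thesis .
    qed
    finally show ?thesis .
  next
    case False
    then have "?f \<xi> = 0" by (cases "\<xi> = 0") simp_all
    then show ?thesis by (simp only: norm_zero ennreal_0 zero_le)
  qed
  have vol: "emeasure lebesgue (ball (0::real^'n) r) \<le> ennreal (?V * r^2)" if r: "0 \<le> r" "r \<le> 1" for r
  proof -
    have "measure lebesgue (ball (0::real^'n) r) = r ^ CARD('n) * ?V"
      using content_ball_conv_unit_ball[OF r(1), of "0::real^'n"] by simp
    also have "\<dots> \<le> r ^ 2 * ?V"
      using r assms by (intro mult_right_mono power_decreasing) auto
    finally have "ennreal (measure lebesgue (ball (0::real^'n) r)) \<le> ennreal (?V * r^2)"
      by (intro ennreal_leI) (simp add: mult.commute)
    then show ?thesis
      by (simp only: emeasure_eq_measure2[OF lmeasurable_ball])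
  qed
  have "(\<integral>\<^sup>+\<xi>. ennreal (norm (?f \<xi>)) \<partial>lebesgue) \<le> (\<integral>\<^sup>+\<xi>. (\<Sum>k. ?g k \<xi>) \<partial>lebesgue)"
    by (intro nn_integral_mono pt)
  also have "\<dots> = (\<Sum>k. \<integral>\<^sup>+\<xi>. ?g k \<xi> \<partial>lebesgue)"
    by (intro nn_integral_suminf borel_measurable_times_ennreal borel_measurable_const
        borel_measurable_indicator fmeasurableD[OF lmeasurable_ball])
  also have "\<dots> = (\<Sum>k. ennreal (8 ^ Suc k) * emeasure lebesgue (ball (0::real^'n) ((1/4)^k)))"
    by (simp only: nn_integral_cmult_indicator[OF fmeasurableD[OF lmeasurable_ball]])
  also have "\<dots> \<le> (\<Sum>k. ennreal (8 * ?V * (1/2)^k))"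
  proof (intro suminf_le summableI)
    fix k
    have "ennreal (8 ^ Suc k) * emeasure lebesgue (ball (0::real^'n) ((1/4)^k))
        \<le> ennreal (8 ^ Suc k) * ennreal (?V * ((1/4)^k)^2)"
      by (intro mult_left_mono vol) (auto simp: power_le_one)
    also have "\<dots> = ennreal (8 ^ Suc k * (?V * ((1/4)^k)^2))"
      by (simp add: ennreal_mult)
    also have "8 ^ Suc k * (?V * ((1/4)^k)^2) = 8 * ?V * ((8 * (1/4)^2)^k)"
    proof -
      have "((1/4 :: real)^k)^2 = ((1/4)^2)^k" by (simp only: power_mult[symmetric] mult.commute)
      then show ?thesis by (simp only: power_mult_distrib power_Suc mult_ac)
    qed
    also have "8 * (1/4)^2 = (1/2 :: real)" by (simp add: power2_eq_square)
    finally show "ennreal (8 ^ Suc k) * emeasure lebesgue (ball (0::real^'n) ((1/4)^k)) \<le> ennreal (8 * ?V * (1/2)^k)" .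
  qed
  also have "\<dots> = ennreal (\<Sum>k. 8 * ?V * (1/2)^k)"
    by (intro suminf_ennreal2 summable_mult summable_geometric) auto
  also have "\<dots> < \<infinity>" by simp
  finally show "(\<integral>\<^sup>+\<xi>. ennreal (norm (?f \<xi>)) \<partial>lebesgue) < \<infinity>" .
qed

text \<open>
  What the estimates need to know about \<open>f'\<close> and \<open>g'\<close>. Boundedness of \<open>h\<close> is not part of it, which lets the
  quadratic potential satisfy it too.
\<close>

definition bond_law :: "real \<Rightarrow> (real \<Rightarrow> real) \<Rightarrow> bool" where
  "bond_law K h \<longleftrightarrow> h 0 = 0 \<and> 0 \<le> K \<and> (\<forall>a b. \<bar>h a - h b\<bar> \<le> K * \<bar>a - b\<bar>) \<and>
     (\<forall>a b c d. \<bar>h a - h b - (h c - h d)\<bar> \<le> K * \<bar>(a - b) - (c - d)\<bar> + K * \<bar>a - b\<bar> * \<bar>b - d\<bar>)"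

lemma bond_lawI:
  fixes h h' :: "real \<Rightarrow> real"
  assumes "h 0 = 0" and h: "\<And>x. (h has_real_derivative h' x) (at x)"
    and h'_bd: "\<And>x. \<bar>h' x\<bar> \<le> K" and h'_lip: "\<And>x y. \<bar>h' x - h' y\<bar> \<le> K * \<bar>x - y\<bar>"
  shows "bond_law K h"
proof -
  have "0 \<le> K" using h'_bd[of 0] by simp
  moreover have "\<bar>h a - h b\<bar> \<le> K * \<bar>a - b\<bar>" for a b
    using field_differentiable_bound[of UNIV h h' K a b] h h'_bd by (auto simp: has_field_derivative_at_within)
  ultimately show ?thesis
    using assms(1) second_difference_bound[OF h h'_bd h'_lip] by (simp add: bond_law_def)
qed

lemma bond_law_convex_concave:
  assumes "convex_concave f" "bounded_derivs_upto 3 f"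
  shows "\<exists>K. bond_law K (deriv f)"
proof -
  have diff: "((deriv ^^ i) f has_real_derivative (deriv ^^ Suc i) f x) (at x)" if "i < 3" for i x
    using assms(2) that DERIV_deriv_iff_real_differentiable by (auto simp: bounded_derivs_upto_def)
  have bd: "\<exists>K. \<forall>x. \<bar>(deriv ^^ i) f x\<bar> \<le> K" if "i \<le> 3" for i
    using assms(2) that by (force simp: bounded_derivs_upto_def bounded_iff)
  obtain K2 K3 where K: "\<And>x. \<bar>(deriv ^^ 2) f x\<bar> \<le> K2" "\<And>x. \<bar>(deriv ^^ 3) f x\<bar> \<le> K3"
    using bd[of 2] bd[of 3] by auto
  have d1: "(deriv f has_real_derivative (deriv ^^ 2) f x) (at x)" for x
    using diff[of 1 x] by (simp add: numeral_2_eq_2)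
  have d2: "((deriv ^^ 2) f has_real_derivative (deriv ^^ 3) f x) (at x)" for x
    using diff[of 2 x] by (simp add: numeral_3_eq_3 numeral_2_eq_2)
  have "bond_law (max K2 K3) (deriv f)"
  proof (rule bond_lawI[OF _ d1])
    show "deriv f 0 = 0" using assms(1) DERIV_imp_deriv by (auto simp: convex_concave_def)
    show "\<bar>(deriv ^^ 2) f x\<bar> \<le> max K2 K3" for x using K(1)[of x] by simp
    show "\<bar>(deriv ^^ 2) f x - (deriv ^^ 2) f y\<bar> \<le> max K2 K3 * \<bar>x - y\<bar>" for x y
    proof -
      have "\<bar>(deriv ^^ 2) f x - (deriv ^^ 2) f y\<bar> \<le> K3 * \<bar>x - y\<bar>"
        using field_differentiable_bound[of UNIV "(deriv ^^ 2) f" "(deriv ^^ 3) f" K3 x y] d2 K(2)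
        by (auto simp: has_field_derivative_at_within)
      also have "\<dots> \<le> max K2 K3 * \<bar>x - y\<bar>" by (intro mult_right_mono) auto
      finally show ?thesis .
    qed
  qed
  then show ?thesis by blast
qed

lemma bond_law_quadratic:
  assumes "quadratic_potential g" shows "\<exists>K. bond_law K (deriv g)"
proof -
  obtain \<beta> where \<beta>: "\<beta> > 0" "g = (\<lambda>r. \<beta> * r\<^sup>2 / 2)"
    using assms unfolding quadratic_potential_def by blast
  have "(g has_real_derivative \<beta> * r) (at r)" for r
    unfolding \<beta>(2) by (auto intro!: derivative_eq_intros)
  then have "deriv g = (\<lambda>r. \<beta> * r)" by (auto intro: DERIV_imp_deriv)
  then have "bond_law \<beta> (deriv g)"
    using \<beta>(1) by (intro bond_lawI[of _ "\<lambda>_. \<beta>"]) (auto intro!: derivative_eq_intros)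
  then show ?thesis by blast
qed

lemma bond_law_continuous: assumes "bond_law K h" shows "continuous_on S h"
  by (rule lipschitz_on_continuous_on[of K], rule lipschitz_onI)
    (use assms in \<open>auto simp: bond_law_def dist_real_def\<close>)

lemma tame_bond_law: "bond_law K h \<Longrightarrow> tame \<gamma> (\<lambda>R. K * (1 + R)) (\<lambda>u x. h (u x))"
  by (rule tame_superposition) (auto simp: bond_law_def)

lemma bond_law_zero: "0 \<le> K \<Longrightarrow> bond_law K (\<lambda>_. 0)"
  by (simp add: bond_law_def)

text \<open>
  The scaling of the tensile law with \<open>r\<close> the square root of the bond length: the Lipschitz
  constant scales like \<open>r^-2\<close>, the second-difference constant like \<open>r^-3\<close>. The bound \<open>s\<close> on \<open>r\<close> merges them.
\<close>

lemma bond_law_rescale: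
  assumes h: "bond_law K h" and r: "0 < r" "r \<le> s" and j: "0 \<le> j" "j \<le> M"
  shows "bond_law (M * K * (1 + s) / r ^ 3) (\<lambda>a. j / r * h (a / r))"
proof -
  have K: "0 \<le> K" using h by (simp add: bond_law_def)
  define K' where "K' = M * K * (1 + s) / r ^ 3"
  have K'0: "0 \<le> K'" using K r j by (simp add: K'_def)
  have r2: "j / r * (K / r) \<le> K'"
  proof -
    have "j / r * (K / r) = j * K * r / r ^ 3" using r by (simp add: field_simps power3_eq_cube)
    also have "\<dots> \<le> M * K * (1 + s) / r ^ 3"
      using r j K by (intro divide_right_mono mult_mono) auto
    finally show ?thesis by (simp add: K'_def)
  qed
  have r3: "j / r * (K / r / r) \<le> K'"
  proof -
    have "j / r * (K / r / r) = j * K * 1 / r ^ 3" using r by (simp add: field_simps power3_eq_cube)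
    also have "\<dots> \<le> M * K * (1 + s) / r ^ 3"
      using r j K by (intro divide_right_mono mult_mono) auto
    finally show ?thesis by (simp add: K'_def)
  qed
  have jr: "0 \<le> j / r" using r j by simp
  have lip: "\<bar>j / r * h (a / r) - j / r * h (b / r)\<bar> \<le> K' * \<bar>a - b\<bar>" for a b
  proof -
    have "\<bar>j / r * h (a / r) - j / r * h (b / r)\<bar> = j / r * \<bar>h (a / r) - h (b / r)\<bar>"
      by (simp only: right_diff_distrib[symmetric] abs_mult abs_of_nonneg[OF jr])
    also have "\<dots> \<le> j / r * (K * \<bar>a / r - b / r\<bar>)"
      using h jr by (intro mult_left_mono) (auto simp: bond_law_def)
    also have "\<bar>a / r - b / r\<bar> = \<bar>a - b\<bar> / r" using r by (simp flip: diff_divide_distrib)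
    also have "j / r * (K * (\<bar>a - b\<bar> / r)) = j / r * (K / r) * \<bar>a - b\<bar>" by simp
    also have "\<dots> \<le> K' * \<bar>a - b\<bar>" using r2 by (intro mult_right_mono) auto
    finally show ?thesis .
  qed
  have sec: "\<bar>j / r * h (a / r) - j / r * h (b / r) - (j / r * h (c / r) - j / r * h (d / r))\<bar>
      \<le> K' * \<bar>(a - b) - (c - d)\<bar> + K' * \<bar>a - b\<bar> * \<bar>b - d\<bar>" for a b c d
  proof -
    have "\<bar>j / r * h (a / r) - j / r * h (b / r) - (j / r * h (c / r) - j / r * h (d / r))\<bar>
        = j / r * \<bar>h (a / r) - h (b / r) - (h (c / r) - h (d / r))\<bar>"
      by (simp only: right_diff_distrib[symmetric] abs_mult abs_of_nonneg[OF jr])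
    also have "\<dots> \<le> j / r * (K * \<bar>(a / r - b / r) - (c / r - d / r)\<bar> + K * \<bar>a / r - b / r\<bar> * \<bar>b / r - d / r\<bar>)"
      using h jr by (intro mult_left_mono) (auto simp: bond_law_def)
    also have "\<bar>(a / r - b / r) - (c / r - d / r)\<bar> = \<bar>(a - b) - (c - d)\<bar> / r"
      using r by (simp flip: diff_divide_distrib)
    also have "\<bar>a / r - b / r\<bar> = \<bar>a - b\<bar> / r" using r by (simp flip: diff_divide_distrib)
    also have "\<bar>b / r - d / r\<bar> = \<bar>b - d\<bar> / r" using r by (simp flip: diff_divide_distrib)
    also have "j / r * (K * (\<bar>(a - b) - (c - d)\<bar> / r) + K * (\<bar>a - b\<bar> / r) * (\<bar>b - d\<bar> / r))
        = j / r * (K / r) * \<bar>(a - b) - (c - d)\<bar> + j / r * (K / r / r) * (\<bar>a - b\<bar> * \<bar>b - d\<bar>)"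
      by (simp add: algebra_simps)
    also have "\<dots> \<le> K' * \<bar>(a - b) - (c - d)\<bar> + K' * (\<bar>a - b\<bar> * \<bar>b - d\<bar>)"
      using r2 r3 by (intro add_mono mult_right_mono) auto
    finally show ?thesis by (simp add: mult.assoc)
  qed
  show ?thesis
    unfolding K'_def[symmetric] using h K'0 lip sec by (simp add: bond_law_def)
qed

lemma borel_imp_lebesgue_measurable:
  "f \<in> borel_measurable borel \<Longrightarrow> f \<in> borel_measurable (lebesgue :: 'a::euclidean_space measure)"
  by (simp add: measurable_completion)



section \<open>The peridynamic force\<close>


lemma affine_shift_measurable:
  fixes v :: "real^'n \<Rightarrow> 'b::euclidean_space"
  assumes "continuous_on UNIV v"
  shows "(\<lambda>\<xi>. v (x + \<epsilon> *\<^sub>R \<xi>)) \<in> borel_measurable lebesgue"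
  by (intro borel_imp_lebesgue_measurable borel_measurable_continuous_onI
      continuous_on_compose2[OF assms] continuous_intros) auto

lemma sgn_measurable: "(sgn :: real^'n \<Rightarrow> real^'n) \<in> borel_measurable lebesgue"
  unfolding sgn_div_norm[abs_def]
  by (intro borel_imp_lebesgue_measurable borel_measurable_scaleR borel_measurable_inverse borel_measurable_norm) auto

lemma norm_sgn_le: "norm (sgn x) \<le> 1" for x :: "'a::real_normed_vector"
  by (simp add: norm_sgn)

lemma tame_bond_stretch:
  fixes z e :: "'a::euclidean_space"
  assumes e: "norm e \<le> 1"
  shows "tame \<gamma> (\<lambda>_. 2) (\<lambda>u x. (u (x + z) - u x) \<bullet> e)"
proof -
  have "tame \<gamma> (\<lambda>_. 1 + 1) (\<lambda>u x :: 'a. u (x + z) + - u x)"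
    by (rule tame_add[OF tame_shift tame_uminus])
  moreover have "tame \<gamma> (\<lambda>_. 1) (\<lambda>(w :: 'a \<Rightarrow> 'a) x. w x \<bullet> e)"
  proof (rule tame_pointwise_linear)
    show "linear (\<lambda>y. y \<bullet> e)" by (intro linearI) (auto simp: inner_add_left)
    show "norm (y \<bullet> e) \<le> 1 * norm y" for y
      using Cauchy_Schwarz_ineq2[of y e] mult_left_mono[OF e, of "norm y"] by simp
  qed simp
  ultimately show ?thesis using tame_compose by fastforce
qed

text \<open>
  A single bond, with direction \<open>e\<close> and endpoint \<open>x + z\<close>: a linear stretch, the bond law, the
  direction and the boundary weight, composed.
\<close>

lemma tame_bond_force:
  fixes \<omega> :: "'a::euclidean_space \<Rightarrow> real" and z e :: 'a
  assumes \<omega>: "holder_bounded \<gamma> a \<omega>" and e: "norm e \<le> 1" and H: "bond_law K H"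
  shows "tame \<gamma> (\<lambda>R. K * (4 * a * (1 + 2 * R))) (\<lambda>u x. \<omega> (x + z) *\<^sub>R (H ((u (x + z) - u x) \<bullet> e) *\<^sub>R e))"
proof -
  have lin: "tame \<gamma> (\<lambda>_. 1) (\<lambda>(w :: 'a \<Rightarrow> real) x. w x *\<^sub>R e)"
    by (rule tame_pointwise_linear) (auto intro!: linearI mult_right_le_one_le simp: scaleR_add_left e)
  have "tame \<gamma> (\<lambda>R. K * (1 + 2 * R) * 2) (\<lambda>u x. H ((u (x + z) - u x) \<bullet> e))"
    by (rule tame_compose[OF tame_bond_stretch[OF e] tame_bond_law[OF H]])
  from tame_compose[OF tame_compose[OF this lin] tame_multiplication[OF holder_bounded_shift[OF \<omega>, of z]]]
  show ?thesis by (rule tame_mono) (simp add: algebra_simps)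
qed

context
  fixes \<epsilon> \<gamma> M a :: real and J :: "real \<Rightarrow> real" and \<omega> :: "real^'n \<Rightarrow> real"
  assumes dim: "2 \<le> CARD('n)" and eps: "0 < \<epsilon>" and gamma: "0 < \<gamma>"
    and J_nonneg: "\<And>r. 0 \<le> r \<Longrightarrow> 0 \<le> J r" and J_bound: "\<And>r. 0 \<le> r \<Longrightarrow> r < 1 \<Longrightarrow> J r \<le> M"
    and J_meas: "(\<lambda>\<xi>::real^'n. J (norm \<xi>)) \<in> borel_measurable lebesgue"
    and \<omega>: "holder_bounded \<gamma> a \<omega>"
begin

lemma influence_bound_nonneg: "0 \<le> M" using J_nonneg[of 0] J_bound[of 0] by simp

lemma weight_bound_nonneg: "0 \<le> a" using holder_bounded_nonneg \<omega> by blast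

lemma indicator_ball_measurable: "(indicator (ball (0::real^'n) 1) :: _ \<Rightarrow> real) \<in> borel_measurable lebesgue"
  by (intro borel_measurable_indicator fmeasurableD[OF lmeasurable_ball])

lemma integrable_indicator_ball: "integrable lebesgue (\<lambda>\<xi>::real^'n. indicator (ball 0 1) \<xi> * M :: real)"
  using lmeasurable_ball[of "0::real^'n" 1] by (intro integrable_mult_left integrable_real_indicator) (auto simp: fmeasurable_def)

lemma cutoff_J: "0 \<le> indicator (ball 0 1) \<xi> * J (norm \<xi>)" "indicator (ball 0 1) \<xi> * J (norm \<xi>) \<le> indicator (ball 0 1) \<xi> * M"
  for \<xi> :: "real^'n"
  using J_nonneg[of "norm \<xi>"] J_bound[of "norm \<xi>"] by (auto simp: indicator_def)

lemma tame_hydrostatic_strain: "\<exists>L. tame \<gamma> (\<lambda>_. L) (hydrostatic_strain \<epsilon> \<omega> J)"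
proof -
  define c where "c = 1 / measure lebesgue (ball (0::real^'n) 1)"
  define G where "G \<xi> u x = \<omega> (x + \<epsilon> *\<^sub>R \<xi>) *\<^sub>R ((indicator (ball 0 1) \<xi> * J (norm \<xi>)) * ((u (x + \<epsilon> *\<^sub>R \<xi>) - u x) \<bullet> sgn \<xi>))"
    for \<xi> x :: "real^'n" and u :: "real^'n \<Rightarrow> real^'n"
  have G: "tame \<gamma> (\<lambda>_. indicator (ball 0 1) \<xi> * M * (4 * a)) (G \<xi>)" for \<xi>
  proof -
    have "tame \<gamma> (\<lambda>_. indicator (ball 0 1) \<xi> * M) (\<lambda>(w :: real^'n \<Rightarrow> real) x. (indicator (ball 0 1) \<xi> * J (norm \<xi>)) * w x)"
      using cutoff_J[of \<xi>] influence_bound_nonneg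
      by (intro tame_pointwise_linear linearI) (auto simp: abs_mult distrib_left mult_right_mono simp del: times_divide_eq_left)
    from tame_compose[OF tame_compose[OF tame_bond_stretch[OF norm_sgn_le] this] tame_multiplication[OF holder_bounded_shift[OF \<omega>]]]
    show ?thesis unfolding G_def[abs_def] by (rule tame_mono) simp
  qed
  have "tame \<gamma> (\<lambda>R. (LINT \<xi>|lebesgue. indicator (ball (0::real^'n) 1) \<xi> * M) * (4 * a)) (\<lambda>u x. LINT \<xi>|lebesgue. G \<xi> u x)"
  proof (rule tame_integral[OF integrable_indicator_ball])
    show "0 \<le> indicator (ball 0 1) \<xi> * M" for \<xi> :: "real^'n" using influence_bound_nonneg by simp
    show "0 \<le> 4 * a" using weight_bound_nonneg by simp
    fix C and u :: "real^'n \<Rightarrow> real^'n" and x assume "holder_bounded \<gamma> C u"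
    then have "continuous_on UNIV u" using holder_bounded_continuous gamma by blast
    then show "(\<lambda>\<xi>. G \<xi> u x) \<in> borel_measurable lebesgue"
      unfolding G_def
      by (intro borel_measurable_scaleR borel_measurable_times borel_measurable_inner borel_measurable_diff
          affine_shift_measurable holder_bounded_continuous[OF gamma \<omega>] indicator_ball_measurable J_meas
          sgn_measurable borel_measurable_const)
  qed (rule G)
  from tame_compose[OF this tame_pointwise_linear[of "\<lambda>y. c * y" "\<bar>c\<bar>"]]
  have "tame \<gamma> (\<lambda>_. \<bar>c\<bar> * ((LINT \<xi>|lebesgue. indicator (ball (0::real^'n) 1) \<xi> * M) * (4 * a)))
      (\<lambda>u x. c * (LINT \<xi>|lebesgue. G \<xi> u x))"
    by (simp add: abs_mult linear_times)
  moreover have "(\<lambda>u x. c * (LINT \<xi>|lebesgue. G \<xi> u x)) = hydrostatic_strain \<epsilon> \<omega> J"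
    unfolding hydrostatic_strain_def set_lebesgue_integral_def G_def c_def
    by (intro ext arg_cong2[where f = "(*)"] refl Bochner_Integration.integral_cong) simp_all
  ultimately show ?thesis by auto
qed

text \<open>
  The integrand without its factor \<open>\<omega>(x)\<close>, cut off to the unit ball, so that the integrals range over the whole
  space and the constants of the bonds form one integrable weight.
\<close>

definition tensile_kernel :: "(real \<Rightarrow> real) \<Rightarrow> real^'n \<Rightarrow> (real^'n \<Rightarrow> real^'n) \<Rightarrow> real^'n \<Rightarrow> real^'n" where
  "tensile_kernel h \<xi> u x = \<omega> (x + \<epsilon> *\<^sub>R \<xi>) *\<^sub>R
     ((indicator (ball 0 1) \<xi> * J (norm \<xi>) / sqrt (\<epsilon> * norm \<xi>) *
        h (((u (x + \<epsilon> *\<^sub>R \<xi>) - u x) \<bullet> sgn \<xi>) / sqrt (\<epsilon> * norm \<xi>))) *\<^sub>R sgn \<xi>)"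

text \<open>
  The rescaled law has a constant proportional to the length of the bond to the power \<open>-3/2\<close>, the
  weight whose integrability is known. Off the unit ball and at \<open>\<xi> = 0\<close>, where the quotient by the square
  root is zero, the law vanishes identically.
\<close>

lemma tame_tensile_integral:
  assumes h: "bond_law K h"
  shows "\<exists>L. tame \<gamma> L (\<lambda>u x. LINT \<xi>|lebesgue. tensile_kernel h \<xi> u x)"
proof -
  have K0: "0 \<le> K" using h by (simp add: bond_law_def)
  define k where "k \<xi> = M * K * (1 + sqrt \<epsilon>) * \<epsilon> powr (-3/2) * (indicator (ball 0 1) \<xi> * norm \<xi> powr (-3/2))" for \<xi> :: "real^'n"
  have k0: "0 \<le> k \<xi>" for \<xi> using influence_bound_nonneg K0 eps by (simp add: k_def)
  have kint: "integrable lebesgue k"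
    unfolding k_def using integrable_norm_powr_ball[OF dim] by (intro integrable_mult_right)
  have law: "bond_law (k \<xi>) (\<lambda>s. indicator (ball 0 1) \<xi> * J (norm \<xi>) / sqrt (\<epsilon> * norm \<xi>) * h (s / sqrt (\<epsilon> * norm \<xi>)))" for \<xi>
  proof (cases "\<xi> \<in> ball 0 1 \<and> \<xi> \<noteq> 0")
    case True
    define r where "r = sqrt (\<epsilon> * norm \<xi>)"
    have r: "0 < r" "r \<le> sqrt \<epsilon>" using True eps by (auto simp: r_def mult_left_le)
    have "r ^ 3 = (\<epsilon> * norm \<xi>) powr (3/2)"
    proof -
      have "r = (\<epsilon> * norm \<xi>) powr (1/2)" using eps by (simp add: r_def powr_half_sqrt)
      then show ?thesis by (simp only: power3_eq_cube powr_add[symmetric]) simp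
    qed
    then have r3: "1 / r ^ 3 = \<epsilon> powr (-3/2) * norm \<xi> powr (-3/2)"
      using eps by (simp add: powr_mult powr_minus_divide)
    have "M * K * (1 + sqrt \<epsilon>) / r ^ 3 = M * K * (1 + sqrt \<epsilon>) * (1 / r ^ 3)" by simp
    also have "\<dots> = k \<xi>" unfolding r3 k_def using True by simp
    finally have "M * K * (1 + sqrt \<epsilon>) / r ^ 3 = k \<xi>" .
    moreover have "bond_law (M * K * (1 + sqrt \<epsilon>) / r ^ 3) (\<lambda>s. J (norm \<xi>) / r * h (s / r))"
      using True r J_nonneg[of "norm \<xi>"] J_bound[of "norm \<xi>"] by (intro bond_law_rescale[OF h]) auto
    ultimately show ?thesis using True by (simp add: r_def)
  next
    case False
    then have "(\<lambda>s. indicator (ball 0 1) \<xi> * J (norm \<xi>) / sqrt (\<epsilon> * norm \<xi>) * h (s / sqrt (\<epsilon> * norm \<xi>))) = (\<lambda>_. 0)"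
      by (cases "\<xi> = 0") auto
    then show ?thesis using bond_law_zero[OF k0] by simp
  qed
  have hm: "h \<in> borel_measurable borel" by (intro borel_measurable_continuous_onI bond_law_continuous[OF h])
  have "tame \<gamma> (\<lambda>R. (LINT \<xi>|lebesgue. k \<xi>) * (4 * a * (1 + 2 * R))) (\<lambda>u x. LINT \<xi>|lebesgue. tensile_kernel h \<xi> u x)"
  proof (rule tame_integral[OF kint k0])
    show "0 \<le> 4 * a * (1 + 2 * R)" if "0 \<le> R" for R using that weight_bound_nonneg by simp
    show "tame \<gamma> (\<lambda>R. k \<xi> * (4 * a * (1 + 2 * R))) (tensile_kernel h \<xi>)" for \<xi>
      unfolding tensile_kernel_def[abs_def] by (rule tame_bond_force[OF \<omega> norm_sgn_le law])
    fix C and u :: "real^'n \<Rightarrow> real^'n" and x assume "holder_bounded \<gamma> C u"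
    then have "continuous_on UNIV u" using holder_bounded_continuous gamma by blast
    then show "(\<lambda>\<xi>. tensile_kernel h \<xi> u x) \<in> borel_measurable lebesgue"
      unfolding tensile_kernel_def
      by (intro borel_measurable_scaleR borel_measurable_times borel_measurable_divide borel_measurable_inner
          borel_measurable_diff affine_shift_measurable holder_bounded_continuous[OF gamma \<omega>]
          indicator_ball_measurable J_meas sgn_measurable borel_measurable_const
          measurable_compose[OF _ hm] borel_imp_lebesgue_measurable[of "\<lambda>\<xi>. sqrt (\<epsilon> * norm \<xi>)"]) auto
  qed
  then show ?thesis by blast
qed

definition dilatational_kernel :: "real^'n \<Rightarrow> (real^'n \<Rightarrow> real) \<Rightarrow> real^'n \<Rightarrow> real^'n" where
  "dilatational_kernel \<xi> v x = \<omega> (x + \<epsilon> *\<^sub>R \<xi>) *\<^sub>R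
     ((indicator (ball 0 1) \<xi> * J (norm \<xi>) * (v (x + \<epsilon> *\<^sub>R \<xi>) + v x)) *\<^sub>R sgn \<xi>)"

text \<open>
  The force is linear in \<open>g' \<circ> \<theta>\<close>, and \<open>\<theta>\<close> is linear in the displacement; the only nonlinear step is the
  superposition with \<open>g'\<close>.
\<close>

lemma tame_dilatational_integral:
  assumes h: "bond_law K h"
  shows "\<exists>L. tame \<gamma> L (\<lambda>u x. LINT \<xi>|lebesgue. dilatational_kernel \<xi> (\<lambda>y. h (hydrostatic_strain \<epsilon> \<omega> J u y)) x)"
proof -
  have G: "tame \<gamma> (\<lambda>_. indicator (ball 0 1) \<xi> * M * (4 * a)) (dilatational_kernel \<xi>)" for \<xi>
  proof -
    have sum: "tame \<gamma> (\<lambda>_. 1 + 1) (\<lambda>(v :: real^'n \<Rightarrow> real) x. v (x + \<epsilon> *\<^sub>R \<xi>) + v x)"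
      by (rule tame_add[OF tame_shift tame_id])
    have lin: "tame \<gamma> (\<lambda>_. indicator (ball 0 1) \<xi> * M)
        (\<lambda>(w :: real^'n \<Rightarrow> real) x. (indicator (ball 0 1) \<xi> * J (norm \<xi>) * w x) *\<^sub>R sgn \<xi>)"
    proof (rule tame_pointwise_linear)
      show "linear (\<lambda>y. (indicator (ball 0 1) \<xi> * J (norm \<xi>) * y) *\<^sub>R sgn \<xi>)"
        by (intro linearI) (auto simp: distrib_left scaleR_add_left)
      show "0 \<le> indicator (ball 0 1) \<xi> * M" using influence_bound_nonneg by simp
      show "norm ((indicator (ball 0 1) \<xi> * J (norm \<xi>) * y) *\<^sub>R sgn \<xi>) \<le> indicator (ball 0 1) \<xi> * M * norm y" for y
      proof -
        have "norm ((indicator (ball 0 1) \<xi> * J (norm \<xi>) * y) *\<^sub>R sgn \<xi>)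
            = (indicator (ball 0 1) \<xi> * J (norm \<xi>)) * \<bar>y\<bar> * norm (sgn \<xi>)"
          using cutoff_J(1)[of \<xi>] by (simp only: norm_scaleR abs_mult[of _ y] abs_of_nonneg)
        also have "\<dots> \<le> (indicator (ball 0 1) \<xi> * M) * \<bar>y\<bar> * 1"
        proof -
          have "c * \<bar>y\<bar> * s \<le> m * \<bar>y\<bar> * 1" if "0 \<le> c" "c \<le> m" "0 \<le> s" "s \<le> 1" for c m s :: real
            using that by (intro mult_mono) auto
          then show ?thesis using cutoff_J[of \<xi>] norm_sgn_le[of \<xi>] norm_ge_zero by blast
        qed
        finally show ?thesis by simp
      qed
    qed
    from tame_compose[OF tame_compose[OF sum lin] tame_multiplication[OF holder_bounded_shift[OF \<omega>]]]
    show ?thesis unfolding dilatational_kernel_def[abs_def] by (rule tame_mono) simp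
  qed
  have outer: "tame \<gamma> (\<lambda>R. (LINT \<xi>|lebesgue. indicator (ball (0::real^'n) 1) \<xi> * M) * (4 * a)) (\<lambda>v x. LINT \<xi>|lebesgue. dilatational_kernel \<xi> v x)"
  proof (rule tame_integral[OF integrable_indicator_ball])
    show "0 \<le> indicator (ball 0 1) \<xi> * M" for \<xi> :: "real^'n" using influence_bound_nonneg by simp
    show "0 \<le> 4 * a" using weight_bound_nonneg by simp
    fix C and v :: "real^'n \<Rightarrow> real" and x assume "holder_bounded \<gamma> C v"
    then have "continuous_on UNIV v" using holder_bounded_continuous gamma by blast
    then show "(\<lambda>\<xi>. dilatational_kernel \<xi> v x) \<in> borel_measurable lebesgue"
      unfolding dilatational_kernel_def
      by (intro borel_measurable_scaleR borel_measurable_times borel_measurable_add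
          affine_shift_measurable holder_bounded_continuous[OF gamma \<omega>] indicator_ball_measurable J_meas
          sgn_measurable borel_measurable_const)
  qed (rule G)
  obtain L where L: "tame \<gamma> (\<lambda>_. L) (hydrostatic_strain \<epsilon> \<omega> J)" using tame_hydrostatic_strain by blast
  show ?thesis using tame_compose[OF tame_compose[OF L tame_bond_law[OF h]] outer] by blast
qed

text \<open>
  Both forces carry \<open>\<omega>(x)\<close> in front of the integral. Splitting it off leaves a tame operator, whose values
  are bounded and continuous, and the factor makes the product vanish at the boundary of \<open>D\<close>.
\<close>

lemma peridynamic_force_factors:
  assumes f: "bond_law Kf (deriv f)" and g: "bond_law Kg (deriv g)"
  shows "\<exists>Q L. tame \<gamma> L Q \<and> (\<forall>u x. peridynamic_force \<epsilon> \<omega> J f g u x = \<omega> x *\<^sub>R Q u x)"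
proof -
  define V where "V = measure lebesgue (ball (0::real^'n) 1)"
  define QT where "QT u x = (2 / (\<epsilon> * V)) *\<^sub>R (LINT \<xi>|lebesgue. tensile_kernel (deriv f) \<xi> u x)" for u x
  define QD where "QD u x = (1 / (\<epsilon>\<^sup>2 * V)) *\<^sub>R
      (LINT \<xi>|lebesgue. dilatational_kernel \<xi> (\<lambda>y. deriv g (hydrostatic_strain \<epsilon> \<omega> J u y)) x)" for u x
  have scale: "tame \<gamma> (\<lambda>_. \<bar>c\<bar>) (\<lambda>(w :: real^'n \<Rightarrow> real^'n) x. c *\<^sub>R w x)" for c
    by (rule tame_pointwise_linear) (auto intro!: linearI simp: scaleR_add_right)
  obtain LT where LT: "tame \<gamma> LT QT"
    unfolding QT_def[abs_def] using tame_compose[OF _ scale] tame_tensile_integral[OF f] by blast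
  obtain LD where LD: "tame \<gamma> LD QD"
    unfolding QD_def[abs_def] using tame_compose[OF _ scale] tame_dilatational_integral[OF g] by blast
  have T: "tensile_force \<epsilon> \<omega> J f u x = \<omega> x *\<^sub>R QT u x" for u x
  proof -
    have "(LINT \<xi>:ball 0 1|lebesgue.
        (\<omega> x * \<omega> (x + \<epsilon> *\<^sub>R \<xi>) * (J (norm \<xi>) / sqrt (\<epsilon> * norm \<xi>)) *
         deriv f (((u (x + \<epsilon> *\<^sub>R \<xi>) - u x) \<bullet> sgn \<xi>) / sqrt (\<epsilon> * norm \<xi>))) *\<^sub>R sgn \<xi>)
      = (LINT \<xi>|lebesgue. \<omega> x *\<^sub>R tensile_kernel (deriv f) \<xi> u x)"
      unfolding set_lebesgue_integral_def tensile_kernel_def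
      by (intro Bochner_Integration.integral_cong refl) (simp add: mult_ac)
    then show ?thesis unfolding tensile_force_def QT_def V_def by simp
  qed
  have D: "dilatational_force \<epsilon> \<omega> J g u x = \<omega> x *\<^sub>R QD u x" for u x
  proof -
    have "(LINT \<xi>:ball 0 1|lebesgue.
        (\<omega> x * \<omega> (x + \<epsilon> *\<^sub>R \<xi>) * J (norm \<xi>) *
         (deriv g (hydrostatic_strain \<epsilon> \<omega> J u (x + \<epsilon> *\<^sub>R \<xi>)) +
          deriv g (hydrostatic_strain \<epsilon> \<omega> J u x))) *\<^sub>R sgn \<xi>)
      = (LINT \<xi>|lebesgue. \<omega> x *\<^sub>R dilatational_kernel \<xi> (\<lambda>y. deriv g (hydrostatic_strain \<epsilon> \<omega> J u y)) x)"
      unfolding set_lebesgue_integral_def dilatational_kernel_def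
      by (intro Bochner_Integration.integral_cong refl) (simp add: mult_ac)
    then show ?thesis unfolding dilatational_force_def QD_def V_def by simp
  qed
  have "peridynamic_force \<epsilon> \<omega> J f g u x = \<omega> x *\<^sub>R (QT u x + QD u x)" for u x
    by (simp add: peridynamic_force_def T D scaleR_add_right)
  then show ?thesis using tame_add[OF LT LD] by blast
qed

end

section \<open>Well-posedness of the peridynamic evolution\<close>

text \<open>
  The force lies in the closure of the compactly supported functions because of its factor \<open>\<omega>\<close>; there, Hoelder bounds
  on the whole space and the Hoelder norm over \<open>D\<close> agree up to the factor two, so the three estimates of
  tameness carry over.
\<close>

lemma force_on_C0_holder:
  fixes D :: "(real^'n) set" and \<omega> :: "(real^'n) \<Rightarrow>\<^sub>C real" and P :: "(real^'n \<Rightarrow> real^'n) \<Rightarrow> real^'n \<Rightarrow> real^'n"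
  assumes D: "open D" "D \<noteq> {}" and gamma: "0 < \<gamma>" and \<omega>: "\<omega> \<in> C0_holder \<gamma> D"
    and Q: "tame \<gamma> LQ Q" and P: "\<And>u x. P u x = \<omega> x *\<^sub>R Q u x"
  obtains L where "\<And>R. 0 \<le> R \<Longrightarrow> 0 \<le> L R"
    "\<And>u :: (real^'n) \<Rightarrow>\<^sub>C (real^'n). u \<in> C0_holder \<gamma> D \<Longrightarrow>
        Bcontfun (P u) \<in> C0_holder \<gamma> D \<and> holder_norm \<gamma> D (Bcontfun (P u)) \<le> L 0 * holder_norm \<gamma> D u"
    "\<And>u v :: (real^'n) \<Rightarrow>\<^sub>C (real^'n). u \<in> C0_holder \<gamma> D \<Longrightarrow> v \<in> C0_holder \<gamma> D \<Longrightarrow>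
        norm (Bcontfun (P u) - Bcontfun (P v)) \<le> L 0 * norm (u - v)"
    "\<And>R (u :: (real^'n) \<Rightarrow>\<^sub>C (real^'n)) v. u \<in> C0_holder \<gamma> D \<Longrightarrow> v \<in> C0_holder \<gamma> D \<Longrightarrow>
        u - v \<in> C0_holder \<gamma> D \<Longrightarrow> holder_norm \<gamma> D v \<le> R \<Longrightarrow>
        holder_norm \<gamma> D (Bcontfun (P u) - Bcontfun (P v)) \<le> L R * holder_norm \<gamma> D (u - v)"
proof -
  define a where "a = holder_norm \<gamma> D \<omega>"
  have \<omega>h: "holder_bounded \<gamma> a \<omega>"
    unfolding a_def by (rule holder_bounded_of_C0_holder[OF D gamma \<omega>])
  define LP where "LP R = 2 * a * LQ R" for R
  have PT: "tame \<gamma> LP P"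
    using tame_compose[OF Q tame_multiplication[OF \<omega>h]] unfolding LP_def P[symmetric] by simp
  have PH: "holder_bounded \<gamma> (LP 0 * holder_norm \<gamma> D u) (P u)" if "u \<in> C0_holder \<gamma> D" for u :: "(real^'n) \<Rightarrow>\<^sub>C (real^'n)"
    by (rule tame_growth[OF PT holder_bounded_of_C0_holder[OF D gamma that]])
  have app: "apply_bcontfun (Bcontfun (P u)) = P u" if "u \<in> C0_holder \<gamma> D" for u :: "(real^'n) \<Rightarrow>\<^sub>C (real^'n)"
    by (rule Bcontfun_inverse[OF holder_bounded_in_bcontfun[OF gamma PH[OF that]]])
  have C0: "Bcontfun (P u) \<in> C0_space D" if u: "u \<in> C0_holder \<gamma> D" for u :: "(real^'n) \<Rightarrow>\<^sub>C (real^'n)"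
  proof -
    have "Q u \<in> bcontfun"
      using holder_bounded_in_bcontfun[OF gamma tame_growth[OF Q holder_bounded_of_C0_holder[OF D gamma u]]] .
    then obtain q where q: "Q u = apply_bcontfun q" by (rule bcontfunE)
    show ?thesis
    proof (rule C0_space_mult)
      show "\<omega> \<in> C0_space D" using \<omega> by (simp add: C0_holder_def)
      show "Bcontfun (P u) x = \<omega> x *\<^sub>R q x" for x by (simp add: app[OF u] P q)
    qed
  qed
  show thesis
  proof (rule that[of "\<lambda>R. 2 * LP R"])
    show "0 \<le> 2 * LP R" if "0 \<le> R" for R using tame_nonneg[OF PT that] by simp
  next
    fix u :: "(real^'n) \<Rightarrow>\<^sub>C (real^'n)" assume u: "u \<in> C0_holder \<gamma> D"
    show "Bcontfun (P u) \<in> C0_holder \<gamma> D \<and> holder_norm \<gamma> D (Bcontfun (P u)) \<le> 2 * LP 0 * holder_norm \<gamma> D u"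
      using C0_holder_of_holder_bounded[OF D C0[OF u], of \<gamma> "LP 0 * holder_norm \<gamma> D u"] PH[OF u]
      by (simp add: app[OF u])
  next
    fix u v :: "(real^'n) \<Rightarrow>\<^sub>C (real^'n)" assume u: "u \<in> C0_holder \<gamma> D" and v: "v \<in> C0_holder \<gamma> D"
    have uv: "norm (u x - v x) \<le> norm (u - v)" for x
      using norm_bounded[of "u - v" x] by simp
    have "norm (P u x - P v x) \<le> LP 0 * norm (u - v)" for x
      by (rule tame_sup[OF PT holder_bounded_of_C0_holder[OF D gamma u] holder_bounded_of_C0_holder[OF D gamma v] uv])
    then have "norm (Bcontfun (P u) - Bcontfun (P v)) \<le> LP 0 * norm (u - v)"
      by (intro norm_bound) (simp add: app u v)
    also have "\<dots> \<le> 2 * LP 0 * norm (u - v)"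
      using tame_nonneg[OF PT, of 0] by (intro mult_right_mono) auto
    finally show "norm (Bcontfun (P u) - Bcontfun (P v)) \<le> 2 * LP 0 * norm (u - v)" .
  next
    fix R and u v :: "(real^'n) \<Rightarrow>\<^sub>C (real^'n)"
    assume u: "u \<in> C0_holder \<gamma> D" and v: "v \<in> C0_holder \<gamma> D" and uv: "u - v \<in> C0_holder \<gamma> D"
      and R: "holder_norm \<gamma> D v \<le> R"
    have "holder_bounded \<gamma> (LP R * holder_norm \<gamma> D (u - v)) (\<lambda>x. P u x - P v x)"
      using holder_bounded_of_C0_holder[OF D gamma uv]
      by (intro tame_holder[OF PT] holder_bounded_mono[OF holder_bounded_of_C0_holder[OF D gamma v] R])
        (simp add: minus_bcontfun.rep_eq[abs_def])
    moreover have "Bcontfun (P u) - Bcontfun (P v) \<in> C0_space D"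
      using subspace_diff[OF subspace_C0_space C0[OF u] C0[OF v]] .
    ultimately show "holder_norm \<gamma> D (Bcontfun (P u) - Bcontfun (P v)) \<le> 2 * LP R * holder_norm \<gamma> D (u - v)"
      using C0_holder_of_holder_bounded[OF D, of "Bcontfun (P u) - Bcontfun (P v)" \<gamma> "LP R * holder_norm \<gamma> D (u - v)"]
      by (simp add: app u v minus_bcontfun.rep_eq[abs_def])
  qed
qed

lemma X_norm_zero_Pair:
  fixes D :: "'a::euclidean_space set" and v :: "'a \<Rightarrow>\<^sub>C 'b::real_normed_vector"
  assumes D: "open D" "D \<noteq> {}"
  shows "X_norm \<gamma> D (0, v) = holder_norm \<gamma> D v" and "(0 :: 'a \<Rightarrow>\<^sub>C 'b) \<in> C0_holder \<gamma> D"
proof -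
  have z: "(0 :: 'a \<Rightarrow>\<^sub>C 'b) \<in> C0_holder \<gamma> D \<and> holder_norm \<gamma> D (0 :: 'a \<Rightarrow>\<^sub>C 'b) \<le> 2 * 0"
    using subspace_0[OF subspace_C0_space]
    by (intro C0_holder_of_holder_bounded[OF D]) (auto simp: holder_bounded_def)
  moreover have "0 \<le> holder_norm \<gamma> D (0 :: 'a \<Rightarrow>\<^sub>C 'b)"
    using norm_le_holder_norm[OF D, of "0 :: 'a \<Rightarrow>\<^sub>C 'b"] z by simp
  ultimately show "X_norm \<gamma> D (0, v) = holder_norm \<gamma> D v" "(0 :: 'a \<Rightarrow>\<^sub>C 'b) \<in> C0_holder \<gamma> D"
    by (auto simp: X_norm_def)
qed

theorem theorem1:
  fixes D :: "(real^'n) set"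
    and \<epsilon> \<gamma> T :: real
    and \<omega> :: "(real^'n) \<Rightarrow>\<^sub>C real"
    and J f g :: "real \<Rightarrow> real"
    and x0 :: "((real^'n) \<Rightarrow>\<^sub>C (real^'n)) \<times> ((real^'n) \<Rightarrow>\<^sub>C (real^'n))"
    and b :: "real \<Rightarrow> ((real^'n) \<Rightarrow>\<^sub>C (real^'n))"
  defines "I\<^sub>0 \<equiv> {-T<..<T}"
    and "X \<equiv> X_space \<gamma> D"
    and "N \<equiv> X_norm \<gamma> D"
    and "F \<equiv> F_peri \<epsilon> \<omega> J f g b"
  assumes dim: "CARD('n) \<in> {2, 3}"
    and D: "open D" "D \<noteq> {}"
    and eps: "\<epsilon> > 0"
    and gamma: "0 < \<gamma>" "\<gamma> \<le> 1"
    and T: "T > 0"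
    and J: "influence_function TYPE('n) J"
    and \<omega>: "boundary_function \<epsilon> \<gamma> D \<omega>"
    and f: "convex_concave f" "bounded_derivs_upto 3 f"
    and g: "quadratic_potential g \<or> (convex_concave g \<and> bounded_derivs_upto 3 g)"
    and x0: "x0 \<in> X"
    and b: "b ` I\<^sub>0 \<subseteq> C0_holder \<gamma> D" "continuous_wrt (holder_norm \<gamma> D) I\<^sub>0 b"
      "bdd_above ((\<lambda>t. holder_norm \<gamma> D (b t)) ` I\<^sub>0)"
  shows "(\<exists>y y'. C1_wrt X N I\<^sub>0 y y' \<and> solves_integral_eq X N I\<^sub>0 F x0 y \<and>
            (\<forall>z z'. C1_wrt X N I\<^sub>0 z z' \<and> solves_integral_eq X N I\<^sub>0 F x0 z \<longrightarrow> (\<forall>t\<in>I\<^sub>0. z t = y t)) \<and>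
            lipschitz_wrt N I\<^sub>0 y \<and>
            (lipschitz_wrt N I\<^sub>0 y' \<longleftrightarrow> lipschitz_wrt (holder_norm \<gamma> D) I\<^sub>0 b)) \<and>
         (\<forall>z z'. C1_wrt X N I\<^sub>0 z z' \<longrightarrow>
            (solves_integral_eq X N I\<^sub>0 F x0 z \<longleftrightarrow> solves_ivp I\<^sub>0 F x0 z z'))"
proof -
  have \<omega>C: "\<omega> \<in> C0_holder \<gamma> D" using \<omega> by (simp add: boundary_function_def)
  obtain Kf where Kf: "bond_law Kf (deriv f)" using bond_law_convex_concave[OF f] by blast
  obtain Kg where Kg: "bond_law Kg (deriv g)"
    using g bond_law_convex_concave bond_law_quadratic by blast
  obtain M where M: "\<And>r. 0 \<le> r \<Longrightarrow> r < 1 \<Longrightarrow> J r \<le> M" using J unfolding influence_function_def by blast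
  have dim2: "2 \<le> CARD('n)" using dim by auto
  have J_nonneg: "0 \<le> J r" if "0 \<le> r" for r using J that by (simp add: influence_function_def)
  have J_meas: "(\<lambda>\<xi>::real^'n. J (norm \<xi>)) \<in> borel_measurable lebesgue"
    using J by (simp add: influence_function_def)
  have "\<exists>Q L. tame \<gamma> L Q \<and> (\<forall>u x. peridynamic_force \<epsilon> \<omega> J f g u x = \<omega> x *\<^sub>R Q u x)"
    by (rule peridynamic_force_factors[OF dim2 eps gamma(1) J_nonneg M J_meas
          holder_bounded_of_C0_holder[OF D gamma(1) \<omega>C] Kf Kg])
  then obtain Q LQ where Q: "tame \<gamma> LQ Q" "\<And>u x. peridynamic_force \<epsilon> \<omega> J f g u x = \<omega> x *\<^sub>R Q u x"
    by (elim exE conjE) simp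
  let ?P = "peridynamic_force \<epsilon> \<omega> J f g"
  obtain L where L0: "\<And>R. 0 \<le> R \<Longrightarrow> 0 \<le> L R"
    and L1: "\<And>u :: (real^'n) \<Rightarrow>\<^sub>C (real^'n). u \<in> C0_holder \<gamma> D \<Longrightarrow>
        Bcontfun (?P u) \<in> C0_holder \<gamma> D \<and> holder_norm \<gamma> D (Bcontfun (?P u)) \<le> L 0 * holder_norm \<gamma> D u"
    and L2: "\<And>u v :: (real^'n) \<Rightarrow>\<^sub>C (real^'n). u \<in> C0_holder \<gamma> D \<Longrightarrow> v \<in> C0_holder \<gamma> D \<Longrightarrow>
        norm (Bcontfun (?P u) - Bcontfun (?P v)) \<le> L 0 * norm (u - v)"
    and L3: "\<And>R (u :: (real^'n) \<Rightarrow>\<^sub>C (real^'n)) v. u \<in> C0_holder \<gamma> D \<Longrightarrow> v \<in> C0_holder \<gamma> D \<Longrightarrow>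
        u - v \<in> C0_holder \<gamma> D \<Longrightarrow> holder_norm \<gamma> D v \<le> R \<Longrightarrow>
        holder_norm \<gamma> D (Bcontfun (?P u) - Bcontfun (?P v)) \<le> L R * holder_norm \<gamma> D (u - v)"
    by (rule force_on_C0_holder[OF D gamma(1) \<omega>C Q], rule that) assumption+
  \<comment> \<open>The system as an autonomous field plus a forcing in the velocity component.\<close>
  define A where "A y = (snd y, Bcontfun (?P (fst y)))" for y :: "((real^'n) \<Rightarrow>\<^sub>C (real^'n)) \<times> ((real^'n) \<Rightarrow>\<^sub>C (real^'n))"
  define \<beta> where "\<beta> t = (0 :: (real^'n) \<Rightarrow>\<^sub>C (real^'n), b t)" for t
  obtain B where B: "\<And>t. t \<in> I\<^sub>0 \<Longrightarrow> holder_norm \<gamma> D (b t) \<le> B"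
    using b(3) by (auto simp: bdd_above_def)
  interpret X: normed_subspace X N
    unfolding X_def N_def by (rule normed_subspace_X_space[OF D])
  have hn0: "0 \<le> holder_norm \<gamma> D u" if "u \<in> C0_holder \<gamma> D" for u :: "(real^'n) \<Rightarrow>\<^sub>C (real^'n)"
    using norm_le_holder_norm[OF D that] norm_ge_zero order_trans by blast
  have XI: "y \<in> X \<longleftrightarrow> fst y \<in> C0_holder \<gamma> D \<and> snd y \<in> C0_holder \<gamma> D" for y
    by (cases y) (simp add: X_def X_space_def)
  have N: "N y = holder_norm \<gamma> D (fst y) + holder_norm \<gamma> D (snd y)" for y
    by (simp add: N_def X_norm_def)
  have N\<beta>: "N (\<beta> s - \<beta> t) = holder_norm \<gamma> D (b s - b t)" "N (\<beta> t) = holder_norm \<gamma> D (b t)" for s t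
    unfolding N_def \<beta>_def using X_norm_zero_Pair(1)[OF D] by simp_all
  interpret forced_evolution X N A \<beta> T "1 + L 0" B
  proof
    show "0 < T" by (rule T)
    show "0 < 1 + L 0" using L0[of 0] by simp
    fix x assume x: "x \<in> X"
    then show "A x \<in> X" using L1[of "fst x"] by (simp add: XI A_def)
    have "N (A x) \<le> holder_norm \<gamma> D (snd x) + L 0 * holder_norm \<gamma> D (fst x)"
      using x L1[of "fst x"] by (simp add: N A_def XI)
    also have "\<dots> \<le> (1 + L 0) * N x"
      using x L0[of 0] hn0[of "fst x"] hn0[of "snd x"] by (simp add: N XI algebra_simps)
    finally show "N (A x) \<le> (1 + L 0) * N x" .
    fix y assume y: "y \<in> X"
    have "norm (A x - A y) \<le> norm (snd x - snd y) + norm (Bcontfun (?P (fst x)) - Bcontfun (?P (fst y)))"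
      unfolding A_def by (simp add: norm_Pair_le)
    also have "\<dots> \<le> norm (x - y) + L 0 * norm (x - y)"
    proof (intro add_mono)
      show "norm (snd x - snd y) \<le> norm (x - y)" using dist_snd_le[of x y] by (simp add: dist_norm)
      have "norm (Bcontfun (?P (fst x)) - Bcontfun (?P (fst y))) \<le> L 0 * norm (fst x - fst y)"
        using x y by (intro L2) (auto simp: XI)
      also have "\<dots> \<le> L 0 * norm (x - y)"
        using dist_fst_le[of x y] L0[of 0] by (intro mult_left_mono) (auto simp: dist_norm)
      finally show "norm (Bcontfun (?P (fst x)) - Bcontfun (?P (fst y))) \<le> L 0 * norm (x - y)" .
    qed
    finally show "norm (A x - A y) \<le> (1 + L 0) * norm (x - y)" by (simp add: distrib_right)
  next
    fix R
    have "N (A x - A y) \<le> (1 + L (max R 0)) * N (x - y)" if x: "x \<in> X" and y: "y \<in> X" and R: "N y \<le> R" for x y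
    proof -
      have xy: "x - y \<in> X" using X.X_diff x y by blast
      have "holder_norm \<gamma> D (fst y) \<le> max R 0"
        using R y hn0[of "snd y"] by (simp add: N XI)
      then have "holder_norm \<gamma> D (Bcontfun (?P (fst x)) - Bcontfun (?P (fst y))) \<le> L (max R 0) * holder_norm \<gamma> D (fst x - fst y)"
        using x y xy by (intro L3) (auto simp: XI)
      then have "N (A x - A y) \<le> holder_norm \<gamma> D (snd x - snd y) + L (max R 0) * holder_norm \<gamma> D (fst x - fst y)"
        by (simp add: N A_def)
      also have "\<dots> \<le> (1 + L (max R 0)) * N (x - y)"
        using xy L0[of "max R 0"] hn0[of "fst (x - y)"] hn0[of "snd (x - y)"] by (simp add: N XI algebra_simps)
      finally show ?thesis .
    qed
    then show "\<exists>K\<ge>0. \<forall>x\<in>X. \<forall>y\<in>X. N x \<le> R \<longrightarrow> N y \<le> R \<longrightarrow> N (A x - A y) \<le> K * N (x - y)"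
      using L0[of "max R 0"] by (intro exI[of _ "1 + L (max R 0)"]) auto
  next
    show "\<beta> t \<in> X" if "t \<in> {-T<..<T}" for t
      using b(1) that X_norm_zero_Pair(2)[OF D] by (auto simp: XI \<beta>_def I\<^sub>0_def)
    show "N (\<beta> t) \<le> B" if "t \<in> {-T<..<T}" for t using B[of t] that by (simp add: N\<beta> I\<^sub>0_def)
    show "continuous_wrt N {-T<..<T} \<beta>"
      using b(2) by (simp add: continuous_wrt_def N\<beta> I\<^sub>0_def)
  qed
  have F: "F = (\<lambda>y t. A y + \<beta> t)"
    by (intro ext) (simp add: F_def F_peri_def A_def \<beta>_def)
  have lip\<beta>: "lipschitz_wrt N I\<^sub>0 \<beta> \<longleftrightarrow> lipschitz_wrt (holder_norm \<gamma> D) I\<^sub>0 b"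
    by (simp add: lipschitz_wrt_def N\<beta>)
  show ?thesis
    unfolding F lip\<beta>[symmetric] unfolding I\<^sub>0_def
    by (intro conjI allI impI forced_evolution_well_posed[OF x0])
qed

end
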